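(* Let $\varphi:A\to B$ be a ring epimorphism, where $A$ is right (or left) perfect and $B$ is semilocal. Suppose that $B$ is basic, that is, $B/\mathrm{rad}(B)$ is a product of skew-fields. Then $\varphi$ is surjective. Moreover, if $\varphi$ is a homological epimorphism, then its kernel is a stratifying ideal, i.e. $\ker\varphi=AeA$ for some idempotent $e\in A$.
   Context: Rings are associative and unital. A ring epimorphism is an epimorphism in the category of rings. A ring $R$ is semilocal if $R/\mathrm{rad}(R)$ is semisimple artinian, and right perfect if moreover $\mathrm{rad}(R)$ is left T-nilpotent (for every sequence $a_1,a_2,\dots$ in $\mathrm{rad}(R)$ there is $n$ with $a_na_{n-1}\cdots a_1=0$); left perfect is defined symmetrically. A ring homomorphism $\varphi:A\to B$ is a homological epimorphism if it is a ring epimorphism and $\mathrm{Tor}^A_i(B,B)=0$ for all $i\ge1$. An ideal $I=AeA$ with $e=e^2$ is a stratifying ideal if the projection $A\to A/AeA$ is a homological epimorphism. *)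

theory Defs
  imports "HOL-Algebra.Algebra"
begin

definition lideal :: "('a, 'm) ring_scheme \<Rightarrow> 'a set \<Rightarrow> bool" where
  "lideal R L \<longleftrightarrow> additive_subgroup L R \<and> (\<forall>r\<in>carrier R. \<forall>x\<in>L. r \<otimes>\<^bsub>R\<^esub> x \<in> L)"

definition maximal_lideal :: "('a, 'm) ring_scheme \<Rightarrow> 'a set \<Rightarrow> bool" where
  "maximal_lideal R L \<longleftrightarrow> lideal R L \<and> L \<noteq> carrier R \<and>
     (\<forall>L'. lideal R L' \<and> L \<subseteq> L' \<and> L' \<noteq> carrier R \<longrightarrow> L' = L)"

definition jacobson_rad :: "('a, 'm) ring_scheme \<Rightarrow> 'a set" where
  "jacobson_rad R = carrier R \<inter> \<Inter>{L. maximal_lideal R L}"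

definition semisimple_ring :: "('a, 'm) ring_scheme \<Rightarrow> bool" where
  "semisimple_ring R \<longleftrightarrow> ring R \<and>
     (\<forall>L. lideal R L \<longrightarrow> (\<exists>L'. lideal R L' \<and> L \<inter> L' = {\<zero>\<^bsub>R\<^esub>} \<and>
        {x \<oplus>\<^bsub>R\<^esub> y | x y. x \<in> L \<and> y \<in> L'} = carrier R))"

definition semilocal :: "('a, 'm) ring_scheme \<Rightarrow> bool" where
  "semilocal R \<longleftrightarrow> ring R \<and> semisimple_ring (R Quot jacobson_rad R)"

primrec lprod :: "('a, 'm) ring_scheme \<Rightarrow> (nat \<Rightarrow> 'a) \<Rightarrow> nat \<Rightarrow> 'a" where
  "lprod R a 0 = a 0"
| "lprod R a (Suc n) = a (Suc n) \<otimes>\<^bsub>R\<^esub> lprod R a n"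

primrec rprod :: "('a, 'm) ring_scheme \<Rightarrow> (nat \<Rightarrow> 'a) \<Rightarrow> nat \<Rightarrow> 'a" where
  "rprod R a 0 = a 0"
| "rprod R a (Suc n) = rprod R a n \<otimes>\<^bsub>R\<^esub> a (Suc n)"

definition left_T_nilpotent :: "('a, 'm) ring_scheme \<Rightarrow> 'a set \<Rightarrow> bool" where
  "left_T_nilpotent R S \<longleftrightarrow> (\<forall>a. (\<forall>n. a n \<in> S) \<longrightarrow> (\<exists>n. lprod R a n = \<zero>\<^bsub>R\<^esub>))"

definition right_T_nilpotent :: "('a, 'm) ring_scheme \<Rightarrow> 'a set \<Rightarrow> bool" where
  "right_T_nilpotent R S \<longleftrightarrow> (\<forall>a. (\<forall>n. a n \<in> S) \<longrightarrow> (\<exists>n. rprod R a n = \<zero>\<^bsub>R\<^esub>))"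

definition right_perfect :: "('a, 'm) ring_scheme \<Rightarrow> bool" where
  "right_perfect R \<longleftrightarrow> semilocal R \<and> left_T_nilpotent R (jacobson_rad R)"

definition left_perfect :: "('a, 'm) ring_scheme \<Rightarrow> bool" where
  "left_perfect R \<longleftrightarrow> semilocal R \<and> right_T_nilpotent R (jacobson_rad R)"

definition division_ring :: "('a, 'm) ring_scheme \<Rightarrow> bool" where
  "division_ring D \<longleftrightarrow> ring D \<and> \<one>\<^bsub>D\<^esub> \<noteq> \<zero>\<^bsub>D\<^esub> \<and>
     (\<forall>x \<in> carrier D - {\<zero>\<^bsub>D\<^esub>}. x \<in> Units D)"

definition prod_ring :: "'i set \<Rightarrow> ('i \<Rightarrow> ('c, 'n) ring_scheme) \<Rightarrow> ('i \<Rightarrow> 'c) ring" where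
  "prod_ring I D =
     \<lparr>carrier = PiE I (\<lambda>i. carrier (D i)),
      monoid.mult = (\<lambda>f g. restrict (\<lambda>i. f i \<otimes>\<^bsub>D i\<^esub> g i) I),
      monoid.one = restrict (\<lambda>i. \<one>\<^bsub>D i\<^esub>) I,
      ring.zero = restrict (\<lambda>i. \<zero>\<^bsub>D i\<^esub>) I,
      ring.add = (\<lambda>f g. restrict (\<lambda>i. f i \<oplus>\<^bsub>D i\<^esub> g i) I)\<rparr>"

definition basic_ring :: "('a, 'm) ring_scheme \<Rightarrow> bool" where
  "basic_ring R \<longleftrightarrow> (\<exists>(I :: nat set) (D :: nat \<Rightarrow> 'a set ring).
     finite I \<and> (\<forall>i\<in>I. division_ring (D i)) \<and>
     (R Quot jacobson_rad R) \<simeq> prod_ring I D)"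

text \<open>Epimorphism in the category of rings.  The test rings C range over rings whose
  elements are of type 'b list; this type has cardinality at least
  max(|B|, aleph_0), which is enough to contain an isomorphic copy of the subring generated by
  the images of any two homomorphisms out of B, so nothing is lost.\<close>
definition ring_epi :: "('a, 'm) ring_scheme \<Rightarrow> ('b, 'n) ring_scheme \<Rightarrow> ('a \<Rightarrow> 'b) \<Rightarrow> bool" where
  "ring_epi A B \<phi> \<longleftrightarrow> ring A \<and> ring B \<and> \<phi> \<in> ring_hom A B \<and>
     (\<forall>(C :: 'b list ring) f g. ring C \<longrightarrow> f \<in> ring_hom B C \<longrightarrow> g \<in> ring_hom B C \<longrightarrow>
        (\<forall>a\<in>carrier A. f (\<phi> a) = g (\<phi> a)) \<longrightarrow> (\<forall>b\<in>carrier B. f b = g b))"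

text \<open>Finitely supported families on X with values in S (zero element z):
  the free module S^(X).\<close>
definition fin_elems :: "'c set \<Rightarrow> 'c \<Rightarrow> 'i set \<Rightarrow> ('i \<Rightarrow> 'c) set" where
  "fin_elems S z Xs = {v. (\<forall>i. v i \<in> S) \<and> (\<forall>i. i \<notin> Xs \<longrightarrow> v i = z) \<and> finite {i. v i \<noteq> z}}"

text \<open>A right A-linear map between free right modules A^(Y) -> A^(X), given by
  the images d y \<in> A^(X) of the basis vectors y: v = sum_y e_y v_y maps to
  sum_y (sum_x e_x d y x) v_y.\<close>
definition dmap :: "('a, 'm) ring_scheme \<Rightarrow> ('i \<Rightarrow> 'i \<Rightarrow> 'a) \<Rightarrow> ('i \<Rightarrow> 'a) \<Rightarrow> ('i \<Rightarrow> 'a)" where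
  "dmap A d v = (\<lambda>x. \<Oplus>\<^bsub>A\<^esub> y \<in> {y. v y \<noteq> \<zero>\<^bsub>A\<^esub>}. d y x \<otimes>\<^bsub>A\<^esub> v y)"

text \<open>The augmentation A^(X_0) -> B_A, e_x |-> m x (B a right A-module via phi).\<close>
definition augm :: "('a, 'm) ring_scheme \<Rightarrow> ('b, 'n) ring_scheme \<Rightarrow> ('a \<Rightarrow> 'b) \<Rightarrow> ('i \<Rightarrow> 'b) \<Rightarrow> ('i \<Rightarrow> 'a) \<Rightarrow> 'b" where
  "augm A B \<phi> m v = (\<Oplus>\<^bsub>B\<^esub> x \<in> {x. v x \<noteq> \<zero>\<^bsub>A\<^esub>}. m x \<otimes>\<^bsub>B\<^esub> \<phi> (v x))"

text \<open>The map (dmap d) \<otimes>_A B : A^(Y) \<otimes>_A B -> A^(X) \<otimes>_A B, under the canonical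
  identification A^(X) \<otimes>_A B = B^(X) (B a left A-module via phi):
  e_y \<otimes> w_y |-> sum_x e_x \<otimes> phi(d y x) w_y.\<close>
definition tmap :: "('b, 'n) ring_scheme \<Rightarrow> ('a \<Rightarrow> 'b) \<Rightarrow> ('i \<Rightarrow> 'i \<Rightarrow> 'a) \<Rightarrow> ('i \<Rightarrow> 'b) \<Rightarrow> ('i \<Rightarrow> 'b)" where
  "tmap B \<phi> d w = (\<lambda>x. \<Oplus>\<^bsub>B\<^esub> y \<in> {y. w y \<noteq> \<zero>\<^bsub>B\<^esub>}. \<phi> (d y x) \<otimes>\<^bsub>B\<^esub> w y)"

text \<open>A free resolution  ... -> A^(X 2) -d 1-> A^(X 1) -d 0-> A^(X 0) -augm-> B_A -> 0
  of B as a right A-module (via phi).\<close>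
definition free_resolution ::
  "('a, 'm) ring_scheme \<Rightarrow> ('b, 'n) ring_scheme \<Rightarrow> ('a \<Rightarrow> 'b) \<Rightarrow>
   (nat \<Rightarrow> 'i set) \<Rightarrow> (nat \<Rightarrow> 'i \<Rightarrow> 'i \<Rightarrow> 'a) \<Rightarrow> ('i \<Rightarrow> 'b) \<Rightarrow> bool" where
  "free_resolution A B \<phi> Xs d m \<longleftrightarrow>
     (\<forall>n. \<forall>y \<in> Xs (Suc n). d n y \<in> fin_elems (carrier A) \<zero>\<^bsub>A\<^esub> (Xs n)) \<and>
     (\<forall>x \<in> Xs 0. m x \<in> carrier B) \<and>
     augm A B \<phi> m ` fin_elems (carrier A) \<zero>\<^bsub>A\<^esub> (Xs 0) = carrier B \<and>
     {v \<in> fin_elems (carrier A) \<zero>\<^bsub>A\<^esub> (Xs 0). augm A B \<phi> m v = \<zero>\<^bsub>B\<^esub>}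
        = dmap A (d 0) ` fin_elems (carrier A) \<zero>\<^bsub>A\<^esub> (Xs 1) \<and>
     (\<forall>n. {v \<in> fin_elems (carrier A) \<zero>\<^bsub>A\<^esub> (Xs (Suc n)). dmap A (d n) v = (\<lambda>_. \<zero>\<^bsub>A\<^esub>)}
        = dmap A (d (Suc n)) ` fin_elems (carrier A) \<zero>\<^bsub>A\<^esub> (Xs (Suc (Suc n))))"

text \<open>Tor^A_i(B,B) = 0 for all i \<ge> 1, computed as the homology of the tensored resolution:
  ker (d_{i-1} \<otimes> B) \<subseteq> im (d_i \<otimes> B) at every degree i \<ge> 1.\<close>
definition tor_vanishes ::
  "('b, 'n) ring_scheme \<Rightarrow> ('a \<Rightarrow> 'b) \<Rightarrow> (nat \<Rightarrow> 'i set) \<Rightarrow> (nat \<Rightarrow> 'i \<Rightarrow> 'i \<Rightarrow> 'a) \<Rightarrow> bool" where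
  "tor_vanishes B \<phi> Xs d \<longleftrightarrow>
     (\<forall>n. {w \<in> fin_elems (carrier B) \<zero>\<^bsub>B\<^esub> (Xs (Suc n)). tmap B \<phi> (d n) w = (\<lambda>_. \<zero>\<^bsub>B\<^esub>)}
        \<subseteq> tmap B \<phi> (d (Suc n)) ` fin_elems (carrier B) \<zero>\<^bsub>B\<^esub> (Xs (Suc (Suc n))))"

text \<open>Homological epimorphism.  Free resolutions are indexed by subsets of the type
  ('a + 'b) list, whose cardinality max(|A|,|B|,aleph_0) suffices to build a free resolution
  of B_A; Tor does not depend on the chosen resolution.\<close>
definition homological_epi :: "('a, 'm) ring_scheme \<Rightarrow> ('b, 'n) ring_scheme \<Rightarrow> ('a \<Rightarrow> 'b) \<Rightarrow> bool" where
  "homological_epi A B \<phi> \<longleftrightarrow> ring_epi A B \<phi> \<and>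
     (\<exists>(Xs :: nat \<Rightarrow> ('a + 'b) list set) d m.
        free_resolution A B \<phi> Xs d m \<and> tor_vanishes B \<phi> Xs d)"

definition stratifying_ideal :: "('a, 'm) ring_scheme \<Rightarrow> 'a set \<Rightarrow> bool" where
  "stratifying_ideal A I \<longleftrightarrow>
     (\<exists>e \<in> carrier A. e \<otimes>\<^bsub>A\<^esub> e = e \<and> I = Idl\<^bsub>A\<^esub> {e}) \<and>
     homological_epi A (A Quot I) (\<lambda>a. I +>\<^bsub>A\<^esub> a)"

end

theory Submission
  imports Defs "HOL-Library.Countable_Set"
begin

text \<open>Write \<open>J\<close> for the radical of \<open>A\<close> and \<open>Q\<close> for that of \<open>B\<close>. Since \<open>\<phi>\<close> is an epimorphism, every
  \<open>A\<close>-linear map from \<open>B\<close> to a \<open>B\<close>-module is \<open>B\<close>-linear. The radical of a perfect ring is nil and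
  \<open>B / Q\<close> is reduced because \<open>B\<close> is basic, so \<open>\<phi>(J) \<subseteq> Q\<close> and \<open>B / Q\<close> is a semisimple \<open>A\<close>-module;
  the projection of \<open>B\<close> onto an \<open>A\<close>-complement of \<open>\<phi>(A) + Q\<close> kills \<open>1\<close>, hence \<open>B = \<phi>(A) + Q\<close>.
  With \<open>K = \<phi>\<^sup>-\<^sup>1(Q)\<close>, the map \<open>B / Q \<cong> A / K \<rightarrow> B / B\<phi>(K)\<close> is again \<open>B\<close>-linear, so \<open>Q = B\<phi>(K)\<close>. As \<open>K\<close> is
  generated modulo \<open>J\<close> by an idempotent \<open>f\<close>, and \<open>1 - \<phi>(f)\<close> is a unit, \<open>Q = B\<phi>(J)\<close>. Then
  \<open>B = \<phi>(A) + B\<phi>(J)\<close>, and T-nilpotency of \<open>J\<close> gives \<open>B = \<phi>(A)\<close>. The left perfect case follows by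
  passing to opposite rings.

  If \<open>\<phi>\<close> is homological with kernel \<open>I\<close>, then \<open>I / I\<^sup>2 = Tor\<^sub>1(B, B) = 0\<close>. Lifting the idempotent that
  generates \<open>I\<close> modulo \<open>J\<close> to an idempotent \<open>e \<in> I\<close>, one has \<open>I = AeA + (I \<inter> J)\<close>, hence
  \<open>I \<subseteq> AeA + I(I \<inter> J)\<close>, and T-nilpotency gives \<open>I = AeA\<close>. The given resolution may be indexed by a type
  too large for \<open>A / I\<close>; it is cut down to a subresolution closed under the choices of preimages.\<close>

section \<open>Epimorphisms and linear maps\<close>

text \<open>Several obstacles shape the proof. \<open>ring_epi\<close> tests only against rings with
  elements in \<open>'b list\<close>, so the ring that detects linearity must be nameable by lists
  over \<open>B\<close>; the additive maps on \<open>B\<close> are too many in general, which is why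
  only a bimodule generated by one map enters. The maps to be tested arise by choosing
  representatives, so they are linear only modulo a left ideal, and linearity is proved in the form
  of congruences. The Jacobson radical is defined through left ideals and is not visibly the same
  for the opposite ring; Nakayama's lemma and the surjectivity argument therefore speak of sets,
  ideals and explicit inverses, which pass to opposite rings directly. Finally, \<open>B\<close> is
  isomorphic to \<open>A / I\<close>, but \<open>homological_epi\<close> prescribes the index type
  \<open>('a + 'a set) list\<close> for \<open>A / I\<close>, while \<open>'b\<close> may be a much
  larger type; hence finite trees with labels in \<open>'a\<close> are coded as lists.\<close>

definition op_ring :: "('a, 'm) ring_scheme \<Rightarrow> 'a ring" where
  "op_ring R = \<lparr>carrier = carrier R, monoid.mult = (\<lambda>x y. y \<otimes>\<^bsub>R\<^esub> x), monoid.one = \<one>\<^bsub>R\<^esub>,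
     ring.zero = \<zero>\<^bsub>R\<^esub>, ring.add = (\<oplus>\<^bsub>R\<^esub>)\<rparr>"

lemma op_ring_simps [simp]:
  "carrier (op_ring R) = carrier R" "x \<otimes>\<^bsub>op_ring R\<^esub> y = y \<otimes>\<^bsub>R\<^esub> x" "\<one>\<^bsub>op_ring R\<^esub> = \<one>\<^bsub>R\<^esub>"
  "\<zero>\<^bsub>op_ring R\<^esub> = \<zero>\<^bsub>R\<^esub>" "x \<oplus>\<^bsub>op_ring R\<^esub> y = x \<oplus>\<^bsub>R\<^esub> y"
  by (simp_all add: op_ring_def)

lemma op_ring_a_inv [simp]: "\<ominus>\<^bsub>op_ring R\<^esub> x = \<ominus>\<^bsub>R\<^esub> x"
  by (simp add: a_inv_def m_inv_def)

lemma op_ring_a_minus [simp]: "x \<ominus>\<^bsub>op_ring R\<^esub> y = x \<ominus>\<^bsub>R\<^esub> y"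
  by (simp add: a_minus_def)

lemma ring_op_ring: "ring R \<Longrightarrow> ring (op_ring R)"
proof -
  assume "ring R"
  then interpret ring R .
  show ?thesis
  proof (rule ringI)
    show "abelian_group (op_ring R)"
    proof (rule abelian_groupI)
      fix x assume "x \<in> carrier (op_ring R)"
      then show "\<exists>y\<in>carrier (op_ring R). y \<oplus>\<^bsub>op_ring R\<^esub> x = \<zero>\<^bsub>op_ring R\<^esub>"
        using l_neg by auto
    qed (auto simp: a_ac)
    show "Group.monoid (op_ring R)"
      by (rule monoidI) (auto simp: m_assoc)
  qed (auto simp: l_distr r_distr)
qed

lemma ring_hom_op_ring: "f \<in> ring_hom (op_ring R) (op_ring S) \<longleftrightarrow> f \<in> ring_hom R S"
  by (auto simp: ring_hom_def)

lemma ring_epiD: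
  fixes C :: "'b list ring" and B :: "('b, 'n) ring_scheme"
  assumes "ring_epi A B \<phi>" "ring C" "f \<in> ring_hom B C" "g \<in> ring_hom B C"
    "\<And>a. a \<in> carrier A \<Longrightarrow> f (\<phi> a) = g (\<phi> a)" "b \<in> carrier B"
  shows "f b = g b"
  using assms unfolding ring_epi_def by simp

text \<open>The opposite of a test ring keeps the element type \<open>'b list\<close>, so it is
  again one of the rings over which \<open>ring_epi\<close> quantifies.\<close>

lemma ring_epi_op:
  fixes B :: "('b, 'n) ring_scheme"
  assumes "ring_epi A B \<phi>"
  shows "ring_epi (op_ring A) (op_ring B) \<phi>"
proof -
  have "f b = g b"
    if "ring C" "f \<in> ring_hom (op_ring B) C" "g \<in> ring_hom (op_ring B) C"
      "\<forall>a\<in>carrier A. f (\<phi> a) = g (\<phi> a)" "b \<in> carrier B" for C :: "'b list ring" and f g b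
  proof -
    have "f \<in> ring_hom B (op_ring C)" "g \<in> ring_hom B (op_ring C)"
      using that(2,3) by (auto simp: ring_hom_def)
    then show ?thesis
      using ring_epiD[OF assms ring_op_ring[OF that(1)]] that(4,5) by simp
  qed
  then show ?thesis
    using assms unfolding ring_epi_def by (auto simp: ring_op_ring ring_hom_op_ring)
qed

text \<open>The test ring is the set of matrices with equal diagonal entries \<open>b\<close> and off-diagonal entry
  \<open>h\<close> in the bimodule of additive maps from \<open>B\<close> to \<open>G\<close> generated by \<open>f\<close>.\<close>

locale linear_test =
  B: ring B + G: abelian_group G
  for B :: "('b, 'n) ring_scheme" and G :: "('c, 'k) ring_scheme" +
  fixes act :: "'b \<Rightarrow> 'c \<Rightarrow> 'c" and f :: "'b \<Rightarrow> 'c"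
  assumes act_closed: "b \<in> carrier B \<Longrightarrow> x \<in> carrier G \<Longrightarrow> act b x \<in> carrier G"
    and act_one: "x \<in> carrier G \<Longrightarrow> act \<one>\<^bsub>B\<^esub> x = x"
    and act_mult: "b \<in> carrier B \<Longrightarrow> c \<in> carrier B \<Longrightarrow> x \<in> carrier G \<Longrightarrow>
      act (b \<otimes>\<^bsub>B\<^esub> c) x = act b (act c x)"
    and act_add_l: "b \<in> carrier B \<Longrightarrow> c \<in> carrier B \<Longrightarrow> x \<in> carrier G \<Longrightarrow>
      act (b \<oplus>\<^bsub>B\<^esub> c) x = act b x \<oplus>\<^bsub>G\<^esub> act c x"
    and act_add_r: "b \<in> carrier B \<Longrightarrow> x \<in> carrier G \<Longrightarrow> y \<in> carrier G \<Longrightarrow>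
      act b (x \<oplus>\<^bsub>G\<^esub> y) = act b x \<oplus>\<^bsub>G\<^esub> act b y"
    and f_closed: "b \<in> carrier B \<Longrightarrow> f b \<in> carrier G"
    and f_add: "b \<in> carrier B \<Longrightarrow> c \<in> carrier B \<Longrightarrow> f (b \<oplus>\<^bsub>B\<^esub> c) = f b \<oplus>\<^bsub>G\<^esub> f c"
begin

text \<open>All operations on maps are restricted to \<open>carrier B\<close>, so that equality in
  the bimodule is agreement on the carrier.\<close>

definition hzero :: "'b \<Rightarrow> 'c" where
  "hzero = (\<lambda>x\<in>carrier B. \<zero>\<^bsub>G\<^esub>)"

definition hadd :: "('b \<Rightarrow> 'c) \<Rightarrow> ('b \<Rightarrow> 'c) \<Rightarrow> 'b \<Rightarrow> 'c" where
  "hadd h h' = (\<lambda>x\<in>carrier B. h x \<oplus>\<^bsub>G\<^esub> h' x)"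

definition hl :: "'b \<Rightarrow> ('b \<Rightarrow> 'c) \<Rightarrow> 'b \<Rightarrow> 'c" where
  "hl b h = (\<lambda>x\<in>carrier B. act b (h x))"

definition hr :: "('b \<Rightarrow> 'c) \<Rightarrow> 'b \<Rightarrow> 'b \<Rightarrow> 'c" where
  "hr h b = (\<lambda>x\<in>carrier B. h (b \<otimes>\<^bsub>B\<^esub> x))"

lemma ext_ops [simp]:
  "hzero \<in> extensional (carrier B)" "hadd h h' \<in> extensional (carrier B)"
  "hl b h \<in> extensional (carrier B)" "hr h b \<in> extensional (carrier B)"
  by (simp_all add: hzero_def hadd_def hl_def hr_def extensional_def)

text \<open>Finite sums of the maps \<open>x \<mapsto> b f(c x)\<close>; negatives arise from the
  left action of \<open>-1\<close>. Each element is described by the finite list of its coefficients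
  \<open>b\<close> and \<open>c\<close>.\<close>

inductive_set H :: "('b \<Rightarrow> 'c) set" where
  H_zero: "hzero \<in> H"
| H_step: "b \<in> carrier B \<Longrightarrow> c \<in> carrier B \<Longrightarrow> h \<in> H \<Longrightarrow> hadd (hl b (hr f c)) h \<in> H"

lemma hzero_apply: "x \<in> carrier B \<Longrightarrow> hzero x = \<zero>\<^bsub>G\<^esub>"
  and hadd_apply: "x \<in> carrier B \<Longrightarrow> hadd h h' x = h x \<oplus>\<^bsub>G\<^esub> h' x"
  and hl_apply: "x \<in> carrier B \<Longrightarrow> hl b h x = act b (h x)"
  and hr_apply: "x \<in> carrier B \<Longrightarrow> hr h b x = h (b \<otimes>\<^bsub>B\<^esub> x)"
  by (simp_all add: hzero_def hadd_def hl_def hr_def)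

lemma act_zero: "b \<in> carrier B \<Longrightarrow> act b \<zero>\<^bsub>G\<^esub> = \<zero>\<^bsub>G\<^esub>"
  using act_add_r[of b "\<zero>\<^bsub>G\<^esub>" "\<zero>\<^bsub>G\<^esub>"] act_closed[of b "\<zero>\<^bsub>G\<^esub>"]
  by (metis G.add.l_cancel_one' G.l_zero G.zero_closed)

lemma act_zero_l: "x \<in> carrier G \<Longrightarrow> act \<zero>\<^bsub>B\<^esub> x = \<zero>\<^bsub>G\<^esub>"
  using act_add_l[of "\<zero>\<^bsub>B\<^esub>" "\<zero>\<^bsub>B\<^esub>" x] act_closed[of "\<zero>\<^bsub>B\<^esub>" x]
  by (metis G.add.l_cancel_one' B.l_zero B.zero_closed)

lemma act_minus:
  assumes "b \<in> carrier B" "x \<in> carrier G"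
  shows "act (\<ominus>\<^bsub>B\<^esub> b) x = \<ominus>\<^bsub>G\<^esub> act b x"
proof -
  have "act (\<ominus>\<^bsub>B\<^esub> b) x \<oplus>\<^bsub>G\<^esub> act b x = \<zero>\<^bsub>G\<^esub>"
    using act_add_l[of "\<ominus>\<^bsub>B\<^esub> b" b x] assms by (simp add: B.l_neg act_zero_l)
  then show ?thesis
    using assms act_closed by (simp add: G.minus_equality)
qed

lemma H_props:
  assumes "h \<in> H"
  shows "h \<in> extensional (carrier B)" "x \<in> carrier B \<Longrightarrow> h x \<in> carrier G"
    "x \<in> carrier B \<Longrightarrow> y \<in> carrier B \<Longrightarrow> h (x \<oplus>\<^bsub>B\<^esub> y) = h x \<oplus>\<^bsub>G\<^esub> h y"
proof -
  have "h \<in> extensional (carrier B) \<and> (\<forall>x\<in>carrier B. h x \<in> carrier G) \<and>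
    (\<forall>x\<in>carrier B. \<forall>y\<in>carrier B. h (x \<oplus>\<^bsub>B\<^esub> y) = h x \<oplus>\<^bsub>G\<^esub> h y)"
    using assms
  proof induction
    case H_zero
    then show ?case by (auto simp: hzero_apply)
  next
    case (H_step b c h)
    then show ?case
      by (auto simp: hadd_apply hl_apply hr_apply act_closed f_closed f_add act_add_r B.r_distr
          G.a_ac)
  qed
  then show "h \<in> extensional (carrier B)" "x \<in> carrier B \<Longrightarrow> h x \<in> carrier G"
    "x \<in> carrier B \<Longrightarrow> y \<in> carrier B \<Longrightarrow> h (x \<oplus>\<^bsub>B\<^esub> y) = h x \<oplus>\<^bsub>G\<^esub> h y"
    by auto
qed

lemma H_eqI:
  "h \<in> extensional (carrier B) \<Longrightarrow> h' \<in> extensional (carrier B) \<Longrightarrow>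
    (\<And>x. x \<in> carrier B \<Longrightarrow> h x = h' x) \<Longrightarrow> h = h'"
  by (rule extensionalityI)

lemma H_add: "h \<in> H \<Longrightarrow> h' \<in> H \<Longrightarrow> hadd h h' \<in> H"
proof (induction rule: H.induct)
  case H_zero
  have "hadd hzero h' = h'"
    using H_props[OF H_zero] by (intro H_eqI) (auto simp: hadd_def hzero_def)
  then show ?case using H_zero by simp
next
  case (H_step b c h)
  have "hadd (hadd (hl b (hr f c)) h) h' = hadd (hl b (hr f c)) (hadd h h')"
    using H_props[OF H_step.hyps(3)] H_props[OF H_step.prems] H_step.hyps
    by (intro H_eqI) (auto simp: hadd_def hl_def hr_def G.a_assoc act_closed f_closed)
  then show ?case
    using H_step by (auto intro: H.H_step)
qed

lemma H_l: "h \<in> H \<Longrightarrow> b \<in> carrier B \<Longrightarrow> hl b h \<in> H"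
proof (induction rule: H.induct)
  case H_zero
  then have "hl b hzero = hzero"
    by (intro H_eqI) (auto simp: hl_def hzero_def act_zero)
  then show ?case by (simp add: H.H_zero)
next
  case (H_step b' c h)
  have "hl b (hadd (hl b' (hr f c)) h) = hadd (hl (b \<otimes>\<^bsub>B\<^esub> b') (hr f c)) (hl b h)"
    using H_props[OF H_step.hyps(3)] H_step.prems H_step.hyps
    by (intro H_eqI) (auto simp: hadd_def hl_def hr_def act_closed f_closed act_mult act_add_r)
  then show ?case
    using H_step by (auto intro: H.H_step)
qed

lemma H_r: "h \<in> H \<Longrightarrow> b \<in> carrier B \<Longrightarrow> hr h b \<in> H"
proof (induction rule: H.induct)
  case H_zero
  then have "hr hzero b = hzero"
    by (intro H_eqI) (auto simp: hr_def hzero_def)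
  then show ?case by (simp add: H.H_zero)
next
  case (H_step b' c h)
  have "hr (hadd (hl b' (hr f c)) h) b = hadd (hl b' (hr f (c \<otimes>\<^bsub>B\<^esub> b))) (hr h b)"
    using H_props[OF H_step.hyps(3)] H_step.prems H_step.hyps
    by (intro H_eqI) (auto simp: hadd_def hl_def hr_def B.m_assoc)
  then show ?case
    using H_step by (auto intro: H.H_step)
qed

lemma H_gen: "b \<in> carrier B \<Longrightarrow> c \<in> carrier B \<Longrightarrow> hl b (hr f c) \<in> H"
proof -
  assume *: "b \<in> carrier B" "c \<in> carrier B"
  have "hl b (hr f c) = hadd (hl b (hr f c)) hzero"
    using * by (intro H_eqI) (auto simp: hadd_def hzero_def hl_def hr_def act_closed f_closed)
  then show ?thesis
    using H_step[OF * H_zero] by simp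
qed

lemma H_minus: "h \<in> H \<Longrightarrow> hl (\<ominus>\<^bsub>B\<^esub> \<one>\<^bsub>B\<^esub>) h \<in> H"
  by (rule H_l) auto

text \<open>Reads a list \<open>b, c, b', c', ...\<close> as coefficients of a sum in
  \<open>H\<close>. All that matters is that every element of \<open>H\<close> has a name; lists
  with entries outside the carrier may decode to other maps.\<close>

fun dec :: "'b list \<Rightarrow> 'b \<Rightarrow> 'c" where
  "dec (b # c # l) = hadd (hl b (hr f c)) (dec l)"
| "dec _ = hzero"

lemma H_dec: "h \<in> H \<Longrightarrow> \<exists>l. dec l = h"
proof (induction rule: H.induct)
  case H_zero
  show ?case by (rule exI[of _ "[]"]) simp
next
  case (H_step b c h)
  then show ?case by (metis dec.simps(1))
qed

definition C :: "('b \<times> ('b \<Rightarrow> 'c)) ring" where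
  "C = \<lparr>carrier = carrier B \<times> H,
    monoid.mult = (\<lambda>(b, h) (c, k). (b \<otimes>\<^bsub>B\<^esub> c, hadd (hl b k) (hr h c))),
    monoid.one = (\<one>\<^bsub>B\<^esub>, hzero), ring.zero = (\<zero>\<^bsub>B\<^esub>, hzero),
    ring.add = (\<lambda>(b, h) (c, k). (b \<oplus>\<^bsub>B\<^esub> c, hadd h k))\<rparr>"

lemma C_simps:
  "carrier C = carrier B \<times> H" "(b, h) \<otimes>\<^bsub>C\<^esub> (c, k) = (b \<otimes>\<^bsub>B\<^esub> c, hadd (hl b k) (hr h c))"
  "\<one>\<^bsub>C\<^esub> = (\<one>\<^bsub>B\<^esub>, hzero)" "\<zero>\<^bsub>C\<^esub> = (\<zero>\<^bsub>B\<^esub>, hzero)" "(b, h) \<oplus>\<^bsub>C\<^esub> (c, k) = (b \<oplus>\<^bsub>B\<^esub> c, hadd h k)"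
  by (simp_all add: C_def)

lemma ring_C: "ring C"
proof (rule ringI)
  show "abelian_group C"
  proof (rule abelian_groupI)
    fix x assume "x \<in> carrier C"
    then obtain b h where x: "x = (b, h)" "b \<in> carrier B" "h \<in> H"
      by (auto simp: C_simps)
    have "hadd (hl (\<ominus>\<^bsub>B\<^esub> \<one>\<^bsub>B\<^esub>) h) h = hzero"
      using H_props[OF x(3)]
      by (intro H_eqI) (auto simp: hadd_def hzero_def hl_def act_minus act_one G.l_neg)
    then show "\<exists>y\<in>carrier C. y \<oplus>\<^bsub>C\<^esub> x = \<zero>\<^bsub>C\<^esub>"
      using x H_minus by (intro bexI[of _ "(\<ominus>\<^bsub>B\<^esub> b, hl (\<ominus>\<^bsub>B\<^esub> \<one>\<^bsub>B\<^esub>) h)"]) (auto simp: C_simps B.l_neg)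
  qed (auto simp: C_simps H_add H_zero B.a_ac hadd_apply hzero_apply H_props G.a_ac intro!: H_eqI)
  show "Group.monoid C"
  proof (rule monoidI)
    fix x y z assume "x \<in> carrier C" "y \<in> carrier C" "z \<in> carrier C"
    then obtain b h c k d l where "x = (b, h)" "y = (c, k)" "z = (d, l)"
      and *: "b \<in> carrier B" "c \<in> carrier B" "d \<in> carrier B" "h \<in> H" "k \<in> H" "l \<in> H"
      by (auto simp: C_simps)
    moreover have "hadd (hl (b \<otimes>\<^bsub>B\<^esub> c) l) (hr (hadd (hl b k) (hr h c)) d) =
      hadd (hl b (hadd (hl c l) (hr k d))) (hr h (c \<otimes>\<^bsub>B\<^esub> d))"
      using * H_props[OF *(4)] H_props[OF *(5)] H_props[OF *(6)]
      by (intro H_eqI) (auto simp: hadd_def hl_def hr_def act_mult act_add_r act_closed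
          B.m_assoc G.a_assoc)
    ultimately show "x \<otimes>\<^bsub>C\<^esub> y \<otimes>\<^bsub>C\<^esub> z = x \<otimes>\<^bsub>C\<^esub> (y \<otimes>\<^bsub>C\<^esub> z)"
      by (simp add: C_simps B.m_assoc)
  qed (auto simp: C_simps H_add H_zero H_l H_r hadd_apply hzero_apply hl_apply hr_apply H_props
      act_one act_zero intro!: H_eqI)
  fix x y z assume "x \<in> carrier C" "y \<in> carrier C" "z \<in> carrier C"
  then obtain b h c k d l where xyz: "x = (b, h)" "y = (c, k)" "z = (d, l)"
    and *: "b \<in> carrier B" "c \<in> carrier B" "d \<in> carrier B" "h \<in> H" "k \<in> H" "l \<in> H"
    by (auto simp: C_simps)
  note p = H_props[OF *(4)] H_props[OF *(5)] H_props[OF *(6)]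
  have "hadd (hl (b \<oplus>\<^bsub>B\<^esub> c) l) (hr (hadd h k) d) =
      hadd (hadd (hl b l) (hr h d)) (hadd (hl c l) (hr k d))"
    using * p by (intro H_eqI) (auto simp: hadd_def hl_def hr_def act_add_l act_closed G.a_ac)
  then show "(x \<oplus>\<^bsub>C\<^esub> y) \<otimes>\<^bsub>C\<^esub> z = x \<otimes>\<^bsub>C\<^esub> z \<oplus>\<^bsub>C\<^esub> y \<otimes>\<^bsub>C\<^esub> z"
    using xyz * by (simp add: C_simps B.l_distr)
  have "hadd (hl d (hadd h k)) (hr l (b \<oplus>\<^bsub>B\<^esub> c)) =
      hadd (hadd (hl d h) (hr l b)) (hadd (hl d k) (hr l c))"
    using * p by (intro H_eqI) (auto simp: hadd_def hl_def hr_def act_add_r act_closed G.a_ac B.l_distr)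
  then show "z \<otimes>\<^bsub>C\<^esub> (x \<oplus>\<^bsub>C\<^esub> y) = z \<otimes>\<^bsub>C\<^esub> x \<oplus>\<^bsub>C\<^esub> z \<otimes>\<^bsub>C\<^esub> y"
    using xyz * by (simp add: C_simps B.r_distr)
qed

text \<open>The inner derivation \<open>b f - f b\<close>, where \<open>hr f \<one>\<close> stands
  for the restriction of \<open>f\<close> to the carrier. It vanishes at \<open>b\<close> exactly
  when \<open>f(b x) = b f(x)\<close> for all \<open>x\<close>.\<close>

definition delta :: "'b \<Rightarrow> 'b \<Rightarrow> 'c" where
  "delta b = hadd (hl b (hr f \<one>\<^bsub>B\<^esub>)) (hl (\<ominus>\<^bsub>B\<^esub> \<one>\<^bsub>B\<^esub>) (hr f b))"

lemma delta_in_H: "b \<in> carrier B \<Longrightarrow> delta b \<in> H"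
  by (simp add: delta_def H_add H_gen)

lemma delta_apply:
  "b \<in> carrier B \<Longrightarrow> x \<in> carrier B \<Longrightarrow> delta b x = act b (f x) \<ominus>\<^bsub>G\<^esub> f (b \<otimes>\<^bsub>B\<^esub> x)"
  by (simp add: delta_def hadd_def hl_def hr_def act_minus f_closed act_one a_minus_def)

lemma hom_triv: "(\<lambda>b. (b, hzero)) \<in> ring_hom B C"
  by (rule ring_hom_memI)
    (auto simp: C_simps H_zero hadd_apply hzero_apply hl_apply hr_apply act_zero intro!: H_eqI)

text \<open>Multiplicativity into the square-zero extension \<open>C\<close> is the Leibniz rule for
  \<open>delta\<close>.\<close>

lemma hom_delta: "(\<lambda>b. (b, delta b)) \<in> ring_hom B C"
proof (rule ring_hom_memI)
  fix b c assume *: "b \<in> carrier B" "c \<in> carrier B"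
  have "delta (b \<otimes>\<^bsub>B\<^esub> c) = hadd (hl b (delta c)) (hr (delta b) c)"
  proof (rule H_eqI)
    fix x assume x: "x \<in> carrier B"
    \<comment> \<open>In the Leibniz rule the two middle terms \<open>b f(c x)\<close> cancel;
      \<open>k\<close> stands for the last term \<open>- f(b c x)\<close>.\<close>
    have "act b (act c (f x)) \<oplus>\<^bsub>G\<^esub> act b (\<ominus>\<^bsub>G\<^esub> f (c \<otimes>\<^bsub>B\<^esub> x)) \<oplus>\<^bsub>G\<^esub> (act b (f (c \<otimes>\<^bsub>B\<^esub> x)) \<oplus>\<^bsub>G\<^esub> k) =
      act b (act c (f x)) \<oplus>\<^bsub>G\<^esub> k" if "k \<in> carrier G" for k
    proof -
      have "act b (\<ominus>\<^bsub>G\<^esub> f (c \<otimes>\<^bsub>B\<^esub> x)) \<oplus>\<^bsub>G\<^esub> act b (f (c \<otimes>\<^bsub>B\<^esub> x)) = \<zero>\<^bsub>G\<^esub>"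
        using * x act_add_r[of b "\<ominus>\<^bsub>G\<^esub> f (c \<otimes>\<^bsub>B\<^esub> x)" "f (c \<otimes>\<^bsub>B\<^esub> x)"]
        by (simp add: f_closed G.l_neg act_zero)
      then have "act b (\<ominus>\<^bsub>G\<^esub> f (c \<otimes>\<^bsub>B\<^esub> x)) \<oplus>\<^bsub>G\<^esub> (act b (f (c \<otimes>\<^bsub>B\<^esub> x)) \<oplus>\<^bsub>G\<^esub> k) = k"
        using * x that by (metis (no_types, lifting) B.m_closed G.a_assoc G.a_inv_closed G.l_zero
            act_closed f_closed)
      then show ?thesis
        using * x that by (simp add: G.a_assoc f_closed act_closed)
    qed
    then show "delta (b \<otimes>\<^bsub>B\<^esub> c) x = hadd (hl b (delta c)) (hr (delta b) c) x"
      using * x by (simp add: delta_apply hadd_def hl_def hr_def a_minus_def act_mult act_add_r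
          B.m_assoc f_closed act_closed)
  qed (auto simp: delta_def)
  then show "(b \<otimes>\<^bsub>B\<^esub> c, delta (b \<otimes>\<^bsub>B\<^esub> c)) = (b, delta b) \<otimes>\<^bsub>C\<^esub> (c, delta c)"
    by (simp add: C_simps)
  have "delta (b \<oplus>\<^bsub>B\<^esub> c) = hadd (delta b) (delta c)"
  proof (rule H_eqI)
    fix x assume x: "x \<in> carrier B"
    then show "delta (b \<oplus>\<^bsub>B\<^esub> c) x = hadd (delta b) (delta c) x"
      using * by (simp add: delta_apply hadd_def a_minus_def act_add_l B.l_distr f_add f_closed
          act_closed G.minus_add G.a_ac)
  qed (auto simp: delta_def)
  then show "(b \<oplus>\<^bsub>B\<^esub> c, delta (b \<oplus>\<^bsub>B\<^esub> c)) = (b, delta b) \<oplus>\<^bsub>C\<^esub> (c, delta c)"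
    by (simp add: C_simps)
next
  have "delta \<one>\<^bsub>B\<^esub> = hzero"
  proof (rule H_eqI)
    fix x assume "x \<in> carrier B"
    then show "delta \<one>\<^bsub>B\<^esub> x = hzero x"
      by (simp add: delta_apply act_one f_closed hzero_def G.r_neg a_minus_def)
  qed (auto simp: delta_def)
  then show "(\<one>\<^bsub>B\<^esub>, delta \<one>\<^bsub>B\<^esub>) = \<one>\<^bsub>C\<^esub>"
    by (simp add: C_simps)
qed (simp add: C_simps delta_in_H)

text \<open>The head is the diagonal entry and the tail a name of the map; this puts a copy of
  \<open>C\<close> into the type on which \<open>ring_epi\<close> tests.\<close>

definition code :: "'b \<times> ('b \<Rightarrow> 'c) \<Rightarrow> 'b list" where
  "code x = fst x # (SOME l. dec l = snd x)"

lemma inj_code: "inj_on code (carrier C)"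
proof (rule inj_onI)
  fix x y assume xy: "x \<in> carrier C" "y \<in> carrier C" "code x = code y"
  have "dec (SOME l. dec l = snd x) = snd x" if "x \<in> carrier C" for x
    by (rule someI_ex) (use that H_dec in \<open>auto simp: C_simps\<close>)
  then show "x = y"
    using xy by (metis code_def list.inject prod.expand)
qed

text \<open>By \<open>A\<close>-linearity \<open>delta\<close> vanishes on the image of
  \<open>\<phi>\<close>, so \<open>b \<mapsto> (b, 0)\<close> and
  \<open>b \<mapsto> (b, delta b)\<close> agree there and hence everywhere. Evaluating
  \<open>delta b = 0\<close> at \<open>\<one>\<close> gives the claim.\<close>

lemma epi_linear:
  assumes epi: "ring_epi A B \<phi>"
    and lin: "\<And>a b. a \<in> carrier A \<Longrightarrow> b \<in> carrier B \<Longrightarrow> f (\<phi> a \<otimes>\<^bsub>B\<^esub> b) = act (\<phi> a) (f b)"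
    and b: "b \<in> carrier B"
  shows "f b = act b (f \<one>\<^bsub>B\<^esub>)"
proof -
  let ?C = "image_ring code C"
  have iso: "code \<in> ring_hom C ?C"
    using inj_imp_image_ring_iso[OF inj_code] by (simp add: ring_iso_def)
  have "ring ?C"
    by (rule ring.inj_imp_image_ring_is_ring[OF ring_C inj_code])
  moreover have "code \<circ> (\<lambda>b. (b, hzero)) \<in> ring_hom B ?C" "code \<circ> (\<lambda>b. (b, delta b)) \<in> ring_hom B ?C"
    using ring_hom_trans[OF hom_triv iso] ring_hom_trans[OF hom_delta iso] by auto
  moreover have "(code \<circ> (\<lambda>b. (b, hzero))) (\<phi> a) = (code \<circ> (\<lambda>b. (b, delta b))) (\<phi> a)"
    if a: "a \<in> carrier A" for a
  proof -
    have pa: "\<phi> a \<in> carrier B"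
      using epi a by (auto simp: ring_epi_def ring_hom_def)
    have "delta (\<phi> a) = hzero"
    proof (rule H_eqI)
      fix x assume "x \<in> carrier B"
      then show "delta (\<phi> a) x = hzero x"
        using a pa lin[OF a] by (simp add: delta_apply hzero_def a_minus_def G.r_neg act_closed f_closed)
    qed (auto simp: delta_def)
    then show ?thesis by simp
  qed
  ultimately have "(code \<circ> (\<lambda>b. (b, hzero))) b = (code \<circ> (\<lambda>b. (b, delta b))) b"
    by (rule ring_epiD[OF epi _ _ _ _ b])
  then have "(b, hzero) = (b, delta b)"
    by (intro inj_onD[OF inj_code]) (simp_all add: C_simps H_zero delta_in_H b)
  then have "delta b \<one>\<^bsub>B\<^esub> = \<zero>\<^bsub>G\<^esub>"
    by (metis B.one_closed Pair_inject hzero_def restrict_apply')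
  then show ?thesis
    using b G.minus_equality[of "act b (f \<one>\<^bsub>B\<^esub>)" "\<ominus>\<^bsub>G\<^esub> f b"]
    by (simp add: delta_apply f_closed act_closed a_minus_def)
qed

end

section \<open>Left ideals and the Jacobson radical\<close>

text \<open>Left \<open>A\<close>-submodules of \<open>B\<close>, with \<open>A\<close> acting
  through \<open>\<phi>\<close>. Left ideals are the case of \<open>id\<close>, so both notions
  share their closure lemmas.\<close>

definition submod :: "('a, 'm) ring_scheme \<Rightarrow> ('b, 'n) ring_scheme \<Rightarrow> ('a \<Rightarrow> 'b) \<Rightarrow> 'b set \<Rightarrow> bool" where
  "submod A B \<phi> W \<longleftrightarrow> additive_subgroup W B \<and> (\<forall>a\<in>carrier A. \<forall>w\<in>W. \<phi> a \<otimes>\<^bsub>B\<^esub> w \<in> W)"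

lemma submodD:
  assumes "submod A B \<phi> W" "ring B"
  shows "W \<subseteq> carrier B" "\<zero>\<^bsub>B\<^esub> \<in> W" "x \<in> W \<Longrightarrow> y \<in> W \<Longrightarrow> x \<oplus>\<^bsub>B\<^esub> y \<in> W"
    "x \<in> W \<Longrightarrow> \<ominus>\<^bsub>B\<^esub> x \<in> W" "x \<in> W \<Longrightarrow> y \<in> W \<Longrightarrow> x \<ominus>\<^bsub>B\<^esub> y \<in> W"
    "a \<in> carrier A \<Longrightarrow> x \<in> W \<Longrightarrow> \<phi> a \<otimes>\<^bsub>B\<^esub> x \<in> W"
proof -
  interpret ring B by fact
  interpret additive_subgroup W B using assms by (simp add: submod_def)
  show "W \<subseteq> carrier B" "\<zero>\<^bsub>B\<^esub> \<in> W" "x \<in> W \<Longrightarrow> y \<in> W \<Longrightarrow> x \<oplus>\<^bsub>B\<^esub> y \<in> W"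
    "x \<in> W \<Longrightarrow> \<ominus>\<^bsub>B\<^esub> x \<in> W" "x \<in> W \<Longrightarrow> y \<in> W \<Longrightarrow> x \<ominus>\<^bsub>B\<^esub> y \<in> W"
    using a_subset a_inv_closed is_abelian_group by (auto simp: a_minus_def)
  show "a \<in> carrier A \<Longrightarrow> x \<in> W \<Longrightarrow> \<phi> a \<otimes>\<^bsub>B\<^esub> x \<in> W"
    using assms by (simp add: submod_def)
qed

lemma (in ring) additive_subgroupI':
  assumes "W \<subseteq> carrier R" "\<zero> \<in> W" "\<And>x y. x \<in> W \<Longrightarrow> y \<in> W \<Longrightarrow> x \<oplus> y \<in> W"
    "\<And>x. x \<in> W \<Longrightarrow> \<ominus> x \<in> W"
  shows "additive_subgroup W R"
  using assms by (intro additive_subgroupI add.subgroupI) (auto simp: a_inv_def)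

lemma submodI:
  assumes "ring B" "W \<subseteq> carrier B" "\<zero>\<^bsub>B\<^esub> \<in> W" "\<And>x y. x \<in> W \<Longrightarrow> y \<in> W \<Longrightarrow> x \<oplus>\<^bsub>B\<^esub> y \<in> W"
    "\<And>x. x \<in> W \<Longrightarrow> \<ominus>\<^bsub>B\<^esub> x \<in> W" "\<And>a x. a \<in> carrier A \<Longrightarrow> x \<in> W \<Longrightarrow> \<phi> a \<otimes>\<^bsub>B\<^esub> x \<in> W"
  shows "submod A B \<phi> W"
  using assms by (simp add: submod_def ring.additive_subgroupI')

text \<open>Negation is the action of \<open>\<phi>(-1)\<close>, so closure under sums and under the
  action already gives an additive subgroup.\<close>

lemma submodI_hom:
  assumes "ring A" "ring B" "\<phi> \<in> ring_hom A B" "W \<subseteq> carrier B" "\<zero>\<^bsub>B\<^esub> \<in> W"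
    "\<And>x y. x \<in> W \<Longrightarrow> y \<in> W \<Longrightarrow> x \<oplus>\<^bsub>B\<^esub> y \<in> W"
    "\<And>a x. a \<in> carrier A \<Longrightarrow> x \<in> W \<Longrightarrow> \<phi> a \<otimes>\<^bsub>B\<^esub> x \<in> W"
  shows "submod A B \<phi> W"
proof (rule submodI)
  fix x assume x: "x \<in> W"
  interpret A: ring A by fact
  interpret B: ring B by fact
  interpret ring_hom_ring A B \<phi>
    using assms by (simp add: ring_hom_ringI2)
  have "\<ominus>\<^bsub>B\<^esub> x = \<phi> (\<ominus>\<^bsub>A\<^esub> \<one>\<^bsub>A\<^esub>) \<otimes>\<^bsub>B\<^esub> x"
    using x assms(4) by (auto simp: B.l_minus)
  then show "\<ominus>\<^bsub>B\<^esub> x \<in> W"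
    using assms(7)[of "\<ominus>\<^bsub>A\<^esub> \<one>\<^bsub>A\<^esub>" x] x by auto
qed (use assms in auto)

lemma lideal_iff_submod: "lideal R L \<longleftrightarrow> submod R R id L"
  by (simp add: lideal_def submod_def)

lemma Zorn_nonempty_family:
  fixes Ws :: "'a set set"
  assumes "Ws \<noteq> {}"
    and "\<And>Us. Us \<noteq> {} \<Longrightarrow> Us \<subseteq> Ws \<Longrightarrow> (\<And>U V. U \<in> Us \<Longrightarrow> V \<in> Us \<Longrightarrow> U \<subseteq> V \<or> V \<subseteq> U) \<Longrightarrow>
      \<Union>Us \<in> Ws"
  shows "\<exists>M\<in>Ws. \<forall>M'\<in>Ws. M \<subseteq> M' \<longrightarrow> M' = M"
  using assms by (intro subset_Zorn_nonempty) (auto simp: subset_chain_def)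

lemma submod_Union:
  assumes "ring B" "\<K> \<noteq> {}" "\<And>U V. U \<in> \<K> \<Longrightarrow> V \<in> \<K> \<Longrightarrow> U \<subseteq> V \<or> V \<subseteq> U" "\<And>W. W \<in> \<K> \<Longrightarrow> submod A B \<phi> W"
  shows "submod A B \<phi> (\<Union>\<K>)"
proof (rule submodI)
  note D = submodD[OF assms(4) \<open>ring B\<close>]
  show "\<Union>\<K> \<subseteq> carrier B" using D(1) by blast
  show "\<zero>\<^bsub>B\<^esub> \<in> \<Union>\<K>" using D(2) assms(2) by blast
  show "\<ominus>\<^bsub>B\<^esub> x \<in> \<Union>\<K>" if "x \<in> \<Union>\<K>" for x using that D(4) by blast
  show "\<phi> a \<otimes>\<^bsub>B\<^esub> x \<in> \<Union>\<K>" if "a \<in> carrier A" "x \<in> \<Union>\<K>" for a x using that D(6) by blast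
  fix x y assume "x \<in> \<Union>\<K>" "y \<in> \<Union>\<K>"
  then obtain U V where UV: "U \<in> \<K>" "V \<in> \<K>" "x \<in> U" "y \<in> V" by blast
  then have "U \<subseteq> V \<or> V \<subseteq> U"
    using assms(3) by blast
  then show "x \<oplus>\<^bsub>B\<^esub> y \<in> \<Union>\<K>" using UV D(3) by blast
qed fact

context ring
begin

lemma minus_minus_cancel: "x \<in> carrier R \<Longrightarrow> y \<in> carrier R \<Longrightarrow> x \<ominus> (x \<ominus> y) = y"
  and minus_add_cancel: "x \<in> carrier R \<Longrightarrow> y \<in> carrier R \<Longrightarrow> (x \<ominus> y) \<oplus> y = x"
  by (simp_all add: a_minus_def minus_add a_assoc[symmetric] r_neg)
    (simp add: a_assoc l_neg)

lemma lidealD: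
  assumes "lideal R L"
  shows "L \<subseteq> carrier R" "\<zero> \<in> L" "x \<in> L \<Longrightarrow> y \<in> L \<Longrightarrow> x \<oplus> y \<in> L" "x \<in> L \<Longrightarrow> \<ominus> x \<in> L"
    "x \<in> L \<Longrightarrow> y \<in> L \<Longrightarrow> x \<ominus> y \<in> L" "r \<in> carrier R \<Longrightarrow> x \<in> L \<Longrightarrow> r \<otimes> x \<in> L"
  using submodD[OF assms[unfolded lideal_iff_submod] ring_axioms] by auto

lemma lidealI:
  assumes "L \<subseteq> carrier R" "\<zero> \<in> L" "\<And>x y. x \<in> L \<Longrightarrow> y \<in> L \<Longrightarrow> x \<oplus> y \<in> L"
    "\<And>r x. r \<in> carrier R \<Longrightarrow> x \<in> L \<Longrightarrow> r \<otimes> x \<in> L"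
  shows "lideal R L"
  unfolding lideal_iff_submod
  by (rule submodI_hom) (use assms ring_axioms in auto)

lemma lideal_one: "lideal R L \<Longrightarrow> \<one> \<in> L \<Longrightarrow> L = carrier R"
  using lidealD[of L] by (metis r_one subsetI subset_antisym)

lemma exists_maximal_lideal:
  assumes "lideal R L" "L \<noteq> carrier R"
  obtains M where "maximal_lideal R M" "L \<subseteq> M"
proof -
  \<comment> \<open>Properness is expressed as \<open>\<one> \<notin> M\<close>, a condition that
    passes to unions of chains.\<close>
  let ?X = "{M. lideal R M \<and> L \<subseteq> M \<and> \<one> \<notin> M}"
  have "L \<in> ?X"
    using assms lideal_one by blast
  moreover have "\<Union>\<K> \<in> ?X"
    if "\<K> \<noteq> {}" "\<K> \<subseteq> ?X" and chain: "\<And>U V. U \<in> \<K> \<Longrightarrow> V \<in> \<K> \<Longrightarrow> U \<subseteq> V \<or> V \<subseteq> U" for \<K>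
  proof -
    have "\<K> \<subseteq> ?X" by fact
    moreover have "submod R R id (\<Union>\<K>)"
      by (rule submod_Union[OF ring_axioms that(1) chain])
        (use that in \<open>auto simp: lideal_iff_submod\<close>)
    ultimately show ?thesis
      using that(1) by (auto simp: lideal_iff_submod)
  qed
  ultimately obtain M where M: "M \<in> ?X" "\<forall>M'\<in>?X. M \<subseteq> M' \<longrightarrow> M' = M"
    using Zorn_nonempty_family[of ?X] by blast
  have "maximal_lideal R M"
    unfolding maximal_lideal_def
  proof (intro conjI allI impI)
    show "M \<noteq> carrier R" using M by auto
    fix L' assume "lideal R L' \<and> M \<subseteq> L' \<and> L' \<noteq> carrier R"
    then show "L' = M" using M lideal_one by blast
  qed (use M in auto)
  then show ?thesis using that M by auto
qed

lemma set_sum_lideal: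
  assumes "lideal R L" "x \<in> carrier R"
  shows "lideal R {r \<otimes> x \<oplus> l | r l. r \<in> carrier R \<and> l \<in> L}" (is "lideal R ?S")
proof (rule lidealI)
  note D = lidealD[OF assms(1)]
  show "?S \<subseteq> carrier R" using D assms by auto
  show "\<zero> \<in> ?S" using D(2) assms by (intro CollectI exI[of _ \<zero>]) auto
  fix y z assume "y \<in> ?S" "z \<in> ?S"
  then obtain r l r' l' where *: "y = r \<otimes> x \<oplus> l" "z = r' \<otimes> x \<oplus> l'"
    "r \<in> carrier R" "r' \<in> carrier R" "l \<in> L" "l' \<in> L" by blast
  then have c: "l \<in> carrier R" "l' \<in> carrier R" using D(1) by auto
  have "y \<oplus> z = (r \<oplus> r') \<otimes> x \<oplus> (l \<oplus> l')"
    using * c assms by (simp add: l_distr a_ac)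
  then show "y \<oplus> z \<in> ?S" using * D(3) by blast
next
  note D = lidealD[OF assms(1)]
  fix s y assume s: "s \<in> carrier R" and "y \<in> ?S"
  then obtain r l where *: "y = r \<otimes> x \<oplus> l" "r \<in> carrier R" "l \<in> L" by blast
  have "s \<otimes> y = (s \<otimes> r) \<otimes> x \<oplus> s \<otimes> l"
    using * s D(1) assms by (auto simp: r_distr m_assoc)
  then show "s \<otimes> y \<in> ?S" using * s D(6) by blast
qed

text \<open>By maximality \<open>R x + M\<close> is the whole ring and so contains
  \<open>\<one>\<close>.\<close>

lemma maximal_lideal_one:
  assumes "maximal_lideal R M" "x \<in> carrier R" "x \<notin> M"
  obtains r where "r \<in> carrier R" "r \<otimes> x \<ominus> \<one> \<in> M"
proof -
  have M: "lideal R M" using assms by (simp add: maximal_lideal_def)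
  note D = lidealD[OF this]
  let ?S = "{r \<otimes> x \<oplus> l | r l. r \<in> carrier R \<and> l \<in> M}"
  have "M \<subseteq> ?S"
  proof
    fix l assume "l \<in> M"
    then show "l \<in> ?S" using D(1) assms by (intro CollectI exI[of _ \<zero>] exI[of _ l]) auto
  qed
  moreover have "x \<in> ?S"
    using D(2) assms by (intro CollectI exI[of _ \<one>] exI[of _ \<zero>]) auto
  ultimately have "?S = carrier R"
    using assms set_sum_lideal[OF M assms(2)] unfolding maximal_lideal_def by blast
  then obtain r l where *: "\<one> = r \<otimes> x \<oplus> l" "r \<in> carrier R" "l \<in> M"
    by blast
  have "l \<in> carrier R" using * D(1) by auto
  then have "r \<otimes> x \<ominus> \<one> = \<ominus> l"
    unfolding *(1) using *(2) assms(2) by algebra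
  then show ?thesis using that * D(4) by metis
qed

section \<open>The Jacobson radical: two-sidedness and invertibility of \<open>1 - x\<close>\<close>

abbreviation "J \<equiv> jacobson_rad R"

lemma jacobson_rad_lideal: "lideal R J"
proof (rule lidealI)
  have D: "M \<in> {L. maximal_lideal R L} \<Longrightarrow> lideal R M" for M
    by (simp add: maximal_lideal_def)
  note D = lidealD[OF D]
  show "\<zero> \<in> J" using D(2) by (simp add: jacobson_rad_def)
  show "x \<oplus> y \<in> J" if "x \<in> J" "y \<in> J" for x y using that D(3) by (simp add: jacobson_rad_def)
  show "r \<otimes> x \<in> J" if "r \<in> carrier R" "x \<in> J" for r x using that D(6) by (simp add: jacobson_rad_def)
qed (simp add: jacobson_rad_def)

text \<open>For a maximal left ideal \<open>M\<close> and \<open>r \<notin> M\<close>, the left ideal \<open>{y. y r \<in> M}\<close> is again maximal.\<close>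

lemma jacobson_rad_r_closed:
  assumes x: "x \<in> J" and r: "r \<in> carrier R"
  shows "x \<otimes> r \<in> J"
proof -
  have xc: "x \<in> carrier R" using x by (simp add: jacobson_rad_def)
  have "x \<otimes> r \<in> M" if M: "maximal_lideal R M" for M
  proof (cases "r \<in> M")
    case True
    then show ?thesis using M xc lidealD(6)[of M x r] by (simp add: maximal_lideal_def)
  next
    case False
    have lM: "lideal R M" using M by (simp add: maximal_lideal_def)
    note D = lidealD[OF lM]
    let ?N = "{y \<in> carrier R. y \<otimes> r \<in> M}"
    have N: "lideal R ?N"
      by (rule lidealI) (use D r in \<open>auto simp: l_distr m_assoc\<close>)
    have "maximal_lideal R ?N"
      unfolding maximal_lideal_def
    proof (intro conjI allI impI)
      have "\<one> \<notin> ?N" using r False by simp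
      then show "?N \<noteq> carrier R" using one_closed by blast
      fix L assume L: "lideal R L \<and> ?N \<subseteq> L \<and> L \<noteq> carrier R"
      then have lL: "lideal R L" by simp
      note E = lidealD[OF lL]
      show "L = ?N"
      proof (rule ccontr)
        assume "L \<noteq> ?N"
        then obtain y where y: "y \<in> L" "y \<otimes> r \<notin> M" "y \<in> carrier R" using L E(1) by blast
        obtain s where s: "s \<in> carrier R" "s \<otimes> (y \<otimes> r) \<ominus> \<one> \<in> M"
          using maximal_lideal_one[OF M _ y(2)] y(3) r by auto
        have "r \<otimes> (s \<otimes> (y \<otimes> r) \<ominus> \<one>) \<in> M" using s r D by simp
        moreover have "r \<otimes> (s \<otimes> (y \<otimes> r) \<ominus> \<one>) = (r \<otimes> s \<otimes> y \<ominus> \<one>) \<otimes> r"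
          using r s y by (simp add: a_minus_def l_distr r_distr l_minus r_minus m_assoc)
        ultimately have "r \<otimes> s \<otimes> y \<ominus> \<one> \<in> ?N" using r s y by simp
        then have "r \<otimes> s \<otimes> y \<ominus> \<one> \<in> L" using L by blast
        moreover have "r \<otimes> s \<otimes> y \<in> L" using E(6) r s y by simp
        ultimately have "r \<otimes> s \<otimes> y \<ominus> (r \<otimes> s \<otimes> y \<ominus> \<one>) \<in> L" using E(5) by blast
        moreover have "r \<otimes> s \<otimes> y \<ominus> (r \<otimes> s \<otimes> y \<ominus> \<one>) = \<one>" using r s y by (simp add: minus_minus_cancel)
        ultimately show False using lideal_one[OF lL] L by simp
      qed
    qed (use N in auto)
    then have "x \<in> ?N" using x by (auto simp: jacobson_rad_def)
    then show ?thesis by simp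
  qed
  then show ?thesis using xc r by (simp add: jacobson_rad_def)
qed

lemma jacobson_rad_ideal: "ideal J R"
  by (rule idealI)
    (use jacobson_rad_lideal jacobson_rad_r_closed ring_axioms in
      \<open>auto simp: lideal_def additive_subgroup.a_subgroup\<close>)

text \<open>A maximal left ideal containing \<open>1 - x\<close> also contains \<open>x\<close>,
  hence \<open>1\<close>; so \<open>1 - x\<close> generates the whole ring as a left ideal.\<close>

lemma jacobson_rad_left_inverse:
  assumes "x \<in> J"
  obtains u where "u \<in> carrier R" "u \<otimes> (\<one> \<ominus> x) = \<one>"
proof -
  have xc: "x \<in> carrier R" using assms by (simp add: jacobson_rad_def)
  let ?L = "{r \<otimes> (\<one> \<ominus> x) | r. r \<in> carrier R}"
  have L: "lideal R ?L"
  proof (rule lidealI)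
    show "\<zero> \<in> ?L" using xc by (intro CollectI exI[of _ \<zero>]) auto
    fix y z assume "y \<in> ?L" "z \<in> ?L"
    then obtain r s where "y = r \<otimes> (\<one> \<ominus> x)" "r \<in> carrier R" "z = s \<otimes> (\<one> \<ominus> x)" "s \<in> carrier R"
      by blast
    then show "y \<oplus> z \<in> ?L"
      using xc by (intro CollectI exI[of _ "r \<oplus> s"]) (simp add: l_distr)
  next
    fix r y assume "r \<in> carrier R" "y \<in> ?L"
    moreover then obtain s where "y = s \<otimes> (\<one> \<ominus> x)" "s \<in> carrier R" by blast
    ultimately show "r \<otimes> y \<in> ?L"
      using xc by (intro CollectI exI[of _ "r \<otimes> s"]) (simp add: m_assoc)
  qed (use xc in auto)
  have one: "\<one> \<ominus> x \<in> ?L" using xc by (intro CollectI exI[of _ \<one>]) auto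
  have "?L = carrier R"
  proof (rule ccontr)
    assume "?L \<noteq> carrier R"
    then obtain M where M: "maximal_lideal R M" "?L \<subseteq> M"
      using exists_maximal_lideal[OF L] by blast
    then have lM: "lideal R M" by (simp add: maximal_lideal_def)
    have "x \<in> M" "\<one> \<ominus> x \<in> M" using M assms one by (auto simp: jacobson_rad_def)
    then have "(\<one> \<ominus> x) \<oplus> x \<in> M" using lidealD[OF lM] by blast
    moreover have "(\<one> \<ominus> x) \<oplus> x = \<one>" using xc by (simp add: minus_add_cancel)
    ultimately show False using lideal_one[OF lM] M by (simp add: maximal_lideal_def)
  qed
  then have "\<one> \<in> ?L" by simp
  then show ?thesis using that by force
qed

text \<open>A left inverse satisfies \<open>u = 1 - (- u x)\<close> with \<open>- u x\<close> in
  \<open>J\<close>, so \<open>u\<close> has itself a left inverse \<open>v\<close>. As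
  \<open>1 - x\<close> is a right inverse of \<open>u\<close>, it equals \<open>v\<close>.\<close>

lemma jacobson_rad_inverse:
  assumes "x \<in> J"
  obtains u where "u \<in> carrier R" "u \<otimes> (\<one> \<ominus> x) = \<one>" "(\<one> \<ominus> x) \<otimes> u = \<one>"
proof -
  interpret JI: ideal J R by (rule jacobson_rad_ideal)
  have xc: "x \<in> carrier R" using assms by (simp add: jacobson_rad_def)
  obtain u where u: "u \<in> carrier R" "u \<otimes> (\<one> \<ominus> x) = \<one>" using jacobson_rad_left_inverse[OF assms] .
  have "u \<otimes> (\<one> \<ominus> x) = u \<ominus> u \<otimes> x" 
    using u(1) xc by (simp add: a_minus_def r_distr r_minus)
  then have eq: "u \<ominus> u \<otimes> x = \<one>" using u(2) by metis
  have "\<ominus> (u \<otimes> x) \<in> J" using u assms JI.I_l_closed by simp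
  then obtain v where v: "v \<in> carrier R" "v \<otimes> (\<one> \<ominus> (\<ominus> (u \<otimes> x))) = \<one>"
    using jacobson_rad_left_inverse by blast
  have "\<one> \<ominus> (\<ominus> (u \<otimes> x)) = \<one> \<oplus> u \<otimes> x" using u xc by algebra
  also have "\<dots> = (u \<ominus> u \<otimes> x) \<oplus> u \<otimes> x" using eq by simp
  also have "\<dots> = u" using u xc by (simp add: minus_add_cancel)
  finally have vu: "v \<otimes> u = \<one>" using v by simp
  have "v = v \<otimes> (u \<otimes> (\<one> \<ominus> x))" using u v by simp
  also have "\<dots> = (v \<otimes> u) \<otimes> (\<one> \<ominus> x)" using u v xc by (simp add: m_assoc)
  also have "\<dots> = \<one> \<ominus> x" using vu xc by simp
  finally show ?thesis using that u vu by simp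
qed

end

text \<open>Stated for additive subgroups because it also serves for cosets of left ideals.\<close>

lemma (in abelian_subgroup) coset_eq_iff:
  assumes "ring G" "x \<in> carrier G" "y \<in> carrier G"
  shows "H +> x = H +> y \<longleftrightarrow> x \<ominus> y \<in> H"
  using assms a_rcos_module_minus[OF assms(1,3,2)] a_repr_independence' a_rcos_self by metis

lemma (in ideal) coset_eq_iff_minus:
  assumes "x \<in> carrier R" "y \<in> carrier R"
  shows "I +> x = I +> y \<longleftrightarrow> x \<ominus> y \<in> I"
  using assms by (rule coset_eq_iff[OF ring_axioms])

lemma carrier_Quot: "carrier (R Quot I) = (+>\<^bsub>R\<^esub>) I ` carrier R"
  by (auto simp: FactRing_def A_RCOSETS_def')

lemma zero_Quot: "\<zero>\<^bsub>R Quot I\<^esub> = I"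
  by (simp add: FactRing_def)

section \<open>Semilocal rings: complements and idempotents modulo the radical\<close>

context ring
begin

lemma add_minus_cancel: "x \<in> carrier R \<Longrightarrow> y \<in> carrier R \<Longrightarrow> x \<oplus> y \<ominus> x = y"
  by (simp add: a_comm[of x y] a_minus_def a_assoc r_neg)

text \<open>The preimage in \<open>R\<close> of a complement of the image of \<open>L\<close> in the
  semisimple ring \<open>R / J\<close>.\<close>

lemma semilocal_complement:
  assumes "semilocal R" "lideal R L" "J \<subseteq> L"
  obtains L' where "lideal R L'" "J \<subseteq> L'" "L \<inter> L' = J"
    "\<And>x. x \<in> carrier R \<Longrightarrow> \<exists>y\<in>L. \<exists>z\<in>L'. x = y \<oplus> z"
proof -
  interpret JI: ideal J R by (rule jacobson_rad_ideal)
  let ?Q = "R Quot J" and ?\<pi> = "(+>) J"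
  interpret Q: ring_hom_ring R ?Q ?\<pi> by (rule JI.rcos_ring_hom_ring)
  note D = lidealD[OF assms(2)]
  have lQ: "lideal ?Q (?\<pi> ` L)"
  proof (rule Q.S.lidealI)
    show "?\<pi> ` L \<subseteq> carrier ?Q" using D(1) by auto
    show "\<zero>\<^bsub>?Q\<^esub> \<in> ?\<pi> ` L" using D(2) Q.hom_zero by (metis imageI)
    show "x \<oplus>\<^bsub>?Q\<^esub> y \<in> ?\<pi> ` L" if "x \<in> ?\<pi> ` L" "y \<in> ?\<pi> ` L" for x y
      using that D(1,3) by (auto simp flip: Q.hom_add simp: subset_iff)
    show "x \<otimes>\<^bsub>?Q\<^esub> y \<in> ?\<pi> ` L" if "x \<in> carrier ?Q" "y \<in> ?\<pi> ` L" for x y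
      using that D(1,6) by (auto simp flip: Q.hom_mult simp: subset_iff carrier_Quot)
  qed
  have "\<forall>L. lideal ?Q L \<longrightarrow> (\<exists>L'. lideal ?Q L' \<and> L \<inter> L' = {\<zero>\<^bsub>?Q\<^esub>} \<and>
      {x \<oplus>\<^bsub>?Q\<^esub> y | x y. x \<in> L \<and> y \<in> L'} = carrier ?Q)"
    by (rule assms(1)[unfolded semilocal_def semisimple_ring_def, THEN conjunct2, THEN conjunct2])
  from this[rule_format, OF lQ] obtain M where "lideal ?Q M \<and> ?\<pi> ` L \<inter> M = {\<zero>\<^bsub>?Q\<^esub>} \<and>
      {x \<oplus>\<^bsub>?Q\<^esub> y | x y. x \<in> ?\<pi> ` L \<and> y \<in> M} = carrier ?Q" by (rule exE)
  then have M: "lideal ?Q M" "?\<pi> ` L \<inter> M = {\<zero>\<^bsub>?Q\<^esub>}"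
    "{x \<oplus>\<^bsub>?Q\<^esub> y | x y. x \<in> ?\<pi> ` L \<and> y \<in> M} = carrier ?Q" by simp_all
  note E = Q.S.lidealD[OF M(1)]
  let ?L' = "{x \<in> carrier R. ?\<pi> x \<in> M}"
  have zero: "?\<pi> x = \<zero>\<^bsub>?Q\<^esub> \<longleftrightarrow> x \<in> J" if "x \<in> carrier R" for x
    using that JI.coset_eq_iff_minus[of x \<zero>] by (simp add: zero_Quot a_minus_def)
  have Jc: "J \<subseteq> carrier R" by (rule JI.a_subset)
  have JL': "J \<subseteq> ?L'"
  proof
    fix x assume x: "x \<in> J"
    then have "?\<pi> x = \<zero>\<^bsub>?Q\<^esub>" using Jc zero by blast
    then show "x \<in> ?L'" using x Jc E(2) by auto
  qed
  show ?thesis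
  proof
    show "lideal R ?L'"
      by (rule lidealI) (use E in auto)
    show "J \<subseteq> ?L'" by fact
    have "x \<in> J" if "x \<in> L" "x \<in> ?L'" for x
    proof -
      have "?\<pi> x \<in> ?\<pi> ` L \<inter> M" using that by simp
      then have "?\<pi> x = \<zero>\<^bsub>?Q\<^esub>" using M(2) by simp
      then show ?thesis using zero that(2) by simp
    qed
    then show "L \<inter> ?L' = J" using JL' assms(3) by blast
    fix x assume x: "x \<in> carrier R"
    then have "?\<pi> x \<in> {x \<oplus>\<^bsub>?Q\<^esub> y | x y. x \<in> ?\<pi> ` L \<and> y \<in> M}" using M(3) by simp
    then obtain y v where y: "?\<pi> x = ?\<pi> y \<oplus>\<^bsub>?Q\<^esub> v" "y \<in> L" "v \<in> M" by blast
    have yc: "y \<in> carrier R" and vc: "v \<in> carrier ?Q" using y D(1) E(1) by auto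
    have "?\<pi> (x \<ominus> y) = \<ominus>\<^bsub>?Q\<^esub> ?\<pi> y \<oplus>\<^bsub>?Q\<^esub> (?\<pi> y \<oplus>\<^bsub>?Q\<^esub> v)"
      using x yc vc by (simp add: a_minus_def flip: y(1)) (simp add: Q.S.a_comm)
    also have "\<dots> = v" using yc vc by (simp add: Q.S.r_neg1)
    finally have "x \<ominus> y \<in> ?L'" using x yc y by simp
    moreover have "x = y \<oplus> (x \<ominus> y)" using x yc by (metis a_comm minus_closed minus_add_cancel)
    ultimately show "\<exists>y\<in>L. \<exists>z\<in>?L'. x = y \<oplus> z" using y by blast
  qed
qed

text \<open>Split \<open>1 = f + g\<close> along \<open>K\<close> and a complement \<open>L'\<close>
  modulo \<open>J\<close>. Then \<open>k - k f = k g\<close> lies in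
  \<open>K \<inter> L' = J\<close>. On the other side \<open>k - f k = g k\<close>, and
  \<open>x = g k\<close> satisfies \<open>x R x \<subseteq> J\<close>; since a semisimple ring has
  no nonzero left ideal of square zero, \<open>x\<close> lies in \<open>J\<close>.\<close>

lemma semilocal_ideal_idempotent:
  assumes sl: "semilocal R" and K: "ideal K R" "J \<subseteq> K"
  shows "\<exists>f\<in>K. \<forall>k\<in>K. k \<ominus> k \<otimes> f \<in> J \<and> k \<ominus> f \<otimes> k \<in> J"
proof -
  interpret JI: ideal J R by (rule jacobson_rad_ideal)
  interpret KI: ideal K R by fact
  have "lideal R K"
    by (simp add: lideal_def KI.is_additive_subgroup KI.I_l_closed)
  then obtain L' where L': "lideal R L'" "K \<inter> L' = J" "\<And>x. x \<in> carrier R \<Longrightarrow> \<exists>y\<in>K. \<exists>z\<in>L'. x = y \<oplus> z"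
    using semilocal_complement[OF sl _ K(2)] by metis
  obtain f g where fg: "\<one> = f \<oplus> g" "f \<in> K" "g \<in> L'" using L'(3) by blast
  have c: "f \<in> carrier R" "g \<in> carrier R" using fg lidealD(1)[OF L'(1)] by auto
  have Kg: "k \<otimes> g \<in> J" if k: "k \<in> K" for k
  proof -
    have "k \<otimes> g \<in> L'" using k fg lidealD(6)[OF L'(1)] KI.Icarr by simp
    moreover have "k \<otimes> g \<in> K" using k c KI.I_r_closed by simp
    ultimately show ?thesis using L'(2) by blast
  qed
  have right: "k \<ominus> k \<otimes> f = k \<otimes> g" if k: "k \<in> K" for k
  proof -
    have "k \<ominus> k \<otimes> f = k \<otimes> (f \<oplus> g) \<ominus> k \<otimes> f" using k KI.Icarr by (simp flip: fg(1))
    also have "\<dots> = k \<otimes> g"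
      using k c KI.Icarr by (simp add: r_distr add_minus_cancel)
    finally show ?thesis .
  qed
  have left: "k \<ominus> f \<otimes> k = g \<otimes> k" if k: "k \<in> K" for k
  proof -
    have "k \<ominus> f \<otimes> k = (f \<oplus> g) \<otimes> k \<ominus> f \<otimes> k" using k KI.Icarr by (simp flip: fg(1))
    also have "\<dots> = g \<otimes> k"
      using k c KI.Icarr by (simp add: l_distr add_minus_cancel)
    finally show ?thesis .
  qed
  have gK: "g \<otimes> k \<in> J" if k: "k \<in> K" for k
  proof -
    let ?x = "g \<otimes> k"
    have kc: "k \<in> carrier R" using k KI.Icarr by simp
    \<comment> \<open>With \<open>1 = u + v\<close> along \<open>R x + J\<close> and a complement
      \<open>L''\<close>, the product \<open>x u\<close> is in \<open>J\<close> because
      \<open>x R x\<close> is, while \<open>x v = x - x u\<close> lies in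
      \<open>L \<inter> L'' = J\<close>.\<close>
    define L where "L = {r \<otimes> ?x \<oplus> l | r l. r \<in> carrier R \<and> l \<in> J}"
    have L: "lideal R L"
      unfolding L_def using kc c by (intro set_sum_lideal jacobson_rad_lideal) auto
    have JL: "J \<subseteq> L"
    proof
      fix l assume "l \<in> J"
      then show "l \<in> L" unfolding L_def using c kc JI.Icarr by (intro CollectI exI[of _ \<zero>] exI[of _ l]) auto
    qed
    obtain L'' where L'': "lideal R L''" "L \<inter> L'' = J"
      "\<And>x. x \<in> carrier R \<Longrightarrow> \<exists>y\<in>L. \<exists>z\<in>L''. x = y \<oplus> z"
      using semilocal_complement[OF sl L JL] by metis
    obtain u v where uv: "\<one> = u \<oplus> v" "u \<in> L" "v \<in> L''"
      using L''(3)[OF one_closed] by blast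
    obtain r l where u: "u = r \<otimes> ?x \<oplus> l" "r \<in> carrier R" "l \<in> J"
      using uv(2) unfolding L_def by blast
    have lc: "l \<in> carrier R" using u JI.Icarr by simp
    have vc: "v \<in> carrier R" using uv lidealD(1)[OF L''(1)] by auto
    have uc: "u \<in> carrier R" using u lc c kc by simp
    have xc: "?x \<in> carrier R" using c kc by simp
    have xK: "?x \<in> K" using k c by (simp add: KI.I_l_closed)
    have "?x \<otimes> u = g \<otimes> ((k \<otimes> r) \<otimes> g) \<otimes> k \<oplus> ?x \<otimes> l"
      using u lc c kc by (simp add: r_distr m_assoc)
    moreover have "(k \<otimes> r) \<otimes> g \<in> J" using Kg k u by (simp add: KI.I_r_closed)
    ultimately have xu: "?x \<otimes> u \<in> J"
      using u c kc xc by (simp add: JI.I_l_closed JI.I_r_closed)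
    have x: "?x = ?x \<otimes> u \<oplus> ?x \<otimes> v"
      using xc uc vc uv(1) by (metis r_distr r_one)
    have xv: "?x \<otimes> v \<in> L''" using uv lidealD(6)[OF L''(1)] xc by simp
    have "?x = \<one> \<otimes> ?x \<oplus> \<zero>" using xc by simp
    then have "?x \<in> L" unfolding L_def using JI.zero_closed one_closed by blast
    moreover have "?x \<otimes> u \<in> L" using xu JL by blast
    ultimately have "?x \<ominus> ?x \<otimes> u \<in> L" by (rule lidealD(5)[OF L])
    moreover have "?x \<ominus> ?x \<otimes> u = ?x \<otimes> v"
    proof -
      have "?x \<ominus> ?x \<otimes> u = (?x \<otimes> u \<oplus> ?x \<otimes> v) \<ominus> ?x \<otimes> u"
        by (rule arg_cong[OF x, of "\<lambda>z. z \<ominus> ?x \<otimes> u"])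
      also have "\<dots> = ?x \<otimes> v"
        using xc uc vc by (simp add: add_minus_cancel)
      finally show ?thesis .
    qed
    ultimately have "?x \<otimes> v \<in> J" using xv L''(2) by auto
    then show ?thesis using x xu JI.a_closed by metis
  qed
  show ?thesis
    by (intro bexI[OF _ fg(2)] ballI) (simp add: right left Kg gK)
qed

end

text \<open>Nakayama's lemma for left T-nilpotent sets: otherwise one finds \<open>b\<^sub>n\<close> in \<open>M\<close> and \<open>s\<^sub>n\<close> in \<open>S\<close>
  with \<open>b\<^sub>n s\<^sub>n \<dots> s\<^sub>0 \<notin> N\<close> for all \<open>n\<close>.\<close>

lemma left_T_nilpotent_Nakayama:
  assumes "ring A" "ring B" "\<phi> \<in> ring_hom A B" and S: "S \<subseteq> carrier A"
    and nil: "left_T_nilpotent A S" and N: "additive_subgroup N B"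
    and N_r: "\<And>n a. n \<in> N \<Longrightarrow> a \<in> carrier A \<Longrightarrow> n \<otimes>\<^bsub>B\<^esub> \<phi> a \<in> N"
    and M: "M \<subseteq> carrier B"
    and M_sum: "\<And>m. m \<in> M \<Longrightarrow> \<exists>n\<in>N. \<exists>t\<in>ideal_prod B M (\<phi> ` S). m = n \<oplus>\<^bsub>B\<^esub> t"
  shows "M \<subseteq> N"
proof (rule ccontr)
  interpret A: ring A by fact
  interpret B: ring B by fact
  interpret ring_hom_ring A B \<phi> using assms by (simp add: ring_hom_ringI2)
  interpret N: additive_subgroup N B by fact
  assume "\<not> M \<subseteq> N"
  then obtain b0 where b0: "b0 \<in> M" "b0 \<notin> N" by blast
  \<comment> \<open>Write \<open>b\<close> as \<open>n\<close> plus a sum of terms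
    \<open>b' \<phi>(s)\<close>. If every \<open>b' \<phi>(s p)\<close> were in \<open>N\<close>,
    then so would be \<open>b \<phi>(p)\<close>, because \<open>n \<phi>(p)\<close> is in
    \<open>N\<close>.\<close>
  have step: "\<exists>b'\<in>M. \<exists>s\<in>S. b' \<otimes>\<^bsub>B\<^esub> \<phi> (s \<otimes>\<^bsub>A\<^esub> p) \<notin> N"
    if b: "b \<in> M" "p \<in> carrier A" "b \<otimes>\<^bsub>B\<^esub> \<phi> p \<notin> N" for b p
  proof (rule ccontr)
    assume "\<not> ?thesis"
    then have *: "b' \<otimes>\<^bsub>B\<^esub> \<phi> (s \<otimes>\<^bsub>A\<^esub> p) \<in> N" if "b' \<in> M" "s \<in> S" for b' s using that by blast
    have t: "t \<in> carrier B \<and> t \<otimes>\<^bsub>B\<^esub> \<phi> p \<in> N" if "t \<in> ideal_prod B M (\<phi> ` S)" for t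
      using that
    proof induction
      case (prod i j)
      then obtain s where s: "j = \<phi> s" "s \<in> S" by blast
      then have "i \<in> carrier B" "s \<in> carrier A" using prod M S by auto
      then show ?case using *[OF prod(1) s(2)] s b(2) by (simp add: B.m_assoc)
    next
      case (sum s1 s2)
      then show ?case using b(2) by (simp add: B.l_distr)
    qed
    obtain n t' where "n \<in> N" "t' \<in> ideal_prod B M (\<phi> ` S)" "b = n \<oplus>\<^bsub>B\<^esub> t'"
      using M_sum[OF b(1)] by blast
    moreover from this have "n \<in> carrier B" "t' \<in> carrier B" using t by auto
    ultimately have "b \<otimes>\<^bsub>B\<^esub> \<phi> p = n \<otimes>\<^bsub>B\<^esub> \<phi> p \<oplus>\<^bsub>B\<^esub> t' \<otimes>\<^bsub>B\<^esub> \<phi> p" "n \<otimes>\<^bsub>B\<^esub> \<phi> p \<in> N" "t' \<otimes>\<^bsub>B\<^esub> \<phi> p \<in> N"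
      using b(2) N_r t by (auto simp: B.l_distr)
    then show False using b(3) by simp
  qed
  \<comment> \<open>A state \<open>(b, p, s)\<close> holds the current element of \<open>M\<close>,
    the product so far and its leftmost factor. As \<open>lprod A a 0\<close> is \<open>a 0\<close>
    and not an empty product, the initial state has \<open>p = s\<close>.\<close>
  let ?P = "\<lambda>n (b, p, s). b \<in> M \<and> p \<in> carrier A \<and> s \<in> S \<and> b \<otimes>\<^bsub>B\<^esub> \<phi> p \<notin> N \<and> (n = (0::nat) \<longrightarrow> p = s)"
  let ?Q = "\<lambda>n :: nat. \<lambda>(b, p, s) (b', p', s'). p' = s' \<otimes>\<^bsub>A\<^esub> p"
  have "\<exists>F. \<forall>n. ?P n (F n) \<and> ?Q n (F n) (F (Suc n))"
  proof (rule dependent_nat_choice)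
    obtain b s where "b \<in> M" "s \<in> S" "b \<otimes>\<^bsub>B\<^esub> \<phi> (s \<otimes>\<^bsub>A\<^esub> \<one>\<^bsub>A\<^esub>) \<notin> N"
      using step[OF b0(1) A.one_closed] b0 M by (metis B.r_one hom_one subsetD)
    then show "\<exists>x. ?P 0 x" using S by (intro exI[of _ "(b, s, s)"]) auto
    fix x n assume "?P n x"
    then obtain b p s where x: "x = (b, p, s)" "b \<in> M" "p \<in> carrier A" "b \<otimes>\<^bsub>B\<^esub> \<phi> p \<notin> N"
      by (auto split: prod.splits)
    then obtain b' s' where "b' \<in> M" "s' \<in> S" "b' \<otimes>\<^bsub>B\<^esub> \<phi> (s' \<otimes>\<^bsub>A\<^esub> p) \<notin> N"
      using step by blast
    then show "\<exists>y. ?P (Suc n) y \<and> ?Q n x y"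
      using x S by (intro exI[of _ "(b', s' \<otimes>\<^bsub>A\<^esub> p, s')"]) auto
  qed
  then obtain F where F': "\<forall>n. ?P n (F n) \<and> ?Q n (F n) (F (Suc n))" by (rule exE)
  note F = F'[rule_format, THEN conjunct1] F'[rule_format, THEN conjunct2]
  define a where "a n = snd (snd (F n))" for n
  have p: "fst (snd (F n)) = lprod A a n" for n
  proof (induction n)
    case 0
    then show ?case using F(1)[of 0] by (auto simp: a_def split: prod.splits)
  next
    case (Suc n)
    then show ?case using F(2)[of n] by (auto simp: a_def split: prod.splits)
  qed
  have "a n \<in> S" for n using F(1)[of n] by (simp add: a_def split_beta)
  then obtain n where "lprod A a n = \<zero>\<^bsub>A\<^esub>" using nil unfolding left_T_nilpotent_def by blast
  then have "fst (snd (F n)) = \<zero>\<^bsub>A\<^esub>" using p by simp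
  then show False using F(1)[of n] M by (auto split: prod.splits)
qed

text \<open>The map \<open>b \<mapsto> L + g b\<close> into the left \<open>B\<close>-module
  \<open>B / L\<close> is additive and \<open>A\<close>-linear, hence \<open>B\<close>-linear.
  Congruences are the form in which a map given by chosen representatives satisfies these
  conditions.\<close>

lemma epi_almost_linear:
  assumes epi: "ring_epi A B \<phi>" and L: "lideal B L"
    and g: "\<And>b. b \<in> carrier B \<Longrightarrow> g b \<in> carrier B"
    and add: "\<And>b c. b \<in> carrier B \<Longrightarrow> c \<in> carrier B \<Longrightarrow>
      g (b \<oplus>\<^bsub>B\<^esub> c) \<ominus>\<^bsub>B\<^esub> (g b \<oplus>\<^bsub>B\<^esub> g c) \<in> L"
    and lin: "\<And>a b. a \<in> carrier A \<Longrightarrow> b \<in> carrier B \<Longrightarrow>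
      g (\<phi> a \<otimes>\<^bsub>B\<^esub> b) \<ominus>\<^bsub>B\<^esub> \<phi> a \<otimes>\<^bsub>B\<^esub> g b \<in> L"
    and b: "b \<in> carrier B"
  shows "g b \<ominus>\<^bsub>B\<^esub> b \<otimes>\<^bsub>B\<^esub> g \<one>\<^bsub>B\<^esub> \<in> L"
proof -
  interpret B: ring B using epi by (simp add: ring_epi_def)
  have Ls: "additive_subgroup L B" using L by (simp add: lideal_def)
  interpret L: abelian_subgroup L B
    using Ls B.is_abelian_group by (rule abelian_subgroupI3)
  note eq = L.coset_eq_iff[OF B.ring_axioms]
  \<comment> \<open>As \<open>L\<close> is only a left ideal, \<open>B Quot L\<close> serves as an
    additive group. The action adds \<open>L\<close> because the set of products \<open>b y\<close>
    with \<open>y\<close> in a coset may be smaller than a coset.\<close>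
  let ?G = "B Quot L"
  let ?act = "\<lambda>b Y. L <+>\<^bsub>B\<^esub> (\<lambda>y. b \<otimes>\<^bsub>B\<^esub> y) ` Y"
  have act: "?act c (L +>\<^bsub>B\<^esub> x) = L +>\<^bsub>B\<^esub> (c \<otimes>\<^bsub>B\<^esub> x)" if "c \<in> carrier B" "x \<in> carrier B" for c x
  proof
    show "?act c (L +>\<^bsub>B\<^esub> x) \<subseteq> L +>\<^bsub>B\<^esub> (c \<otimes>\<^bsub>B\<^esub> x)"
    proof
      fix y assume "y \<in> ?act c (L +>\<^bsub>B\<^esub> x)"
      then obtain l l' where l: "l \<in> L" "l' \<in> L" "y = l \<oplus>\<^bsub>B\<^esub> c \<otimes>\<^bsub>B\<^esub> (l' \<oplus>\<^bsub>B\<^esub> x)"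
        by (auto simp: set_add_def' a_r_coset_def')
      then have "y = (l \<oplus>\<^bsub>B\<^esub> c \<otimes>\<^bsub>B\<^esub> l') \<oplus>\<^bsub>B\<^esub> c \<otimes>\<^bsub>B\<^esub> x"
        using that by (simp add: B.r_distr B.a_assoc)
      moreover have "l \<oplus>\<^bsub>B\<^esub> c \<otimes>\<^bsub>B\<^esub> l' \<in> L" using l that B.lidealD(6)[OF L] by simp
      ultimately show "y \<in> L +>\<^bsub>B\<^esub> (c \<otimes>\<^bsub>B\<^esub> x)" by (auto simp: a_r_coset_def')
    qed
    show "L +>\<^bsub>B\<^esub> (c \<otimes>\<^bsub>B\<^esub> x) \<subseteq> ?act c (L +>\<^bsub>B\<^esub> x)"
    proof
      fix y assume "y \<in> L +>\<^bsub>B\<^esub> (c \<otimes>\<^bsub>B\<^esub> x)"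
      then obtain l where "l \<in> L" "y = l \<oplus>\<^bsub>B\<^esub> c \<otimes>\<^bsub>B\<^esub> x"
        by (auto simp: a_r_coset_def')
      then show "y \<in> ?act c (L +>\<^bsub>B\<^esub> x)"
        using L.a_rcos_self[OF that(2)] unfolding set_add_def' by blast
    qed
  qed
  have "abelian_group ?G"
    by (rule comm_group_abelian_groupI)
      (simp add: FactRing_def L.a_factorgroup_is_comm_group[unfolded A_FactGroup_def'])
  then interpret G: abelian_group ?G .
  have Gadd: "(L +>\<^bsub>B\<^esub> x) \<oplus>\<^bsub>?G\<^esub> (L +>\<^bsub>B\<^esub> y) = L +>\<^bsub>B\<^esub> (x \<oplus>\<^bsub>B\<^esub> y)"
    if "x \<in> carrier B" "y \<in> carrier B" for x y
    using that by (simp add: FactRing_def L.a_rcos_sum)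
  interpret linear_test B ?G ?act "\<lambda>b. L +>\<^bsub>B\<^esub> g b"
  proof
    have coset: "\<exists>x\<in>carrier B. y = L +>\<^bsub>B\<^esub> x" if "y \<in> carrier ?G" for y
      using that unfolding carrier_Quot by blast
    show "?act b y \<in> carrier ?G" if "b \<in> carrier B" "y \<in> carrier ?G" for b y
      using that coset[of y] act by (auto simp: carrier_Quot)
    show "?act \<one>\<^bsub>B\<^esub> y = y" if "y \<in> carrier ?G" for y
      using that coset[of y] act by auto
    show "?act (b \<otimes>\<^bsub>B\<^esub> c) y = ?act b (?act c y)"
      if "b \<in> carrier B" "c \<in> carrier B" "y \<in> carrier ?G" for b c y
      using that coset[of y] act by (auto simp: B.m_assoc)
    show "?act (b \<oplus>\<^bsub>B\<^esub> c) y = ?act b y \<oplus>\<^bsub>?G\<^esub> ?act c y"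
      if "b \<in> carrier B" "c \<in> carrier B" "y \<in> carrier ?G" for b c y
      using that coset[of y] act by (auto simp: Gadd B.l_distr)
    show "?act b (y \<oplus>\<^bsub>?G\<^esub> z) = ?act b y \<oplus>\<^bsub>?G\<^esub> ?act b z"
      if "b \<in> carrier B" "y \<in> carrier ?G" "z \<in> carrier ?G" for b y z
      using that coset[of y] coset[of z] act by (auto simp: Gadd B.r_distr)
    show "L +>\<^bsub>B\<^esub> g b \<in> carrier ?G" if "b \<in> carrier B" for b
      using that g by (simp add: carrier_Quot)
    show "L +>\<^bsub>B\<^esub> g (b \<oplus>\<^bsub>B\<^esub> c) = (L +>\<^bsub>B\<^esub> g b) \<oplus>\<^bsub>?G\<^esub> (L +>\<^bsub>B\<^esub> g c)"
      if "b \<in> carrier B" "c \<in> carrier B" for b c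
      using that g add by (simp add: Gadd eq)
  qed
  have "L +>\<^bsub>B\<^esub> g b = ?act b (L +>\<^bsub>B\<^esub> g \<one>\<^bsub>B\<^esub>)"
  proof (rule epi_linear[OF epi _ b])
    fix a b assume *: "a \<in> carrier A" "b \<in> carrier B"
    then have "\<phi> a \<in> carrier B" using epi by (auto simp: ring_epi_def ring_hom_def)
    then show "L +>\<^bsub>B\<^esub> g (\<phi> a \<otimes>\<^bsub>B\<^esub> b) = ?act (\<phi> a) (L +>\<^bsub>B\<^esub> g b)"
      using * g lin by (simp add: act eq)
  qed
  then show ?thesis using b g by (simp add: act eq)
qed

section \<open>Density modulo the radical\<close>

lemma (in ring) minus_minus_left:
  assumes "x \<in> carrier R" "y \<in> carrier R" "z \<in> carrier R"
  shows "(x \<ominus> y) \<ominus> (x \<ominus> z) = z \<ominus> y"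
proof -
  have "(x \<ominus> y) \<ominus> (x \<ominus> z) = \<ominus> x \<oplus> (x \<oplus> (z \<ominus> y))"
    using assms by (simp add: a_minus_def minus_add a_ac)
  then show ?thesis using assms by (simp add: r_neg1)
qed

lemma (in ring) add_minus_add:
  "x \<in> carrier R \<Longrightarrow> y \<in> carrier R \<Longrightarrow> z \<in> carrier R \<Longrightarrow> u \<in> carrier R \<Longrightarrow>
    (x \<oplus> y) \<ominus> (z \<oplus> u) = (x \<ominus> z) \<oplus> (y \<ominus> u)"
  by (simp add: a_minus_def minus_add a_ac)

lemma (in ring) r_distr_minus:
  "x \<in> carrier R \<Longrightarrow> y \<in> carrier R \<Longrightarrow> z \<in> carrier R \<Longrightarrow> x \<otimes> (y \<ominus> z) = x \<otimes> y \<ominus> x \<otimes> z"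
  by (simp add: a_minus_def r_distr r_minus)

lemma (in ring) l_distr_minus:
  "x \<in> carrier R \<Longrightarrow> y \<in> carrier R \<Longrightarrow> z \<in> carrier R \<Longrightarrow> (y \<ominus> z) \<otimes> x = y \<otimes> x \<ominus> z \<otimes> x"
  by (simp add: a_minus_def l_distr l_minus)

context ring_hom_ring
begin

lemma submod_sum:
  assumes "submod R S h V" "submod R S h W"
  shows "submod R S h {v \<oplus>\<^bsub>S\<^esub> w | v w. v \<in> V \<and> w \<in> W}" (is "submod R S h ?U")
proof (rule submodI_hom)
  note V = submodD[OF assms(1) S.ring_axioms] and W = submodD[OF assms(2) S.ring_axioms]
  show "?U \<subseteq> carrier S" using V(1) W(1) by auto
  have "\<zero>\<^bsub>S\<^esub> = \<zero>\<^bsub>S\<^esub> \<oplus>\<^bsub>S\<^esub> \<zero>\<^bsub>S\<^esub>" by simp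
  then show "\<zero>\<^bsub>S\<^esub> \<in> ?U" using V(2) W(2) by blast
  fix x y assume "x \<in> ?U" "y \<in> ?U"
  then obtain v w v' w' where *: "x = v \<oplus>\<^bsub>S\<^esub> w" "y = v' \<oplus>\<^bsub>S\<^esub> w'" "v \<in> V" "w \<in> W" "v' \<in> V" "w' \<in> W"
    by blast
  then have "x \<oplus>\<^bsub>S\<^esub> y = (v \<oplus>\<^bsub>S\<^esub> v') \<oplus>\<^bsub>S\<^esub> (w \<oplus>\<^bsub>S\<^esub> w')"
    using V(1) W(1) by (simp add: subset_iff S.a_ac)
  then show "x \<oplus>\<^bsub>S\<^esub> y \<in> ?U" using * V(3) W(3) by blast
next
  note V = submodD[OF assms(1) S.ring_axioms] and W = submodD[OF assms(2) S.ring_axioms]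
  fix a x assume a: "a \<in> carrier R" and "x \<in> ?U"
  then obtain v w where *: "x = v \<oplus>\<^bsub>S\<^esub> w" "v \<in> V" "w \<in> W" by blast
  then have "h a \<otimes>\<^bsub>S\<^esub> x = h a \<otimes>\<^bsub>S\<^esub> v \<oplus>\<^bsub>S\<^esub> h a \<otimes>\<^bsub>S\<^esub> w"
    using V(1) W(1) a by (simp add: subset_iff S.r_distr)
  then show "h a \<otimes>\<^bsub>S\<^esub> x \<in> ?U" using * a V(6) W(6) by blast
qed (auto simp: R.ring_axioms S.ring_axioms homh)

lemma submod_cyclic:
  assumes "lideal R L" "m \<in> carrier S"
  shows "submod R S h {h l \<otimes>\<^bsub>S\<^esub> m | l. l \<in> L}" (is "submod R S h ?U")
proof (rule submodI_hom)
  note D = R.lidealD[OF assms(1)]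
  show "?U \<subseteq> carrier S" using D(1) assms(2) by auto
  have "\<zero>\<^bsub>S\<^esub> = h \<zero> \<otimes>\<^bsub>S\<^esub> m" using assms(2) by simp
  then show "\<zero>\<^bsub>S\<^esub> \<in> ?U" using D(2) by blast
  fix x y assume "x \<in> ?U" "y \<in> ?U"
  then obtain k l where *: "x = h k \<otimes>\<^bsub>S\<^esub> m" "y = h l \<otimes>\<^bsub>S\<^esub> m" "k \<in> L" "l \<in> L"
    by blast
  then have "x \<oplus>\<^bsub>S\<^esub> y = h (k \<oplus> l) \<otimes>\<^bsub>S\<^esub> m"
    using D(1) assms(2) by (simp add: subset_iff S.l_distr)
  then show "x \<oplus>\<^bsub>S\<^esub> y \<in> ?U" using * D(3) by blast
next
  note D = R.lidealD[OF assms(1)]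
  fix a x assume a: "a \<in> carrier R" and "x \<in> ?U"
  then obtain l where *: "x = h l \<otimes>\<^bsub>S\<^esub> m" "l \<in> L" by blast
  then have "h a \<otimes>\<^bsub>S\<^esub> x = h (a \<otimes> l) \<otimes>\<^bsub>S\<^esub> m"
    using D(1) a assms(2) by (simp add: subset_iff S.m_assoc)
  then show "h a \<otimes>\<^bsub>S\<^esub> x \<in> ?U" using * a D(6) by blast
qed (auto simp: R.ring_axioms S.ring_axioms homh)

text \<open>An extension to \<open>S\<close> of the complement argument in the semisimple ring \<open>R / J\<close>: a maximal \<open>W\<close>
  meeting \<open>N\<close> only in \<open>Q\<close> is a complement of \<open>N\<close> modulo \<open>Q\<close>.\<close>

lemma submod_complement:
  assumes sl: "semilocal R" and Q: "ideal Q S" and JQ: "h ` jacobson_rad R \<subseteq> Q"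
    and N: "submod R S h N" "Q \<subseteq> N"
  obtains W where "submod R S h W" "Q \<subseteq> W" "W \<inter> N \<subseteq> Q"
    "\<And>b. b \<in> carrier S \<Longrightarrow> \<exists>w\<in>W. \<exists>n\<in>N. b = w \<oplus>\<^bsub>S\<^esub> n"
proof -
  interpret Q: ideal Q S by fact
  define Ws where "Ws = {W. submod R S h W \<and> Q \<subseteq> W \<and> W \<inter> N \<subseteq> Q}"
  have Qs: "submod R S h Q"
    by (simp add: submod_def Q.is_additive_subgroup Q.I_l_closed)
  have "\<exists>M\<in>Ws. \<forall>M'\<in>Ws. M \<subseteq> M' \<longrightarrow> M' = M"
  proof (rule Zorn_nonempty_family)
    have "Q \<in> Ws" using Qs by (simp add: Ws_def)
    then show "Ws \<noteq> {}" by blast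
    fix Us assume Us: "Us \<noteq> {}" "Us \<subseteq> Ws" and ch: "\<And>U V. U \<in> Us \<Longrightarrow> V \<in> Us \<Longrightarrow> U \<subseteq> V \<or> V \<subseteq> U"
    have "submod R S h (\<Union>Us)"
      by (rule submod_Union[OF S.ring_axioms Us(1) ch]) (use Us in \<open>auto simp: Ws_def\<close>)
    then show "\<Union>Us \<in> Ws" using Us unfolding Ws_def by blast
  qed
  then obtain W where W: "W \<in> Ws" and max: "\<And>W'. W' \<in> Ws \<Longrightarrow> W \<subseteq> W' \<Longrightarrow> W' = W" by blast
  have Wp: "submod R S h W" "Q \<subseteq> W" "W \<inter> N \<subseteq> Q" using W by (auto simp: Ws_def)
  note D = submodD[OF Wp(1) S.ring_axioms] and E = submodD[OF N(1) S.ring_axioms]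
  define U where "U = {w \<oplus>\<^bsub>S\<^esub> n | w n. w \<in> W \<and> n \<in> N}"
  have U: "submod R S h U" unfolding U_def by (rule submod_sum[OF Wp(1) N(1)])
  note F = submodD[OF U S.ring_axioms]
  have WU: "w \<in> U" if "w \<in> W" for w
  proof -
    have "w = w \<oplus>\<^bsub>S\<^esub> \<zero>\<^bsub>S\<^esub>" using D(1) that by auto
    then show ?thesis unfolding U_def using that E(2) by blast
  qed
  have NU: "n \<in> U" if "n \<in> N" for n
  proof -
    have "n = \<zero>\<^bsub>S\<^esub> \<oplus>\<^bsub>S\<^esub> n" using E(1) that by auto
    then show ?thesis unfolding U_def using that D(2) by blast
  qed
  have all: "m \<in> U" if m: "m \<in> carrier S" for m
  proof -
    \<comment> \<open>The multipliers taking \<open>m\<close> into \<open>W + N\<close> form a left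
      ideal containing the radical; let \<open>L'\<close> be its complement. If
      \<open>l m = n - w\<close> with \<open>l\<close> in \<open>L'\<close>, then \<open>l\<close>
      is in \<open>L \<inter> L'\<close>, so \<open>l m\<close> is in \<open>Q\<close>. Thus
      \<open>W + L' m\<close> still meets \<open>N\<close> inside \<open>Q\<close>, maximality puts
      \<open>L' m\<close> into \<open>W\<close>, and both \<open>L\<close> and \<open>L'\<close>
      multiply \<open>m\<close> into \<open>W + N\<close>.\<close>
    define L where "L = {a \<in> carrier R. h a \<otimes>\<^bsub>S\<^esub> m \<in> U}"
    have L: "lideal R L"
    proof (rule R.lidealI)
      show "\<zero> \<in> L" using F(2) m by (simp add: L_def)
      show "x \<oplus> y \<in> L" if "x \<in> L" "y \<in> L" for x y
        using that F(3) m by (simp add: L_def S.l_distr)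
      show "r \<otimes> x \<in> L" if "r \<in> carrier R" "x \<in> L" for r x
        using that F(6) m by (simp add: L_def S.m_assoc)
    qed (simp add: L_def)
    have "jacobson_rad R \<subseteq> L"
    proof
      fix x assume x: "x \<in> jacobson_rad R"
      then have "x \<in> carrier R" by (simp add: jacobson_rad_def)
      moreover have "h x \<otimes>\<^bsub>S\<^esub> m \<in> Q" using x JQ m by (intro Q.I_r_closed) auto
      ultimately show "x \<in> L" using Wp(2) WU by (auto simp: L_def)
    qed
    then obtain L' where L': "lideal R L'" "L \<inter> L' = jacobson_rad R"
      "\<And>x. x \<in> carrier R \<Longrightarrow> \<exists>y\<in>L. \<exists>z\<in>L'. x = y \<oplus> z"
      using R.semilocal_complement[OF sl L] by metis
    define V where "V = {h l \<otimes>\<^bsub>S\<^esub> m | l. l \<in> L'}"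
    define W' where "W' = {w \<oplus>\<^bsub>S\<^esub> v | w v. w \<in> W \<and> v \<in> V}"
    have V: "submod R S h V" unfolding V_def by (rule submod_cyclic[OF L'(1) m])
    note G = submodD[OF V S.ring_axioms]
    have "submod R S h W'" unfolding W'_def by (rule submod_sum[OF Wp(1) V])
    moreover have WW': "W \<subseteq> W'"
    proof
      fix w assume w: "w \<in> W"
      then have "w = w \<oplus>\<^bsub>S\<^esub> \<zero>\<^bsub>S\<^esub>" using D(1) by auto
      then show "w \<in> W'" unfolding W'_def using w G(2) by blast
    qed
    moreover have "W' \<inter> N \<subseteq> Q"
    proof
      fix n assume n: "n \<in> W' \<inter> N"
      then obtain w l where wl: "n = w \<oplus>\<^bsub>S\<^esub> h l \<otimes>\<^bsub>S\<^esub> m" "w \<in> W" "l \<in> L'"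
        unfolding W'_def V_def by blast
      have lc: "l \<in> carrier R" using wl R.lidealD(1)[OF L'(1)] by auto
      have wc: "w \<in> carrier S" using wl D(1) by auto
      have "n \<ominus>\<^bsub>S\<^esub> w \<in> U" using n wl WU NU F(5) by blast
      moreover have "n \<ominus>\<^bsub>S\<^esub> w = h l \<otimes>\<^bsub>S\<^esub> m"
        using wl lc wc m by (simp add: S.add_minus_cancel)
      ultimately have "l \<in> L" using lc by (simp add: L_def)
      then have "h l \<in> Q" using wl L'(2) JQ by blast
      then have lm: "h l \<otimes>\<^bsub>S\<^esub> m \<in> Q" using m by (simp add: Q.I_r_closed)
      then have "n \<in> W" using wl Wp(2) D(3) by blast
      then show "n \<in> Q" using n Wp(3) by blast
    qed
    ultimately have "W' = W" using max Wp(2) by (auto simp: Ws_def)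
    have "L' \<subseteq> L"
    proof
      fix l assume l: "l \<in> L'"
      then have lc: "l \<in> carrier R" using R.lidealD(1)[OF L'(1)] by auto
      have "h l \<otimes>\<^bsub>S\<^esub> m = \<zero>\<^bsub>S\<^esub> \<oplus>\<^bsub>S\<^esub> h l \<otimes>\<^bsub>S\<^esub> m" using lc m by simp
      moreover have "h l \<otimes>\<^bsub>S\<^esub> m \<in> V" using l by (auto simp: V_def)
      ultimately have "h l \<otimes>\<^bsub>S\<^esub> m \<in> W'" unfolding W'_def using D(2) by blast
      then show "l \<in> L" using lc WU \<open>W' = W\<close> by (simp add: L_def)
    qed
    then have "\<one> \<in> L"
      using L'(3)[OF R.one_closed] R.lidealD(3)[OF L] by (metis subsetD)
    then show ?thesis using m by (simp add: L_def)
  qed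
  show ?thesis
  proof (rule that[OF Wp])
    fix b assume "b \<in> carrier S"
    then have "b \<in> U" by (rule all)
    then show "\<exists>w\<in>W. \<exists>n\<in>N. b = w \<oplus>\<^bsub>S\<^esub> n" unfolding U_def by blast
  qed
qed

end

lemma epi_dense_modulo_ideal:
  assumes epi: "ring_epi A B \<phi>" and sl: "semilocal A" and Q: "ideal Q B"
    and JQ: "\<phi> ` jacobson_rad A \<subseteq> Q" and b: "b \<in> carrier B"
  shows "\<exists>a\<in>carrier A. b \<ominus>\<^bsub>B\<^esub> \<phi> a \<in> Q"
proof -
  interpret h: ring_hom_ring A B \<phi>
    using epi by (simp add: ring_epi_def ring_hom_ringI2)
  interpret Q: ideal Q B by fact
  define N where "N = {b \<in> carrier B. \<exists>a\<in>carrier A. b \<ominus>\<^bsub>B\<^esub> \<phi> a \<in> Q}"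
  have N: "submod A B \<phi> N"
  proof (rule submodI_hom)
    show "\<zero>\<^bsub>B\<^esub> \<in> N" unfolding N_def by (auto intro!: bexI[of _ "\<zero>\<^bsub>A\<^esub>"] simp: a_minus_def)
    fix x y assume "x \<in> N" "y \<in> N"
    then obtain a c where "x \<in> carrier B" "y \<in> carrier B" "a \<in> carrier A" "c \<in> carrier A"
      "x \<ominus>\<^bsub>B\<^esub> \<phi> a \<in> Q" "y \<ominus>\<^bsub>B\<^esub> \<phi> c \<in> Q" by (auto simp: N_def)
    then show "x \<oplus>\<^bsub>B\<^esub> y \<in> N"
      unfolding N_def by (auto intro!: bexI[of _ "a \<oplus>\<^bsub>A\<^esub> c"] simp: h.S.add_minus_add)
  next
    fix a x assume a: "a \<in> carrier A" and "x \<in> N"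
    then obtain c where "x \<in> carrier B" "c \<in> carrier A" "x \<ominus>\<^bsub>B\<^esub> \<phi> c \<in> Q" by (auto simp: N_def)
    then show "\<phi> a \<otimes>\<^bsub>B\<^esub> x \<in> N"
      unfolding N_def using a Q.I_l_closed[of "x \<ominus>\<^bsub>B\<^esub> \<phi> c" "\<phi> a"]
      by (auto intro!: bexI[of _ "a \<otimes>\<^bsub>A\<^esub> c"] simp: h.S.r_distr_minus)
  qed (use epi in \<open>auto simp: ring_epi_def N_def\<close>)
  have QN: "Q \<subseteq> N"
    unfolding N_def by (auto intro!: bexI[of _ "\<zero>\<^bsub>A\<^esub>"] simp: a_minus_def Q.Icarr)
  have oneN: "\<one>\<^bsub>B\<^esub> \<in> N"
    unfolding N_def by (auto intro!: bexI[of _ "\<one>\<^bsub>A\<^esub>"] simp: a_minus_def h.S.r_neg)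
  note E = submodD[OF N h.S.ring_axioms]
  obtain W where W: "submod A B \<phi> W" "Q \<subseteq> W" "W \<inter> N \<subseteq> Q"
    "\<And>b. b \<in> carrier B \<Longrightarrow> \<exists>w\<in>W. \<exists>n\<in>N. b = w \<oplus>\<^bsub>B\<^esub> n"
    using h.submod_complement[OF sl Q JQ N QN] by metis
  note D = submodD[OF W(1) h.S.ring_axioms]
  \<comment> \<open>A chosen component of \<open>b\<close> in \<open>W\<close> along
    \<open>N\<close>. Two choices differ by an element of \<open>W \<inter> N \<subseteq> Q\<close>,
    which makes \<open>g\<close> additive and \<open>A\<close>-linear modulo
    \<open>Q\<close>.\<close>
  define g where "g b = (SOME w. w \<in> W \<and> b \<ominus>\<^bsub>B\<^esub> w \<in> N)" for b
  have g: "g b \<in> W \<and> b \<ominus>\<^bsub>B\<^esub> g b \<in> N" if b: "b \<in> carrier B" for b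
    unfolding g_def
  proof (rule someI_ex)
    obtain w n where "w \<in> W" "n \<in> N" "b = w \<oplus>\<^bsub>B\<^esub> n" using W(4)[OF b] by blast
    moreover from this have "w \<in> carrier B" "n \<in> carrier B" using D(1) E(1) by auto
    ultimately show "\<exists>w. w \<in> W \<and> b \<ominus>\<^bsub>B\<^esub> w \<in> N" by (auto simp: h.S.add_minus_cancel)
  qed
  have uniq: "w \<ominus>\<^bsub>B\<^esub> w' \<in> Q"
    if "b \<in> carrier B" "w \<in> W" "w' \<in> W" "b \<ominus>\<^bsub>B\<^esub> w \<in> N" "b \<ominus>\<^bsub>B\<^esub> w' \<in> N" for b w w'
  proof -
    have "(b \<ominus>\<^bsub>B\<^esub> w') \<ominus>\<^bsub>B\<^esub> (b \<ominus>\<^bsub>B\<^esub> w) \<in> N" using that E(5) by blast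
    then have "w \<ominus>\<^bsub>B\<^esub> w' \<in> N" using that D(1) by (simp add: h.S.minus_minus_left subset_iff)
    moreover have "w \<ominus>\<^bsub>B\<^esub> w' \<in> W" using that D(5) by blast
    ultimately show ?thesis using W(3) by blast
  qed
  have gc: "g b \<in> carrier B" if "b \<in> carrier B" for b using g[OF that] D(1) by blast
  have lQ: "lideal B Q" by (simp add: lideal_def Q.is_additive_subgroup Q.I_l_closed)
  have lin: "g b \<ominus>\<^bsub>B\<^esub> b \<otimes>\<^bsub>B\<^esub> g \<one>\<^bsub>B\<^esub> \<in> Q" if b: "b \<in> carrier B" for b
  proof (rule epi_almost_linear[OF epi lQ gc _ _ b])
    fix b c assume bc: "b \<in> carrier B" "c \<in> carrier B"
    have "(b \<ominus>\<^bsub>B\<^esub> g b) \<oplus>\<^bsub>B\<^esub> (c \<ominus>\<^bsub>B\<^esub> g c) \<in> N" using g bc E(3) by blast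
    then have "(b \<oplus>\<^bsub>B\<^esub> c) \<ominus>\<^bsub>B\<^esub> (g b \<oplus>\<^bsub>B\<^esub> g c) \<in> N" using bc gc by (simp add: h.S.add_minus_add)
    then show "g (b \<oplus>\<^bsub>B\<^esub> c) \<ominus>\<^bsub>B\<^esub> (g b \<oplus>\<^bsub>B\<^esub> g c) \<in> Q"
      using bc g D(3) by (intro uniq[of "b \<oplus>\<^bsub>B\<^esub> c"]) auto
  next
    fix a b assume ab: "a \<in> carrier A" "b \<in> carrier B"
    have "\<phi> a \<otimes>\<^bsub>B\<^esub> (b \<ominus>\<^bsub>B\<^esub> g b) \<in> N" using g ab E(6) by blast
    then have "\<phi> a \<otimes>\<^bsub>B\<^esub> b \<ominus>\<^bsub>B\<^esub> \<phi> a \<otimes>\<^bsub>B\<^esub> g b \<in> N" using ab gc by (simp add: h.S.r_distr_minus)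
    then show "g (\<phi> a \<otimes>\<^bsub>B\<^esub> b) \<ominus>\<^bsub>B\<^esub> \<phi> a \<otimes>\<^bsub>B\<^esub> g b \<in> Q"
      using ab g D(6) by (intro uniq[of "\<phi> a \<otimes>\<^bsub>B\<^esub> b"]) auto
  qed
  have g1: "g \<one>\<^bsub>B\<^esub> \<in> Q"
  proof -
    have "\<one>\<^bsub>B\<^esub> \<ominus>\<^bsub>B\<^esub> (\<one>\<^bsub>B\<^esub> \<ominus>\<^bsub>B\<^esub> g \<one>\<^bsub>B\<^esub>) \<in> N" using g[OF h.S.one_closed] oneN E(5) by blast
    then have "g \<one>\<^bsub>B\<^esub> \<in> N" using gc by (simp add: h.S.minus_minus_cancel)
    then show ?thesis using g W(3) by blast
  qed
  \<comment> \<open>Modulo \<open>Q\<close>, the component \<open>g w\<close> is \<open>w\<close>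
    itself, whereas linearity makes it \<open>w g(1)\<close>, which is zero. So the complement is
    trivial and \<open>N\<close> is all of \<open>B\<close>.\<close>
  have WQ: "w \<in> Q" if w: "w \<in> W" for w
  proof -
    have wc: "w \<in> carrier B" using w D(1) by blast
    have "w \<ominus>\<^bsub>B\<^esub> g w \<in> W \<inter> N" using w g[OF wc] D(5) by blast
    then have 1: "w \<ominus>\<^bsub>B\<^esub> g w \<in> Q" using W(3) by blast
    have "w \<otimes>\<^bsub>B\<^esub> g \<one>\<^bsub>B\<^esub> \<in> Q" using g1 wc by (simp add: Q.I_l_closed)
    with lin[OF wc] have "(g w \<ominus>\<^bsub>B\<^esub> w \<otimes>\<^bsub>B\<^esub> g \<one>\<^bsub>B\<^esub>) \<oplus>\<^bsub>B\<^esub> w \<otimes>\<^bsub>B\<^esub> g \<one>\<^bsub>B\<^esub> \<in> Q" by simp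
    then have "g w \<in> Q" using wc gc by (simp add: h.S.minus_add_cancel)
    with 1 have "(w \<ominus>\<^bsub>B\<^esub> g w) \<oplus>\<^bsub>B\<^esub> g w \<in> Q" by simp
    then show ?thesis using wc gc by (simp add: h.S.minus_add_cancel)
  qed
  obtain w n where "w \<in> W" "n \<in> N" "b = w \<oplus>\<^bsub>B\<^esub> n" using W(4)[OF b] by blast
  then have "b \<in> N" using WQ QN E(3) by blast
  then show ?thesis by (simp add: N_def)
qed

lemma epi_ideal_eq:
  assumes epi: "ring_epi A B \<phi>" and Q: "ideal Q B"
    and dense: "\<And>b. b \<in> carrier B \<Longrightarrow> \<exists>a\<in>carrier A. b \<ominus>\<^bsub>B\<^esub> \<phi> a \<in> Q" and q: "q \<in> Q"
  shows "q \<in> ideal_prod B (carrier B) (\<phi> ` {a \<in> carrier A. \<phi> a \<in> Q})"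
proof -
  interpret h: ring_hom_ring A B \<phi>
    using epi by (simp add: ring_epi_def ring_hom_ringI2)
  interpret Q: ideal Q B by fact
  define L where "L = ideal_prod B (carrier B) (\<phi> ` {a \<in> carrier A. \<phi> a \<in> Q})"
  have inL: "\<phi> a \<in> L" if "a \<in> carrier A" "\<phi> a \<in> Q" for a
    using ideal_prod.prod[of "\<one>\<^bsub>B\<^esub>" "carrier B" "\<phi> a" "\<phi> ` {a \<in> carrier A. \<phi> a \<in> Q}" B] that
    by (simp add: L_def)
  have Lc: "x \<in> carrier B" if "x \<in> L" for x
    using that unfolding L_def by induction auto
  have L: "lideal B L"
  proof (rule h.S.lidealI)
    show "L \<subseteq> carrier B" using Lc by blast
    show "\<zero>\<^bsub>B\<^esub> \<in> L" using inL[of "\<zero>\<^bsub>A\<^esub>"] by simp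
    show "x \<oplus>\<^bsub>B\<^esub> y \<in> L" if "x \<in> L" "y \<in> L" for x y
      using that unfolding L_def by (rule ideal_prod.sum)
    fix r x assume r: "r \<in> carrier B" and "x \<in> L"
    from this(2) have "x \<in> carrier B \<and> r \<otimes>\<^bsub>B\<^esub> x \<in> L"
      unfolding L_def
    proof induction
      case (prod i j)
      then obtain a where "j = \<phi> a" "a \<in> carrier A" by blast
      then show ?case
        using prod r ideal_prod.prod[OF _ prod(2), of "r \<otimes>\<^bsub>B\<^esub> i" "carrier B" B]
        by (auto simp: h.S.m_assoc)
    qed (use r in \<open>auto simp: h.S.r_distr intro: ideal_prod.sum\<close>)
    then show "r \<otimes>\<^bsub>B\<^esub> x \<in> L" by simp
  qed
  note D = h.S.lidealD[OF L]
  \<comment> \<open>A representative of \<open>b\<close> modulo \<open>Q\<close> in the image of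
    \<open>\<phi>\<close>. Two such representatives differ by some \<open>\<phi> a\<close> in
    \<open>Q\<close>, hence by an element of \<open>L\<close>.\<close>
  define g where "g b = \<phi> (SOME a. a \<in> carrier A \<and> b \<ominus>\<^bsub>B\<^esub> \<phi> a \<in> Q)" for b
  have g: "\<exists>a\<in>carrier A. g b = \<phi> a \<and> b \<ominus>\<^bsub>B\<^esub> g b \<in> Q" if "b \<in> carrier B" for b
  proof -
    have "(SOME a. a \<in> carrier A \<and> b \<ominus>\<^bsub>B\<^esub> \<phi> a \<in> Q) \<in> carrier A \<and>
      b \<ominus>\<^bsub>B\<^esub> \<phi> (SOME a. a \<in> carrier A \<and> b \<ominus>\<^bsub>B\<^esub> \<phi> a \<in> Q) \<in> Q"
      by (rule someI_ex) (use dense[OF that] in blast)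
    then show ?thesis unfolding g_def by blast
  qed
  have gc: "g b \<in> carrier B" if "b \<in> carrier B" for b using g[OF that] by auto
  have uniq: "\<phi> a \<ominus>\<^bsub>B\<^esub> \<phi> c \<in> L"
    if "b \<in> carrier B" "a \<in> carrier A" "c \<in> carrier A" "b \<ominus>\<^bsub>B\<^esub> \<phi> a \<in> Q" "b \<ominus>\<^bsub>B\<^esub> \<phi> c \<in> Q" for a b c
  proof -
    have "(b \<ominus>\<^bsub>B\<^esub> \<phi> c) \<ominus>\<^bsub>B\<^esub> (b \<ominus>\<^bsub>B\<^esub> \<phi> a) \<in> Q" using that by (simp add: a_minus_def)
    then have "\<phi> a \<ominus>\<^bsub>B\<^esub> \<phi> c \<in> Q" using that by (simp add: h.S.minus_minus_left)
    then show ?thesis using inL[of "a \<ominus>\<^bsub>A\<^esub> c"] that by (simp add: a_minus_def)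
  qed
  have lin: "g b \<ominus>\<^bsub>B\<^esub> b \<otimes>\<^bsub>B\<^esub> g \<one>\<^bsub>B\<^esub> \<in> L" if b: "b \<in> carrier B" for b
  proof (rule epi_almost_linear[OF epi L gc _ _ b])
    fix b c assume bc: "b \<in> carrier B" "c \<in> carrier B"
    obtain x y z where *: "x \<in> carrier A" "g b = \<phi> x" "b \<ominus>\<^bsub>B\<^esub> \<phi> x \<in> Q" "y \<in> carrier A" "g c = \<phi> y"
      "c \<ominus>\<^bsub>B\<^esub> \<phi> y \<in> Q" "z \<in> carrier A" "g (b \<oplus>\<^bsub>B\<^esub> c) = \<phi> z" "b \<oplus>\<^bsub>B\<^esub> c \<ominus>\<^bsub>B\<^esub> \<phi> z \<in> Q"
      using g[OF bc(1)] g[OF bc(2)] g[OF h.S.a_closed[OF bc]] by auto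
    have "(b \<ominus>\<^bsub>B\<^esub> \<phi> x) \<oplus>\<^bsub>B\<^esub> (c \<ominus>\<^bsub>B\<^esub> \<phi> y) \<in> Q" using * by simp
    then have "(b \<oplus>\<^bsub>B\<^esub> c) \<ominus>\<^bsub>B\<^esub> \<phi> (x \<oplus>\<^bsub>A\<^esub> y) \<in> Q" using bc * by (simp add: h.S.add_minus_add)
    then show "g (b \<oplus>\<^bsub>B\<^esub> c) \<ominus>\<^bsub>B\<^esub> (g b \<oplus>\<^bsub>B\<^esub> g c) \<in> L"
      using uniq[of "b \<oplus>\<^bsub>B\<^esub> c" z "x \<oplus>\<^bsub>A\<^esub> y"] bc * by simp
  next
    fix a b assume ab: "a \<in> carrier A" "b \<in> carrier B"
    have abc: "\<phi> a \<otimes>\<^bsub>B\<^esub> b \<in> carrier B" using ab by simp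
    obtain x z where *: "x \<in> carrier A" "g b = \<phi> x" "b \<ominus>\<^bsub>B\<^esub> \<phi> x \<in> Q"
      "z \<in> carrier A" "g (\<phi> a \<otimes>\<^bsub>B\<^esub> b) = \<phi> z" "\<phi> a \<otimes>\<^bsub>B\<^esub> b \<ominus>\<^bsub>B\<^esub> \<phi> z \<in> Q"
      using g[OF ab(2)] g[OF abc] by auto
    have "\<phi> a \<otimes>\<^bsub>B\<^esub> (b \<ominus>\<^bsub>B\<^esub> \<phi> x) \<in> Q" using * ab by (simp add: Q.I_l_closed)
    then have "\<phi> a \<otimes>\<^bsub>B\<^esub> b \<ominus>\<^bsub>B\<^esub> \<phi> (a \<otimes>\<^bsub>A\<^esub> x) \<in> Q" using ab * by (simp add: h.S.r_distr_minus)
    then show "g (\<phi> a \<otimes>\<^bsub>B\<^esub> b) \<ominus>\<^bsub>B\<^esub> \<phi> a \<otimes>\<^bsub>B\<^esub> g b \<in> L"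
      using uniq[of "\<phi> a \<otimes>\<^bsub>B\<^esub> b" z "a \<otimes>\<^bsub>A\<^esub> x"] ab * by simp
  qed
  \<comment> \<open>Decompose \<open>q = q (1 - g 1) + q g(1)\<close>. The first term is in
    \<open>L\<close> because \<open>1 - g 1\<close> is a value of \<open>\<phi>\<close> in
    \<open>Q\<close>; the second is congruent to \<open>g q\<close>, which is also a value of
    \<open>\<phi>\<close> in \<open>Q\<close>.\<close>
  have qc: "q \<in> carrier B" using q by (rule Q.Icarr)
  obtain x where x: "x \<in> carrier A" "g q = \<phi> x" "q \<ominus>\<^bsub>B\<^esub> \<phi> x \<in> Q" using g[OF qc] by auto
  obtain y where y: "y \<in> carrier A" "g \<one>\<^bsub>B\<^esub> = \<phi> y" "\<one>\<^bsub>B\<^esub> \<ominus>\<^bsub>B\<^esub> \<phi> y \<in> Q"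
    using g[OF h.S.one_closed] by auto
  have "q \<ominus>\<^bsub>B\<^esub> (q \<ominus>\<^bsub>B\<^esub> \<phi> x) \<in> Q" using q x by (simp add: a_minus_def)
  then have gq: "g q \<in> L" using x qc inL by (simp add: h.S.minus_minus_cancel)
  have "\<phi> (\<one>\<^bsub>A\<^esub> \<ominus>\<^bsub>A\<^esub> y) \<in> L" using y inL[of "\<one>\<^bsub>A\<^esub> \<ominus>\<^bsub>A\<^esub> y"] by (simp add: a_minus_def)
  then have "q \<otimes>\<^bsub>B\<^esub> (\<one>\<^bsub>B\<^esub> \<ominus>\<^bsub>B\<^esub> \<phi> y) \<in> L" using qc y D(6) by (simp add: a_minus_def)
  then have 1: "q \<ominus>\<^bsub>B\<^esub> q \<otimes>\<^bsub>B\<^esub> \<phi> y \<in> L" using qc y by (simp add: h.S.r_distr_minus)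
  have "g q \<ominus>\<^bsub>B\<^esub> (g q \<ominus>\<^bsub>B\<^esub> q \<otimes>\<^bsub>B\<^esub> \<phi> y) \<in> L" using D(5)[OF gq lin[OF qc]] y by simp
  then have "q \<otimes>\<^bsub>B\<^esub> \<phi> y \<in> L" using qc x y by (simp add: h.S.minus_minus_cancel)
  from D(3)[OF 1 this] have "q \<in> L" using qc y by (simp add: h.S.minus_add_cancel)
  then show ?thesis by (simp add: L_def)
qed

section \<open>Surjectivity and idempotent ideals\<close>

lemma ideal_op:
  assumes "ideal I R"
  shows "ideal I (op_ring R)"
proof -
  interpret ideal I R by fact
  have o: "ring (op_ring R)" by (rule ring_op_ring) (rule ring_axioms)
  show ?thesis
  proof (rule idealI[OF o])
    show "subgroup I (add_monoid (op_ring R))"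
      by (rule additive_subgroup.a_subgroup[OF ring.additive_subgroupI'[OF o]]) auto
  qed (auto simp: I_l_closed I_r_closed)
qed

text \<open>\<open>ideal_prod\<close> forms nonempty sums of products from two arbitrary sets; zero
  is obtained as \<open>0 t\<close> with some \<open>t\<close> in \<open>T\<close>.\<close>

lemma (in ring) ideal_prod_carrier_lideal:
  assumes "T \<subseteq> carrier R" "T \<noteq> {}"
  shows "lideal R (ideal_prod R (carrier R) T)"
proof (rule lidealI)
  let ?P = "ideal_prod R (carrier R) T"
  have c: "x \<in> carrier R" if "x \<in> ?P" for x
    using that by induction (use assms in auto)
  then show "?P \<subseteq> carrier R" by blast
  obtain t where "t \<in> T" using assms by blast
  then show "\<zero> \<in> ?P" using ideal_prod.prod[of \<zero> "carrier R" t T R] assms by auto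
  show "x \<oplus> y \<in> ?P" if "x \<in> ?P" "y \<in> ?P" for x y
    using that by (rule ideal_prod.sum)
  fix r x assume r: "r \<in> carrier R" and "x \<in> ?P"
  from this(2) show "r \<otimes> x \<in> ?P"
  proof induction
    case (prod i j)
    then show ?case
      using r assms ideal_prod.prod[OF _ prod(2), of "r \<otimes> i" "carrier R" R] by (auto simp: m_assoc)
  next
    case (sum s t)
    then show ?case using r c by (auto simp: r_distr intro: ideal_prod.sum)
  qed
qed

lemma (in ring) ideal_prod_carrier_incl:
  "T \<subseteq> carrier R \<Longrightarrow> t \<in> T \<Longrightarrow> t \<in> ideal_prod R (carrier R) T"
  using ideal_prod.prod[of \<one> "carrier R" t T R] by auto

text \<open>Nakayama's lemma with \<open>M = B\<close> and \<open>N = \<phi>(A)\<close>, once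
  \<open>Q\<close> is placed inside \<open>B \<phi>(I)\<close>. \<open>I\<close> and
  \<open>Q\<close> stand for the two radicals; keeping them abstract and asking for a right identity
  \<open>f\<close> and a left inverse \<open>u\<close> makes the statement applicable to opposite
  rings.\<close>

lemma epi_surjective_left_T_nilpotent:
  assumes epi: "ring_epi A B \<phi>" and Q: "ideal Q B" and I: "I \<subseteq> carrier A" "I \<noteq> {}"
    and dense: "\<And>b. b \<in> carrier B \<Longrightarrow> \<exists>a\<in>carrier A. b \<ominus>\<^bsub>B\<^esub> \<phi> a \<in> Q"
    and f: "f \<in> carrier A" "\<phi> f \<in> Q"
    and kf: "\<And>k. k \<in> carrier A \<Longrightarrow> \<phi> k \<in> Q \<Longrightarrow> k \<ominus>\<^bsub>A\<^esub> k \<otimes>\<^bsub>A\<^esub> f \<in> I"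
    and u: "u \<in> carrier B" "u \<otimes>\<^bsub>B\<^esub> (\<one>\<^bsub>B\<^esub> \<ominus>\<^bsub>B\<^esub> \<phi> f) = \<one>\<^bsub>B\<^esub>"
    and nil: "left_T_nilpotent A I"
  shows "\<phi> ` carrier A = carrier B"
proof -
  interpret h: ring_hom_ring A B \<phi>
    using epi by (simp add: ring_epi_def ring_hom_ringI2)
  interpret Q: ideal Q B by fact
  define P where "P = ideal_prod B (carrier B) (\<phi> ` I)"
  have phiI: "\<phi> ` I \<subseteq> carrier B" "\<phi> ` I \<noteq> {}" using I by auto
  have P: "lideal B P" unfolding P_def by (rule h.S.ideal_prod_carrier_lideal[OF phiI])
  note D = h.S.lidealD[OF P]
  have inP: "\<phi> x \<in> P" if "x \<in> I" for x
    unfolding P_def by (rule h.S.ideal_prod_carrier_incl[OF phiI(1)]) (use that in blast)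
  \<comment> \<open>Cancelling the left invertible factor \<open>1 - \<phi>(f)\<close> turns
    \<open>f - f f\<close> in \<open>I\<close> into \<open>\<phi>(f)\<close> in
    \<open>B \<phi>(I)\<close>.\<close>
  have "\<phi> f = (u \<otimes>\<^bsub>B\<^esub> (\<one>\<^bsub>B\<^esub> \<ominus>\<^bsub>B\<^esub> \<phi> f)) \<otimes>\<^bsub>B\<^esub> \<phi> f" using u f by simp
  also have "\<dots> = u \<otimes>\<^bsub>B\<^esub> \<phi> (f \<ominus>\<^bsub>A\<^esub> f \<otimes>\<^bsub>A\<^esub> f)"
    using u(1) f by (simp add: h.S.m_assoc h.S.l_distr_minus) (simp add: a_minus_def)
  finally have fP: "\<phi> f \<in> P" using D(6)[OF u(1) inP[OF kf[OF f]]] by simp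
  have kP: "\<phi> k \<in> P" if k: "k \<in> carrier A" "\<phi> k \<in> Q" for k
  proof -
    have "(k \<ominus>\<^bsub>A\<^esub> k \<otimes>\<^bsub>A\<^esub> f) \<oplus>\<^bsub>A\<^esub> k \<otimes>\<^bsub>A\<^esub> f = k" using k f by (simp add: h.R.minus_add_cancel)
    then have "\<phi> k = \<phi> (k \<ominus>\<^bsub>A\<^esub> k \<otimes>\<^bsub>A\<^esub> f) \<oplus>\<^bsub>B\<^esub> \<phi> k \<otimes>\<^bsub>B\<^esub> \<phi> f"
      using k f by (metis h.R.m_closed h.R.minus_closed h.hom_add h.hom_mult)
    moreover have "\<dots> \<in> P" using D(3)[OF inP[OF kf[OF k]] D(6)[OF _ fP]] k by simp
    ultimately show ?thesis by (rule ssubst)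
  qed
  have QP: "q \<in> P" if q: "q \<in> Q" for q
  proof -
    have "q \<in> ideal_prod B (carrier B) (\<phi> ` {a \<in> carrier A. \<phi> a \<in> Q})"
      by (rule epi_ideal_eq[OF epi Q dense q])
    then show ?thesis
    proof induction
      case (prod i j)
      then show ?case using D(6) kP by blast
    next
      case (sum s t)
      then show ?case using D(3) by blast
    qed
  qed
  have "carrier B \<subseteq> \<phi> ` carrier A"
  proof (rule left_T_nilpotent_Nakayama[OF h.R.ring_axioms h.S.ring_axioms h.homh I(1) nil])
    show "additive_subgroup (\<phi> ` carrier A) B"
      by (rule h.S.additive_subgroupI')
        (use h.hom_zero in \<open>force simp flip: h.hom_add h.hom_a_inv\<close>)+
    show "n \<otimes>\<^bsub>B\<^esub> \<phi> a \<in> \<phi> ` carrier A" if "n \<in> \<phi> ` carrier A" "a \<in> carrier A" for n a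
      using that by (auto simp flip: h.hom_mult)
    fix m assume m: "m \<in> carrier B"
    then obtain a where a: "a \<in> carrier A" "m \<ominus>\<^bsub>B\<^esub> \<phi> a \<in> Q" using dense by blast
    then have "m = \<phi> a \<oplus>\<^bsub>B\<^esub> (m \<ominus>\<^bsub>B\<^esub> \<phi> a)"
      using m by (metis h.S.a_comm h.S.minus_closed h.S.minus_add_cancel h.hom_closed)
    then show "\<exists>n\<in>\<phi> ` carrier A. \<exists>t\<in>ideal_prod B (carrier B) (\<phi> ` I). m = n \<oplus>\<^bsub>B\<^esub> t"
      using QP[OF a(2)] a(1) unfolding P_def by blast
  qed simp
  then show ?thesis by auto
qed

section \<open>Nilpotent elements and surjectivity\<close>

lemma lprod_op: "lprod (op_ring R) a n = rprod R a n"
  by (induction n) simp_all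

lemma left_T_nilpotent_op: "left_T_nilpotent (op_ring R) S \<longleftrightarrow> right_T_nilpotent R S"
  by (simp add: left_T_nilpotent_def right_T_nilpotent_def lprod_op)

text \<open>T-nilpotency of the constant sequence. At index \<open>n\<close> both products have
  \<open>n + 1\<close> factors, hence \<open>Suc n\<close>.\<close>

lemma (in ring) T_nilpotent_imp_nilpotent:
  assumes "left_T_nilpotent R S \<or> right_T_nilpotent R S" "x \<in> S" "x \<in> carrier R"
  shows "\<exists>n. x [^] Suc n = \<zero>"
proof -
  have "lprod R (\<lambda>_. x) n = x [^] Suc n" for n
  proof (induction n)
    case (Suc n)
    then show ?case using assms(3) nat_pow_Suc2[of x "Suc n"] by simp
  qed (use assms(3) in simp)
  moreover have "rprod R (\<lambda>_. x) n = x [^] Suc n" for n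
    using assms(3) by (induction n) simp_all
  ultimately show ?thesis
    using assms(1,2) unfolding left_T_nilpotent_def right_T_nilpotent_def by metis
qed

lemma division_ring_nilpotent:
  assumes "division_ring D" "y \<in> carrier D" "y [^]\<^bsub>D\<^esub> (n::nat) = \<zero>\<^bsub>D\<^esub>"
  shows "y = \<zero>\<^bsub>D\<^esub>"
proof (rule ccontr)
  interpret ring D using assms by (simp add: division_ring_def)
  assume "y \<noteq> \<zero>\<^bsub>D\<^esub>"
  then have y: "y \<in> Units D" using assms by (simp add: division_ring_def)
  have "y [^]\<^bsub>D\<^esub> n \<in> Units D"
    using y by (induction n) auto
  then have "\<zero>\<^bsub>D\<^esub> \<in> Units D" using assms by simp
  then have "\<one>\<^bsub>D\<^esub> = \<zero>\<^bsub>D\<^esub>" using Units_l_inv_ex by force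
  then show False using assms by (simp add: division_ring_def)
qed

text \<open>A product of skew fields has no nonzero nilpotents. Each coordinate is viewed as a
  homomorphism from \<open>R\<close> to a skew field and the images of \<open>x\<close> and
  \<open>0\<close> are compared there, which avoids establishing ring axioms for
  \<open>prod_ring\<close>.\<close>

lemma (in ring) basic_ring_nilpotent:
  assumes "basic_ring R" "x \<in> carrier R" "x [^] (n::nat) = \<zero>"
  shows "x \<in> jacobson_rad R"
proof -
  interpret JI: ideal "jacobson_rad R" R by (rule jacobson_rad_ideal)
  let ?Q = "R Quot jacobson_rad R"
  interpret p: ring_hom_ring R ?Q "(+>) J" by (rule JI.rcos_ring_hom_ring)
  obtain I :: "nat set" and D :: "nat \<Rightarrow> 'a set ring" where
    D: "\<And>i. i \<in> I \<Longrightarrow> division_ring (D i)" and "?Q \<simeq> prod_ring I D"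
    using assms(1) unfolding basic_ring_def by blast
  then obtain f where "f \<in> ring_iso ?Q (prod_ring I D)"
    by (auto simp: is_ring_iso_def)
  then have f: "f \<in> ring_hom ?Q (prod_ring I D)" and inj: "inj_on f (carrier ?Q)"
    by (auto simp: ring_iso_def bij_betw_def)
  have ext: "f y \<in> (\<Pi>\<^sub>E i\<in>I. carrier (D i))" if "y \<in> carrier ?Q" for y
    using ring_hom_closed[OF f that] by (simp add: prod_ring_def)
  have comp: "(\<lambda>x. f (J +> x) i) \<in> ring_hom R (D i)" if i: "i \<in> I" for i
  proof (rule ring_hom_memI)
    show "f (J +> y) i \<in> carrier (D i)" if "y \<in> carrier R" for y
      using ext[of "J +> y"] that i by auto
    show "f (J +> \<one>) i = \<one>\<^bsub>D i\<^esub>"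
      using ring_hom_one[OF f] i by (simp add: prod_ring_def)
    fix y z assume yz: "y \<in> carrier R" "z \<in> carrier R"
    show "f (J +> (y \<otimes> z)) i = f (J +> y) i \<otimes>\<^bsub>D i\<^esub> f (J +> z) i"
      using yz i ring_hom_mult[OF f, of "J +> y" "J +> z"] by (simp add: prod_ring_def)
    show "f (J +> (y \<oplus> z)) i = f (J +> y) i \<oplus>\<^bsub>D i\<^esub> f (J +> z) i"
      using yz i ring_hom_add[OF f, of "J +> y" "J +> z"] by (simp add: prod_ring_def)
  qed
  have fx: "f (J +> x) i = f (J +> \<zero>) i" if i: "i \<in> I" for i
  proof -
    interpret c: ring_hom_ring R "D i" "\<lambda>x. f (J +> x) i"
      using comp[OF i] D[OF i] ring_axioms by (auto simp: division_ring_def intro: ring_hom_ringI2)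
    have "f (J +> x) i [^]\<^bsub>D i\<^esub> n = \<zero>\<^bsub>D i\<^esub>"
      by (metis c.hom_nat_pow c.hom_zero assms(2,3))
    then show ?thesis
      using division_ring_nilpotent[OF D[OF i]] c.hom_closed[OF assms(2)] c.hom_zero by metis
  qed
  have "f (J +> x) = f (J +> \<zero>)"
    using ext[of "J +> x"] ext[of "J +> \<zero>"] assms(2) fx by (intro PiE_ext) auto
  then have "J +> x = J +> \<zero>" using inj assms(2) by (auto dest: inj_onD)
  then show ?thesis using JI.coset_eq_iff_minus[of x \<zero>] assms(2) by (simp add: a_minus_def)
qed

theorem epi_surjective:
  assumes epi: "ring_epi A B \<phi>" and perfA: "right_perfect A \<or> left_perfect A"
    and basicB: "basic_ring B"
  shows "\<phi> ` carrier A = carrier B"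
proof -
  interpret h: ring_hom_ring A B \<phi>
    using epi by (simp add: ring_epi_def ring_hom_ringI2)
  let ?J = "jacobson_rad A" and ?Q = "jacobson_rad B"
  interpret J: ideal ?J A by (rule h.R.jacobson_rad_ideal)
  interpret Q: ideal ?Q B by (rule h.S.jacobson_rad_ideal)
  have sl: "semilocal A" using perfA by (auto simp: right_perfect_def left_perfect_def)
  have JQ: "\<phi> ` ?J \<subseteq> ?Q"
  proof
    fix y assume "y \<in> \<phi> ` ?J"
    then obtain x where x: "y = \<phi> x" "x \<in> ?J" by blast
    have xc: "x \<in> carrier A" using x J.Icarr by simp
    obtain n where "x [^]\<^bsub>A\<^esub> Suc n = \<zero>\<^bsub>A\<^esub>"
      using h.R.T_nilpotent_imp_nilpotent[of ?J x] perfA x xc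
      by (auto simp: right_perfect_def left_perfect_def)
    then have "\<phi> x [^]\<^bsub>B\<^esub> Suc n = \<zero>\<^bsub>B\<^esub>"
      using h.hom_nat_pow[OF xc, of "Suc n"] by simp
    then show "y \<in> ?Q"
      using h.S.basic_ring_nilpotent[OF basicB, of "\<phi> x" "Suc n"] x(1) xc h.hom_closed by blast
  qed
  note Qi = h.S.jacobson_rad_ideal
  have dense: "\<exists>a\<in>carrier A. b \<ominus>\<^bsub>B\<^esub> \<phi> a \<in> ?Q" if "b \<in> carrier B" for b
    by (rule epi_dense_modulo_ideal[OF epi sl Qi JQ that])
  have K: "ideal {a \<in> carrier A. \<phi> a \<in> ?Q} A"
    by (rule h.ideal_vimage[OF Qi])
  have JK: "?J \<subseteq> {a \<in> carrier A. \<phi> a \<in> ?Q}" using JQ J.Icarr by auto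
  obtain f where F: "f \<in> {a \<in> carrier A. \<phi> a \<in> ?Q}"
    "\<forall>k\<in>{a \<in> carrier A. \<phi> a \<in> ?Q}. k \<ominus>\<^bsub>A\<^esub> k \<otimes>\<^bsub>A\<^esub> f \<in> ?J \<and> k \<ominus>\<^bsub>A\<^esub> f \<otimes>\<^bsub>A\<^esub> k \<in> ?J"
    using h.R.semilocal_ideal_idempotent[OF sl K JK] by (rule bexE)
  have f: "f \<in> carrier A" "\<phi> f \<in> ?Q" using F(1) by simp_all
  have kf: "k \<ominus>\<^bsub>A\<^esub> k \<otimes>\<^bsub>A\<^esub> f \<in> ?J" and fk: "k \<ominus>\<^bsub>A\<^esub> f \<otimes>\<^bsub>A\<^esub> k \<in> ?J"
    if "k \<in> carrier A" "\<phi> k \<in> ?Q" for k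
    using F(2) that by simp_all
  obtain u where u: "u \<in> carrier B" "u \<otimes>\<^bsub>B\<^esub> (\<one>\<^bsub>B\<^esub> \<ominus>\<^bsub>B\<^esub> \<phi> f) = \<one>\<^bsub>B\<^esub>"
    "(\<one>\<^bsub>B\<^esub> \<ominus>\<^bsub>B\<^esub> \<phi> f) \<otimes>\<^bsub>B\<^esub> u = \<one>\<^bsub>B\<^esub>"
    using h.S.jacobson_rad_inverse[OF f(2)] .
  have J0: "?J \<subseteq> carrier A" "?J \<noteq> {}" using J.a_subset J.zero_closed by blast+
  from perfA show ?thesis
  proof
    assume "right_perfect A"
    then have nil: "left_T_nilpotent A ?J" by (simp add: right_perfect_def)
    show ?thesis
      by (rule epi_surjective_left_T_nilpotent[OF epi Qi J0 dense f kf u(1,2) nil])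
  next
    \<comment> \<open>\<open>f\<close> is an identity modulo \<open>?J\<close> on both sides for the
      preimage of \<open>?Q\<close>, and \<open>u\<close> is a two-sided inverse, so the same data
      meet the hypotheses over the opposite rings.\<close>
    assume "left_perfect A"
    then have nil: "left_T_nilpotent (op_ring A) ?J"
      by (simp add: left_perfect_def left_T_nilpotent_op)
    have "\<phi> ` carrier (op_ring A) = carrier (op_ring B)"
      by (rule epi_surjective_left_T_nilpotent[OF ring_epi_op[OF epi] ideal_op[OF Qi] _ _ _ _ _ _ _ _ nil])
        (use J0 dense f fk u in auto)
    then show ?thesis by simp
  qed
qed

section \<open>Lifting idempotents and idempotent ideals of perfect rings\<close>

lemma (in ring) one_minus_pow:
  assumes x: "x \<in> carrier R"
  shows "\<exists>g\<in>carrier R. x \<otimes> g = g \<otimes> x \<and> (\<one> \<ominus> x) [^] (n::nat) = \<one> \<ominus> x \<otimes> g"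
proof (induction n)
  case 0
  show ?case using x by (intro bexI[of _ \<zero>]) (simp_all add: a_minus_def)
next
  case (Suc n)
  then obtain g where g: "g \<in> carrier R" "x \<otimes> g = g \<otimes> x" "(\<one> \<ominus> x) [^] n = \<one> \<ominus> x \<otimes> g" by blast
  \<comment> \<open>Read off from \<open>(1 - x g)(1 - x) = 1 - x - x g + x g x\<close>, which is to
    be \<open>1 - x ?h\<close>.\<close>
  let ?h = "\<one> \<oplus> (g \<ominus> g \<otimes> x)"
  have "(\<one> \<ominus> x) [^] Suc n = (\<one> \<ominus> x \<otimes> g) \<otimes> (\<one> \<ominus> x)" using g x by simp
  also have "\<dots> = \<one> \<ominus> x \<otimes> ?h"
    using g(1) x by (simp add: a_minus_def l_distr r_distr l_minus r_minus minus_add m_assoc a_ac)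
  finally have "(\<one> \<ominus> x) [^] Suc n = \<one> \<ominus> x \<otimes> ?h" .
  moreover have "x \<otimes> ?h = ?h \<otimes> x"
  proof -
    have "x \<otimes> (g \<otimes> x) = g \<otimes> x \<otimes> x" using g x by (metis m_assoc)
    then show ?thesis
      using g x by (simp add: a_minus_def l_distr r_distr l_minus r_minus m_assoc)
  qed
  ultimately show ?case using g x by blast
qed

text \<open>With \<open>m = n + 1\<close> the assumption says \<open>x^m (1 - x)^m = 0\<close>, and
  \<open>(1 - x)^m = 1 - x g\<close> turns this into \<open>x^m = x^m (x g)\<close>. So
  \<open>e = (x g)^m\<close> fixes \<open>x^m\<close> from the right, and \<open>e = g^m x^m\<close>
  makes it idempotent. The factor \<open>x\<close> keeps \<open>e\<close> in every ideal containing
  \<open>x\<close>, while \<open>x^m = x^m e\<close> puts \<open>x^m\<close> into the ideal of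
  \<open>e\<close>.\<close>

lemma (in ring) idempotent_lift:
  assumes x: "x \<in> carrier R" and nil: "(x \<ominus> x \<otimes> x) [^] Suc n = \<zero>"
  obtains e y where "e \<in> carrier R" "y \<in> carrier R" "e \<otimes> e = e" "e = x \<otimes> y" "x [^] Suc n = x [^] Suc n \<otimes> e"
proof -
  let ?m = "Suc n"
  obtain g where g: "g \<in> carrier R" "x \<otimes> g = g \<otimes> x" "(\<one> \<ominus> x) [^] ?m = \<one> \<ominus> x \<otimes> g"
    using one_minus_pow[OF x, of ?m] by blast
  have "x \<ominus> x \<otimes> x = x \<otimes> (\<one> \<ominus> x)" using x by (simp add: r_distr_minus)
  moreover have "x \<otimes> (\<one> \<ominus> x) = (\<one> \<ominus> x) \<otimes> x" using x by (simp add: r_distr_minus l_distr_minus)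
  ultimately have "x [^] ?m \<otimes> (\<one> \<ominus> x) [^] ?m = \<zero>"
    using nil pow_mult_distrib[of x "\<one> \<ominus> x" ?m] x by simp
  then have "x [^] ?m \<otimes> (\<one> \<ominus> x \<otimes> g) = \<zero>" using g(3) by simp
  then have "x [^] ?m \<ominus> x [^] ?m \<otimes> (x \<otimes> g) = \<zero>" using x g(1) by (simp add: r_distr_minus)
  then have step: "x [^] ?m \<otimes> (x \<otimes> g) = x [^] ?m" using x g(1) by simp
  have xg: "x \<otimes> g \<in> carrier R" using x g by simp
  define e where "e = (x \<otimes> g) [^] ?m"
  have pow: "x [^] ?m \<otimes> (x \<otimes> g) [^] (k::nat) = x [^] ?m" for k
  proof (induction k)
    case (Suc k)
    have "x [^] ?m \<otimes> (x \<otimes> g) [^] Suc k = (x [^] ?m \<otimes> (x \<otimes> g) [^] k) \<otimes> (x \<otimes> g)"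
      using x xg by (simp add: m_assoc)
    then show ?case using Suc step by simp
  qed (use x in simp)
  have e2: "e = x [^] ?m \<otimes> g [^] ?m"
    unfolding e_def using x g by (intro pow_mult_distrib)
  have e3: "e = g [^] ?m \<otimes> x [^] ?m"
    unfolding e_def g(2) using x g by (intro pow_mult_distrib) auto
  have ec: "e \<in> carrier R" using xg by (simp add: e_def)
  have xe: "x [^] ?m \<otimes> e = x [^] ?m" unfolding e_def by (rule pow)
  have "e \<otimes> e = g [^] ?m \<otimes> (x [^] ?m \<otimes> e)"
    using e3 ec x g by (metis m_assoc nat_pow_closed)
  then have "e \<otimes> e = e" using xe e3 by simp
  moreover have "e = x \<otimes> (x [^] n \<otimes> g [^] ?m)"
    using e2 x g by (metis m_assoc nat_pow_closed nat_pow_Suc2)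
  ultimately show ?thesis using that[of e "x [^] n \<otimes> g [^] ?m"] ec xe x g by simp
qed

lemma (in ring) perfect_idempotent_ideal:
  assumes perf: "right_perfect R \<or> left_perfect R"
    and I: "ideal I R" and idem: "I \<subseteq> ideal_prod R I I"
  shows "\<exists>e\<in>carrier R. e \<otimes> e = e \<and> I = Idl {e}"
proof -
  interpret I: ideal I R by fact
  interpret JI: ideal J R by (rule jacobson_rad_ideal)
  have sl: "semilocal R" using perf by (auto simp: right_perfect_def left_perfect_def)
  have K: "ideal (set_add R I J) R" by (rule add_ideals[OF I jacobson_rad_ideal])
  have IK: "k \<in> set_add R I J" if "k \<in> I" for k
  proof -
    have "k = k \<oplus> \<zero>" using I.Icarr[OF that] by simp
    then show ?thesis using that JI.zero_closed unfolding set_add_def' by blast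
  qed
  have JK: "J \<subseteq> set_add R I J"
  proof
    fix j assume j: "j \<in> J"
    then have "j = \<zero> \<oplus> j" using JI.Icarr by simp
    then show "j \<in> set_add R I J" using j I.zero_closed unfolding set_add_def' by blast
  qed
  obtain f where f: "f \<in> set_add R I J"
    "\<forall>k\<in>set_add R I J. k \<ominus> k \<otimes> f \<in> J \<and> k \<ominus> f \<otimes> k \<in> J"
    using semilocal_ideal_idempotent[OF sl K JK] by (rule bexE)
  \<comment> \<open>\<open>f\<close> lies only in \<open>I + J\<close>. Its component
    \<open>x\<close> in \<open>I\<close> is still a right identity on \<open>I\<close> modulo
    \<open>J\<close>, because \<open>k j\<close> is in \<open>J\<close>.\<close>
  obtain x j where xj: "x \<in> I" "j \<in> J" "f = x \<oplus> j" using f(1) by (auto simp: set_add_def')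
  have xc: "x \<in> carrier R" "j \<in> carrier R" using xj I.Icarr JI.Icarr by auto
  have kx: "k \<ominus> k \<otimes> x \<in> J" if k: "k \<in> I" for k
  proof -
    have kc: "k \<in> carrier R" using k I.Icarr by simp
    have "(k \<ominus> k \<otimes> f) \<oplus> k \<otimes> j \<in> J"
      using f(2) IK[OF k] kc xj(2) by (intro JI.a_closed JI.I_l_closed) simp_all
    moreover have "(k \<ominus> k \<otimes> f) \<oplus> k \<otimes> j = k \<ominus> k \<otimes> x"
      using kc xc by (simp add: xj(3) r_distr a_minus_def minus_add a_assoc l_neg)
    ultimately show ?thesis by simp
  qed
  obtain n where n: "(x \<ominus> x \<otimes> x) [^] Suc n = \<zero>"
    using T_nilpotent_imp_nilpotent[of J "x \<ominus> x \<otimes> x"] kx[OF xj(1)] perf xc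
    by (auto simp: right_perfect_def left_perfect_def)
  obtain e y where e: "e \<in> carrier R" "y \<in> carrier R" "e \<otimes> e = e" "e = x \<otimes> y"
    "x [^] Suc n = x [^] Suc n \<otimes> e"
    using idempotent_lift[OF xc(1) n] .
  have eI: "e \<in> I" using e xj I.I_r_closed by simp
  interpret N: ideal "Idl {e}" R using e by (intro genideal_ideal) simp
  have eN: "e \<in> Idl {e}" using e genideal_self'[of e] by simp
  have NI: "Idl {e} \<subseteq> I" by (rule genideal_minimal[OF I]) (use eI in simp)
  have decomp: "\<exists>a\<in>Idl {e}. \<exists>j\<in>J. k = a \<oplus> j" if k: "k \<in> I" for k
  proof -
    have kc: "k \<in> carrier R" using k I.Icarr by simp
    \<comment> \<open>Every power of \<open>x\<close> is a right identity on \<open>I\<close> modulo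
      \<open>J\<close>, and the power with exponent \<open>n + 1\<close> lies in
      \<open>Idl {e}\<close>.\<close>
    have pow: "k \<ominus> k \<otimes> x [^] (m::nat) \<in> J" for m
    proof (induction m)
      case 0
      then show ?case using kc by (simp add: a_minus_def r_neg)
    next
      case (Suc m)
      have 1: "k \<otimes> x [^] m \<in> I" using k xc I.I_r_closed by simp
      have "(k \<ominus> k \<otimes> x [^] m) \<oplus> (k \<otimes> x [^] m \<ominus> (k \<otimes> x [^] m) \<otimes> x) \<in> J"
        using Suc kx[OF 1] by simp
      moreover have "(k \<ominus> k \<otimes> x [^] m) \<oplus> (k \<otimes> x [^] m \<ominus> (k \<otimes> x [^] m) \<otimes> x) = k \<ominus> (k \<otimes> x [^] m) \<otimes> x"
        using kc xc by (simp add: a_minus_def a_assoc r_neg1)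
      ultimately show ?case using kc xc by (simp add: m_assoc)
    qed
    have "k \<otimes> x [^] Suc n = (k \<otimes> x [^] Suc n) \<otimes> e" using e kc xc by (metis m_assoc nat_pow_closed)
    moreover have "(k \<otimes> x [^] Suc n) \<otimes> e \<in> Idl {e}" using eN kc xc by (intro N.I_l_closed) auto
    ultimately have a: "k \<otimes> x [^] Suc n \<in> Idl {e}" by simp
    have "k = k \<otimes> x [^] Suc n \<oplus> (k \<ominus> k \<otimes> x [^] Suc n)"
      using kc xc by (metis a_comm m_closed minus_add_cancel minus_closed nat_pow_closed)
    then show ?thesis using a pow by blast
  qed
  have idc: "(\<lambda>x. x) \<in> ring_hom R R" "(\<lambda>x. x) \<in> ring_hom (op_ring R) (op_ring R)"
    by (auto simp: ring_hom_def)
  have op: "ring (op_ring R)" by (rule ring_op_ring[OF ring_axioms])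
  have Jc: "J \<subseteq> carrier R" by (rule JI.a_subset)
  have "I \<subseteq> Idl {e}"
    using perf
  proof
    assume "right_perfect R"
    then have nil: "left_T_nilpotent R J" by (simp add: right_perfect_def)
    show ?thesis
    proof (rule left_T_nilpotent_Nakayama[OF ring_axioms ring_axioms idc(1) Jc nil])
      fix m assume "m \<in> I"
      then have "m \<in> ideal_prod R I I" using idem by blast
      then show "\<exists>n\<in>Idl {e}. \<exists>t\<in>ideal_prod R I ((\<lambda>x. x) ` J). m = n \<oplus> t"
      proof induction
        \<comment> \<open>Splitting the right factor of a product from \<open>I I\<close> yields
          \<open>i a\<close> in \<open>Idl {e}\<close> and \<open>i j\<close> in \<open>I J\<close>,
          the shape that Nakayama's lemma asks for.\<close>
        case (prod i i')
        obtain a j where aj: "a \<in> Idl {e}" "j \<in> J" "i' = a \<oplus> j" using decomp[OF prod(2)] by blast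
        then have "i \<otimes> i' = i \<otimes> a \<oplus> i \<otimes> j"
          using prod I.Icarr N.Icarr JI.Icarr by (simp add: r_distr)
        moreover have "i \<otimes> a \<in> Idl {e}" using aj prod I.Icarr N.I_l_closed by simp
        moreover have "i \<otimes> j \<in> ideal_prod R I ((\<lambda>x. x) ` J)"
          using aj prod by (intro ideal_prod.prod) auto
        ultimately show ?case by blast
      next
        case (sum s s')
        then obtain a t a' t' where *: "a \<in> Idl {e}" "a' \<in> Idl {e}" "s = a \<oplus> t" "s' = a' \<oplus> t'"
          "t \<in> ideal_prod R I J" "t' \<in> ideal_prod R I J" by auto
        have "r \<in> carrier R" if "r \<in> ideal_prod R I J" for r
          using that by induction (auto simp: I.Icarr JI.Icarr)
        then have "s \<oplus> s' = (a \<oplus> a') \<oplus> (t \<oplus> t')"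
          using * N.Icarr by (simp add: a_ac)
        then show ?case using * N.a_closed ideal_prod.sum[OF *(5,6)] by auto
      qed
    qed (auto simp: N.is_additive_subgroup N.I_r_closed I.Icarr)
  next
    assume "left_perfect R"
    then have nil: "left_T_nilpotent (op_ring R) J"
      by (simp add: left_perfect_def left_T_nilpotent_op)
    interpret N': ideal "Idl {e}" "op_ring R" by (rule ideal_op[OF N.ideal_axioms])
    show ?thesis
    proof (rule left_T_nilpotent_Nakayama[OF op op idc(2) _ nil])
      fix m assume "m \<in> I"
      then have "m \<in> ideal_prod R I I" using idem by blast
      then show "\<exists>n\<in>Idl {e}. \<exists>t\<in>ideal_prod (op_ring R) I ((\<lambda>x. x) ` J). m = n \<oplus>\<^bsub>op_ring R\<^esub> t"
      proof induction
        \<comment> \<open>Here the left factor is split, because \<open>j i\<close> is the product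
          of \<open>i\<close> and \<open>j\<close> in the opposite ring.\<close>
        case (prod i' i)
        obtain a j where aj: "a \<in> Idl {e}" "j \<in> J" "i' = a \<oplus> j" using decomp[OF prod(1)] by blast
        then have "i' \<otimes> i = a \<otimes> i \<oplus> j \<otimes> i"
          using prod I.Icarr N.Icarr JI.Icarr by (simp add: l_distr)
        moreover have "a \<otimes> i \<in> Idl {e}" using aj prod I.Icarr N.I_r_closed by simp
        moreover have "j \<otimes> i \<in> ideal_prod (op_ring R) I ((\<lambda>x. x) ` J)"
          using ideal_prod.prod[of i I j J "op_ring R"] aj prod by simp
        ultimately show ?case by auto
      next
        case (sum s s')
        then obtain a t a' t' where *: "a \<in> Idl {e}" "a' \<in> Idl {e}" "s = a \<oplus> t" "s' = a' \<oplus> t'"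
          "t \<in> ideal_prod (op_ring R) I J" "t' \<in> ideal_prod (op_ring R) I J" by auto
        have "r \<in> carrier R" if "r \<in> ideal_prod (op_ring R) I J" for r
          using that by induction (auto simp: I.Icarr JI.Icarr)
        then have "s \<oplus> s' = (a \<oplus> a') \<oplus> (t \<oplus> t')"
          using * N.Icarr by (simp add: a_ac)
        then show ?case using * N.a_closed ideal_prod.sum[OF *(5,6)] by auto
      qed
    qed (auto simp: N'.is_additive_subgroup N.I_l_closed I.Icarr JI.Icarr)
  qed
  then show ?thesis using NI e by blast
qed

section \<open>Resolutions\<close>

datatype 'a derivation = Start | Entry "'a derivation" 'a "'a derivation" | Apply nat "'a derivation"

text \<open>One kind of tree names both elements and lists: \<open>Entry\<close> prepends a labelled
  element to a list, and \<open>Apply n r\<close> is the \<open>n\<close>-th output on the list of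
  \<open>r\<close>. The component without meaning is filled with \<open>undefined\<close> or
  \<open>[]\<close>; so \<open>undefined\<close> is among the derived elements.\<close>

primrec derivation_eval :: "(nat \<Rightarrow> ('t \<times> 'a) list \<Rightarrow> 't) \<Rightarrow> 'a derivation \<Rightarrow> 't \<times> ('t \<times> 'a) list" where
  "derivation_eval f Start = (undefined, [])"
| "derivation_eval f (Entry c a r) = (undefined, (fst (derivation_eval f c), a) # snd (derivation_eval f r))"
| "derivation_eval f (Apply n r) = (f n (snd (derivation_eval f r)), [])"

text \<open>A prefix code in the type that indexes resolutions for \<open>A Quot I\<close>, whose
  elements have type \<open>'a set\<close>. \<open>Inl\<close> carries labels; \<open>{}\<close> and
  \<open>UNIV\<close>, distinct in every type, are the delimiters, and \<open>n\<close> is written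
  in unary.\<close>

primrec serialize :: "'a derivation \<Rightarrow> ('a + 'a set) list" where
  "serialize Start = [Inr {}]"
| "serialize (Entry c a r) = Inl a # serialize c @ serialize r"
| "serialize (Apply n r) = Inr UNIV # replicate n (Inr UNIV) @ Inr {} # serialize r"

lemma replicate_append_eq:
  assumes "x \<noteq> y" "replicate m x @ y # s = replicate n x @ y # t"
  shows "m = n \<and> s = t"
  using assms(2)
proof (induction m arbitrary: n)
  case 0
  then show ?case using assms(1) by (cases n) auto
next
  case (Suc m)
  then show ?case using assms(1) by (cases n) auto
qed

text \<open>Unique readability. The remainders \<open>s\<close> and \<open>s'\<close> carry the
  induction through \<open>Entry\<close>, where two codes stand side by side.\<close>

lemma serialize_append_eq:
  fixes c :: "'a derivation"
  shows "serialize c @ s = serialize c' @ s' \<Longrightarrow> c = c' \<and> s = s'"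
proof (induction c arbitrary: c' s s')
  case Start
  then show ?case by (cases c') auto
next
  case (Entry c a r)
  obtain d b q where c': "c' = Entry d b q" using Entry.prems by (cases c') simp_all
  have eq: "serialize c @ (serialize r @ s) = serialize d @ (serialize q @ s')" and "a = b"
    using Entry.prems c' by simp_all
  from Entry.IH(1)[OF eq] Entry.IH(2)[of s q s'] show ?case using c' \<open>a = b\<close> by auto
next
  case (Apply n r)
  obtain m q where c': "c' = Apply m q" using Apply.prems by (cases c') simp_all
  have "replicate n (Inr UNIV) @ Inr {} # (serialize r @ s) =
      (replicate m (Inr UNIV) @ Inr {} # (serialize q @ s') :: ('a + 'a set) list)"
    using Apply.prems c' by simp
  then have "n = m \<and> serialize r @ s = serialize q @ s'"
    by (intro replicate_append_eq[of "Inr UNIV" "Inr {}"]) auto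
  then show ?case using Apply.IH[of s q s'] c' by auto
qed

lemma inj_serialize: "inj serialize"
  using serialize_append_eq[of _ "[]" _ "[]"] by (auto intro: injI)

text \<open>Closing up under countably many outputs per finite input only produces as many elements as there
  are finite trees with labels in \<open>'a\<close>.\<close>

lemma small_closed_set:
  fixes F :: "('t \<times> 'a) list \<Rightarrow> 't set"
  assumes "\<And>l. countable (F l)"
  shows "\<exists>Y (\<iota> :: 't \<Rightarrow> ('a + 'a set) list). inj_on \<iota> Y \<and> Y \<noteq> {} \<and> (\<forall>l. fst ` set l \<subseteq> Y \<longrightarrow> F l \<subseteq> Y)"
proof -
  \<comment> \<open>An enumeration of \<open>F l\<close>. For empty \<open>F l\<close> its value is
    arbitrary, so \<open>Y\<close> may exceed the closure proper; only its closedness and its size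
    matter.\<close>
  define f where "f n l = from_nat_into (F l) n" for n l
  define ev where "ev c = fst (derivation_eval f c)" for c
  define Y where "Y = range ev"
  define \<iota> where "\<iota> y = serialize (SOME c. ev c = y)" for y
  have "ev (SOME c. ev c = y) = y" if "y \<in> Y" for y
    by (rule someI_ex) (use that in \<open>auto simp: Y_def\<close>)
  then have "inj_on \<iota> Y"
    unfolding \<iota>_def by (intro inj_onI) (metis inj_serialize injD)
  moreover have "Y \<noteq> {}" by (simp add: Y_def)
  moreover have "F l \<subseteq> Y" if "fst ` set l \<subseteq> Y" for l
  proof
    fix y assume y: "y \<in> F l"
    have "\<exists>r. snd (derivation_eval f r) = l"
      using that
    proof (induction l)
      case Nil
      show ?case by (rule exI[of _ Start]) simp
    next
      case (Cons p l)
      obtain t a where p: "p = (t, a)" by force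
      then obtain c where "ev c = t" using Cons.prems by (auto simp: Y_def)
      moreover obtain r where "snd (derivation_eval f r) = l" using Cons by auto
      ultimately show ?case using p by (intro exI[of _ "Entry c a r"]) (simp add: ev_def)
    qed
    then obtain r where r: "snd (derivation_eval f r) = l" by blast
    obtain n where "from_nat_into (F l) n = y"
      using from_nat_into_surj[OF assms y] by blast
    then have "ev (Apply n r) = y" by (simp add: ev_def r f_def)
    then show "y \<in> Y" by (auto simp: Y_def)
  qed
  ultimately show ?thesis by blast
qed

section \<open>Finitely supported vectors and matrices acting on them\<close>

abbreviation FE :: "('a, 'm) ring_scheme \<Rightarrow> 'i set \<Rightarrow> ('i \<Rightarrow> 'a) set" where
  "FE R Z \<equiv> fin_elems (carrier R) \<zero>\<^bsub>R\<^esub> Z"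

lemma FED:
  assumes "v \<in> FE R Z"
  shows "v x \<in> carrier R" "x \<notin> Z \<Longrightarrow> v x = \<zero>\<^bsub>R\<^esub>" "finite {x. v x \<noteq> \<zero>\<^bsub>R\<^esub>}" "{x. v x \<noteq> \<zero>\<^bsub>R\<^esub>} \<subseteq> Z"
  using assms by (auto simp: fin_elems_def)

lemma FEI:
  assumes "\<And>x. v x \<in> carrier R" "\<And>x. x \<notin> Z \<Longrightarrow> v x = \<zero>\<^bsub>R\<^esub>" "finite F" "{x. v x \<noteq> \<zero>\<^bsub>R\<^esub>} \<subseteq> F"
  shows "v \<in> FE R Z"
  using assms by (auto simp: fin_elems_def intro: finite_subset)

lemma FE_subset_iff: "v \<in> FE R (Z \<inter> Y) \<longleftrightarrow> v \<in> FE R Z \<and> {x. v x \<noteq> \<zero>\<^bsub>R\<^esub>} \<subseteq> Y"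
  by (auto simp: fin_elems_def)

text \<open>Tensoring with \<open>B\<close> applies \<open>\<phi>\<close> to the matrix entries, so
  the facts about \<open>dmap\<close> also cover the tensored complex.\<close>

lemma tmap_eq_dmap: "tmap B \<phi> d = dmap B (\<lambda>y x. \<phi> (d y x))"
  by (intro ext) (simp add: tmap_def dmap_def)

text \<open>\<open>dmap\<close> sums over the support of \<open>v\<close>; a fixed finite set around
  several supports makes such sums comparable.\<close>

lemma (in ring) dmap_eq_finsum:
  assumes "v \<in> FE R Z" "\<And>y. y \<in> Z \<Longrightarrow> d y x \<in> carrier R" "finite F" "F \<subseteq> Z"
    "{y. v y \<noteq> \<zero>} \<subseteq> F"
  shows "dmap R d v x = (\<Oplus>y\<in>F. d y x \<otimes> v y)"
  unfolding dmap_def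
  by (rule add.finprod_mono_neutral_cong_left) (use assms(2-) FED(1,4)[OF assms(1)] in auto)

lemma (in ring) dmap_closed:
  assumes "v \<in> FE R Z" "\<And>y. y \<in> Z \<Longrightarrow> d y x \<in> carrier R"
  shows "dmap R d v x \<in> carrier R"
  unfolding dmap_def by (rule finsum_closed) (use assms(2-) FED(1,4)[OF assms(1)] in auto)

lemma (in ring) dmap_nonzero:
  assumes "v \<in> FE R Z" "\<And>y. y \<in> Z \<Longrightarrow> d y x \<in> carrier R" "dmap R d v x \<noteq> \<zero>"
  shows "\<exists>y\<in>Z. v y \<noteq> \<zero> \<and> d y x \<noteq> \<zero>"
proof (rule ccontr)
  assume "\<not> ?thesis"
  then have *: "d y x = \<zero>" if "v y \<noteq> \<zero>" for y using that FED(4)[OF assms(1)] by blast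
  have "dmap R d v x = \<zero>"
    unfolding dmap_def by (rule add.finprod_one_eqI) (use * FED(1)[OF assms(1)] in auto)
  then show False using assms(3) by simp
qed

lemma dmap_cong:
  assumes "ring R" "v \<in> FE R Z" "\<And>y. y \<in> Z \<Longrightarrow> d y x \<in> carrier R" "\<And>y. y \<in> Z \<Longrightarrow> d y x = d' y x"
  shows "dmap R d v x = dmap R d' v x"
proof -
  interpret ring R by fact
  show ?thesis
    unfolding dmap_def
    by (rule add.finprod_cong') (use assms(3,4) FED(1,4)[OF assms(2)] in auto)
qed

context ring_hom_ring
begin

lemma hom_finsum:
  "f \<in> F \<rightarrow> carrier R \<Longrightarrow> h (\<Oplus>x\<in>F. f x) = (\<Oplus>\<^bsub>S\<^esub>x\<in>F. h (f x))"
proof (induction F rule: infinite_finite_induct)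
  case (insert x F)
  then have "f x \<in> carrier R" "f \<in> F \<rightarrow> carrier R" by auto
  then show ?case
    using insert R.finsum_insert[of F x f] S.finsum_insert[of F x "\<lambda>x. h (f x)"] by (simp add: Pi_def)
qed auto

lemma FE_hom:
  assumes v: "v \<in> FE R Z"
  shows "(\<lambda>x. h (v x)) \<in> FE S Z"
  by (rule FEI[of _ _ _ "{x. v x \<noteq> \<zero>}"]) (use FED[OF v] in auto)

lemma FE_lift:
  assumes surj: "h ` carrier R = carrier S" and w: "w \<in> FE S Z"
  shows "\<exists>v\<in>FE R Z. w = (\<lambda>x. h (v x))"
proof -
  \<comment> \<open>Zero is lifted to zero, so that the support stays finite.\<close>
  define v where "v x = (if w x = \<zero>\<^bsub>S\<^esub> then \<zero> else SOME a. a \<in> carrier R \<and> h a = w x)" for x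
  have "\<exists>a. a \<in> carrier R \<and> h a = w x" for x using FED(1)[OF w, of x] surj by (metis imageE)
  then have "(SOME a. a \<in> carrier R \<and> h a = w x) \<in> carrier R \<and> h (SOME a. a \<in> carrier R \<and> h a = w x) = w x"
    for x by (rule someI_ex)
  then have v: "v x \<in> carrier R" "h (v x) = w x" for x by (simp_all add: v_def)
  have "v \<in> FE R Z"
    by (rule FEI[of _ _ _ "{x. w x \<noteq> \<zero>\<^bsub>S\<^esub>}"]) (use v FED[OF w] in \<open>auto simp: v_def\<close>)
  then show ?thesis using v by (intro bexI[of _ v]) auto
qed

lemma hom_dmap:
  assumes "v \<in> FE R Z" "\<And>y. y \<in> Z \<Longrightarrow> d y x \<in> carrier R"
  shows "h (dmap R d v x) = dmap S (\<lambda>y x. h (d y x)) (\<lambda>y. h (v y)) x"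
proof -
  let ?F = "{y. v y \<noteq> \<zero>}"
  note F = FED(1,3,4)[OF assms(1)]
  have "h (dmap R d v x) = (\<Oplus>\<^bsub>S\<^esub>y\<in>?F. h (d y x \<otimes> v y))"
    unfolding dmap_def by (rule hom_finsum) (use F assms(2) in auto)
  also have "\<dots> = (\<Oplus>\<^bsub>S\<^esub>y\<in>?F. h (d y x) \<otimes>\<^bsub>S\<^esub> h (v y))"
    by (rule S.add.finprod_cong') (use F assms(2) in auto)
  \<comment> \<open>The support may shrink under \<open>h\<close>, so the sum is taken over the
    larger set \<open>?F\<close>.\<close>
  also have "\<dots> = dmap S (\<lambda>y x. h (d y x)) (\<lambda>y. h (v y)) x"
    by (rule S.dmap_eq_finsum[OF FE_hom[OF assms(1)], symmetric]) (use F assms(2) in auto)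
  finally show ?thesis .
qed

lemma augm_eq_finsum:
  assumes "v \<in> FE R Z" "\<And>x. x \<in> Z \<Longrightarrow> m x \<in> carrier S" "finite F" "F \<subseteq> Z" "{x. v x \<noteq> \<zero>} \<subseteq> F"
  shows "augm R S h m v = (\<Oplus>\<^bsub>S\<^esub>x\<in>F. m x \<otimes>\<^bsub>S\<^esub> h (v x))"
  unfolding augm_def
  by (rule S.add.finprod_mono_neutral_cong_left) (use assms(2-) FED(1,4)[OF assms(1)] in auto)

lemma augm_closed:
  assumes "v \<in> FE R Z" "\<And>x. x \<in> Z \<Longrightarrow> m x \<in> carrier S"
  shows "augm R S h m v \<in> carrier S"
  unfolding augm_def by (rule S.finsum_closed) (use assms(2-) FED(1,4)[OF assms(1)] in auto)

end

section \<open>Vanishing Tor and idempotence of the kernel\<close>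

lemma free_resolutionD:
  assumes "free_resolution A B \<phi> Xs d m"
  shows "\<And>n y. y \<in> Xs (Suc n) \<Longrightarrow> d n y \<in> FE A (Xs n)"
    "\<And>x. x \<in> Xs 0 \<Longrightarrow> m x \<in> carrier B"
    "augm A B \<phi> m ` FE A (Xs 0) = carrier B"
    "{v \<in> FE A (Xs 0). augm A B \<phi> m v = \<zero>\<^bsub>B\<^esub>} = dmap A (d 0) ` FE A (Xs (Suc 0))"
    "\<And>n. {v \<in> FE A (Xs (Suc n)). dmap A (d n) v = (\<lambda>_. \<zero>\<^bsub>A\<^esub>)} =
      dmap A (d (Suc n)) ` FE A (Xs (Suc (Suc n)))"
proof -
  note * = assms[unfolded free_resolution_def One_nat_def]
  show "d n y \<in> FE A (Xs n)" if "y \<in> Xs (Suc n)" for n y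
    by (rule *[THEN conjunct1, rule_format, OF that])
  show "m x \<in> carrier B" if "x \<in> Xs 0" for x
    by (rule *[THEN conjunct2, THEN conjunct1, rule_format, OF that])
  show "augm A B \<phi> m ` FE A (Xs 0) = carrier B"
    by (rule *[THEN conjunct2, THEN conjunct2, THEN conjunct1])
  show "{v \<in> FE A (Xs 0). augm A B \<phi> m v = \<zero>\<^bsub>B\<^esub>} = dmap A (d 0) ` FE A (Xs (Suc 0))"
    by (rule *[THEN conjunct2, THEN conjunct2, THEN conjunct2, THEN conjunct1])
  show "{v \<in> FE A (Xs (Suc n)). dmap A (d n) v = (\<lambda>_. \<zero>\<^bsub>A\<^esub>)} =
      dmap A (d (Suc n)) ` FE A (Xs (Suc (Suc n)))" for n
    by (rule *[THEN conjunct2, THEN conjunct2, THEN conjunct2, THEN conjunct2, rule_format])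
qed

text \<open>A chain \<open>u\<close> bounding \<open>v r\<close>, where \<open>v\<close> lifts \<open>1\<close> and \<open>r\<close> lies in the kernel, becomes a cycle over
  \<open>B\<close>; it may be corrected by a boundary so as to have all coefficients in the kernel.\<close>

lemma (in ring_hom_ring) tor_vanishes_kernel_idempotent:
  assumes res: "free_resolution R S h Xs d m" and tor: "tor_vanishes S h Xs d"
    and surj: "h ` carrier R = carrier S"
  shows "a_kernel R S h \<subseteq> ideal_prod R (a_kernel R S h) (a_kernel R S h)"
proof
  let ?I = "a_kernel R S h"
  interpret I: ideal ?I R by (rule kernel_is_ideal)
  let ?P = "ideal_prod R ?I ?I"
  interpret P: ideal ?P R by (rule R.ideal_prod_is_ideal[OF kernel_is_ideal kernel_is_ideal])
  have ker: "x \<in> ?I \<longleftrightarrow> x \<in> carrier R \<and> h x = \<zero>\<^bsub>S\<^esub>" for x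
    unfolding a_kernel_def' by simp
  note res' = free_resolutionD[OF res]
  have dc: "d n y x \<in> carrier R" if "y \<in> Xs (Suc n)" for n y x
    using FED(1)[OF res'(1)[OF that]] .
  fix r assume rI: "r \<in> ?I"
  then have r: "r \<in> carrier R" "h r = \<zero>\<^bsub>S\<^esub>" by (simp_all add: ker)
  have "\<one>\<^bsub>S\<^esub> \<in> augm R S h m ` FE R (Xs 0)" using res'(3) by simp
  then obtain v where v: "v \<in> FE R (Xs 0)" "augm R S h m v = \<one>\<^bsub>S\<^esub>" by auto
  note v' = FED[OF v(1)]
  let ?vr = "\<lambda>x. v x \<otimes> r"
  have vr: "?vr \<in> FE R (Xs 0)"
    by (rule FEI[of _ _ _ "{x. v x \<noteq> \<zero>}"]) (use v' r in auto)
  have "augm R S h m ?vr = \<zero>\<^bsub>S\<^esub>"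
    unfolding augm_def
  proof (rule S.add.finprod_one_eqI)
    fix x assume "x \<in> {x. v x \<otimes> r \<noteq> \<zero>}"
    then have "x \<in> Xs 0" using FED(4)[OF vr] by blast
    then show "m x \<otimes>\<^bsub>S\<^esub> h (v x \<otimes> r) = \<zero>\<^bsub>S\<^esub>" using v'(1)[of x] r res'(2)[of x] by simp
  qed
  with vr have "?vr \<in> {v \<in> FE R (Xs 0). augm R S h m v = \<zero>\<^bsub>S\<^esub>}" by simp
  then obtain u where u: "u \<in> FE R (Xs (Suc 0))" "?vr = dmap R (d 0) u"
    unfolding res'(4) by (rule imageE)
  note u' = FED[OF u(1)]
  have hu: "(\<lambda>y. h (u y)) \<in> FE S (Xs (Suc 0))" by (rule FE_hom[OF u(1)])
  have "tmap S h (d 0) (\<lambda>y. h (u y)) = (\<lambda>_. \<zero>\<^bsub>S\<^esub>)"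
  proof
    fix x
    have "tmap S h (d 0) (\<lambda>y. h (u y)) x = h (dmap R (d 0) u x)"
      unfolding tmap_eq_dmap by (rule hom_dmap[OF u(1) dc, symmetric])
    also have "\<dots> = h (v x \<otimes> r)" using u(2) by metis
    finally show "tmap S h (d 0) (\<lambda>y. h (u y)) x = \<zero>\<^bsub>S\<^esub>" using r v' by simp
  qed
  with hu have "(\<lambda>y. h (u y)) \<in> {w \<in> FE S (Xs (Suc 0)). tmap S h (d 0) w = (\<lambda>_. \<zero>\<^bsub>S\<^esub>)}" by simp
  from subsetD[OF tor[unfolded tor_vanishes_def, rule_format] this]
  obtain w where w: "(\<lambda>y. h (u y)) = tmap S h (d (Suc 0)) w" "w \<in> FE S (Xs (Suc (Suc 0)))"
    by (rule imageE)
  obtain c where c: "c \<in> FE R (Xs (Suc (Suc 0)))" "w = (\<lambda>y. h (c y))"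
    using FE_lift[OF surj w(2)] by blast
  define b where "b = dmap R (d (Suc 0)) c"
  have "b \<in> dmap R (d (Suc 0)) ` FE R (Xs (Suc (Suc 0)))" using c b_def by blast
  then have b: "b \<in> FE R (Xs (Suc 0))" "dmap R (d 0) b = (\<lambda>_. \<zero>)"
    unfolding res'(5)[of 0, symmetric] by auto
  note b' = FED[OF b(1)]
  have hb: "h (b y) = h (u y)" for y
  proof -
    have "h (b y) = tmap S h (d (Suc 0)) w y"
      unfolding b_def tmap_eq_dmap c(2) by (rule hom_dmap[OF c(1) dc])
    also have "\<dots> = h (u y)" by (rule fun_cong[OF w(1), symmetric])
    finally show ?thesis .
  qed
  define t where "t y = u y \<ominus> b y" for y
  define F where "F = {y. u y \<noteq> \<zero>} \<union> {y. b y \<noteq> \<zero>}"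
  have F: "finite F" "F \<subseteq> Xs (Suc 0)" using u' b' by (auto simp: F_def)
  have tI: "t y \<in> ?I" for y
    using hb[of y] u' b' by (simp add: ker t_def a_minus_def S.r_neg)
  have tc: "t y \<in> carrier R" for y using tI ker by blast
  have vrF: "v x \<otimes> r = (\<Oplus>y\<in>F. d 0 y x \<otimes> t y)" for x
  proof -
    have dF: "d 0 y x \<in> carrier R" if "y \<in> F" for y using that F dc by blast
    have "v x \<otimes> r = dmap R (d 0) u x" using u(2) by metis
    also have "\<dots> = (\<Oplus>y\<in>F. d 0 y x \<otimes> u y)"
      by (rule R.dmap_eq_finsum[OF u(1) dc F]) (auto simp: F_def)
    also have "\<dots> = (\<Oplus>y\<in>F. d 0 y x \<otimes> t y \<oplus> d 0 y x \<otimes> b y)"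
    proof (rule R.add.finprod_cong')
      fix y assume "y \<in> F"
      then show "d 0 y x \<otimes> u y = d 0 y x \<otimes> t y \<oplus> d 0 y x \<otimes> b y"
        using dF u' b' by (simp add: t_def R.r_distr_minus R.minus_add_cancel)
    qed (use dF u' b' tc in auto)
    also have "\<dots> = (\<Oplus>y\<in>F. d 0 y x \<otimes> t y) \<oplus> (\<Oplus>y\<in>F. d 0 y x \<otimes> b y)"
      by (rule R.finsum_addf) (use dF b' tc in auto)
    also have "(\<Oplus>y\<in>F. d 0 y x \<otimes> b y) = dmap R (d 0) b x"
      by (rule R.dmap_eq_finsum[OF b(1) dc F, symmetric]) (auto simp: F_def)
    also have "\<dots> = \<zero>" using b(2) by simp
    finally show ?thesis using dF tc by (simp add: R.finsum_closed Pi_def)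
  qed
  \<comment> \<open>A finite set of indices containing the supports of \<open>v\<close> and of all
    \<open>d 0 y\<close> with \<open>y\<close> in \<open>F\<close>, over which all their
    augmentations can be computed.\<close>
  define G where "G = {x. v x \<noteq> \<zero>} \<union> (\<Union>y\<in>F. {x. d 0 y x \<noteq> \<zero>})"
  have dF: "finite {x. d 0 y x \<noteq> \<zero>}" "{x. d 0 y x \<noteq> \<zero>} \<subseteq> Xs 0" if "y \<in> F" for y
    using FED(3,4)[OF res'(1)] F that by blast+
  have "finite G" unfolding G_def by (intro finite_UnI finite_UN_I v'(3) F(1) dF(1))
  moreover have "G \<subseteq> Xs 0" unfolding G_def by (intro Un_least UN_least v'(4) dF(2))
  ultimately have G: "finite G" "G \<subseteq> Xs 0" .
  have "\<forall>x\<in>Xs 0. \<exists>a. a \<in> carrier R \<and> h a = m x"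
  proof
    fix x assume "x \<in> Xs 0"
    then have "m x \<in> h ` carrier R" unfolding surj by (rule res'(2))
    then show "\<exists>a. a \<in> carrier R \<and> h a = m x" by auto
  qed
  from bchoice[OF this] obtain \<mu> where "\<forall>x\<in>Xs 0. \<mu> x \<in> carrier R \<and> h (\<mu> x) = m x" by (rule exE)
  then have \<mu>: "\<mu> x \<in> carrier R \<and> h (\<mu> x) = m x" if "x \<in> Xs 0" for x using that by blast
  have mc: "m x \<in> carrier S" if "x \<in> G" for x using res'(2) G that by blast
  have \<mu>c: "\<mu> x \<in> carrier R" if "x \<in> G" for x using \<mu> G that by blast
  have aug: "h (\<Oplus>x\<in>G. \<mu> x \<otimes> z x) = augm R S h m z"
    if z: "z \<in> FE R (Xs 0)" "{x. z x \<noteq> \<zero>} \<subseteq> G" for z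
  proof -
    have "h (\<Oplus>x\<in>G. \<mu> x \<otimes> z x) = (\<Oplus>\<^bsub>S\<^esub>x\<in>G. h (\<mu> x \<otimes> z x))"
      by (rule hom_finsum) (use \<mu>c FED(1)[OF z(1)] in auto)
    also have "\<dots> = (\<Oplus>\<^bsub>S\<^esub>x\<in>G. m x \<otimes>\<^bsub>S\<^esub> h (z x))"
      by (rule S.add.finprod_cong') (use \<mu> G FED(1)[OF z(1)] mc in auto)
    also have "\<dots> = augm R S h m z"
      by (rule augm_eq_finsum[symmetric, OF z(1) res'(2) G z(2)])
    finally show ?thesis .
  qed
  \<comment> \<open>\<open>d 0 y\<close> is the boundary of the basis vector \<open>?e\<close>, so
    its augmentation vanishes; the sum is a lift of that augmentation to \<open>R\<close>.\<close>
  have dI: "(\<Oplus>x\<in>G. \<mu> x \<otimes> d 0 y x) \<in> ?I" if y: "y \<in> F" for y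
  proof -
    have yX: "y \<in> Xs (Suc 0)" using y F by blast
    let ?e = "\<lambda>z. if z = y then \<one> else \<zero>"
    have e: "?e \<in> FE R (Xs (Suc 0))" by (rule FEI[of _ _ _ "{y}"]) (use yX in auto)
    have "dmap R (d 0) ?e x = d 0 y x" for x
    proof -
      have "dmap R (d 0) ?e x = (\<Oplus>z\<in>{y}. d 0 z x \<otimes> ?e z)"
        by (rule R.dmap_eq_finsum[OF e dc]) (use yX in auto)
      then show ?thesis using dc[OF yX] by (simp add: R.finsum_singleton)
    qed
    then have "d 0 y = dmap R (d 0) ?e" by auto
    then have "augm R S h m (d 0 y) = \<zero>\<^bsub>S\<^esub>" using res'(4) imageI[OF e, of "dmap R (d 0)"] by auto
    moreover have "{x. d 0 y x \<noteq> \<zero>} \<subseteq> G" using y by (auto simp: G_def)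
    ultimately have "h (\<Oplus>x\<in>G. \<mu> x \<otimes> d 0 y x) = \<zero>\<^bsub>S\<^esub>" using aug[OF res'(1)[OF yX]] by simp
    moreover have "(\<Oplus>x\<in>G. \<mu> x \<otimes> d 0 y x) \<in> carrier R"
      using \<mu>c dc[OF yX] by (intro R.finsum_closed) auto
    ultimately show ?thesis unfolding ker by (intro conjI)
  qed
  \<comment> \<open>Interchanging the sums gives, for each \<open>y\<close>, the product of the
    kernel elements \<open>\<Oplus>x\<in>G. \<mu> x \<otimes> d 0 y x\<close> and
    \<open>t y\<close>.\<close>
  have sumP: "(\<Oplus>x\<in>G. \<mu> x \<otimes> (\<Oplus>y\<in>F'. d 0 y x \<otimes> t y)) \<in> ?P" if "finite F'" "F' \<subseteq> F" for F'
    using that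
  proof (induction F')
    case empty
    show ?case
    proof -
    have "(\<Oplus>x\<in>G. \<mu> x \<otimes> (\<Oplus>y\<in>{}. d 0 y x \<otimes> t y)) = \<zero>"
      by (rule R.add.finprod_one_eqI) (use \<mu>c in auto)
    then show ?thesis by (simp only: P.zero_closed)
    qed
  next
    case (insert y F')
    have yX: "y \<in> Xs (Suc 0)" using insert F by blast
    have c1: "(\<Oplus>y\<in>F'. d 0 y x \<otimes> t y) \<in> carrier R" for x
      using insert F dc tc by (intro R.finsum_closed) auto
    have "(\<Oplus>x\<in>G. \<mu> x \<otimes> (\<Oplus>y\<in>insert y F'. d 0 y x \<otimes> t y)) =
      (\<Oplus>x\<in>G. \<mu> x \<otimes> d 0 y x \<otimes> t y \<oplus> \<mu> x \<otimes> (\<Oplus>y\<in>F'. d 0 y x \<otimes> t y))"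
    proof (rule R.add.finprod_cong')
      fix x assume x: "x \<in> G"
      have "(\<Oplus>y\<in>insert y F'. d 0 y x \<otimes> t y) = d 0 y x \<otimes> t y \<oplus> (\<Oplus>y\<in>F'. d 0 y x \<otimes> t y)"
        by (rule R.finsum_insert) (use insert F dc tc in auto)
      then show "\<mu> x \<otimes> (\<Oplus>y\<in>insert y F'. d 0 y x \<otimes> t y) =
          \<mu> x \<otimes> d 0 y x \<otimes> t y \<oplus> \<mu> x \<otimes> (\<Oplus>y\<in>F'. d 0 y x \<otimes> t y)"
        using \<mu>c[OF x] dc[OF yX] tc c1 by (simp add: R.r_distr R.m_assoc)
    qed (use \<mu>c dc[OF yX] tc c1 in auto)
    also have "\<dots> = (\<Oplus>x\<in>G. \<mu> x \<otimes> d 0 y x \<otimes> t y) \<oplus> (\<Oplus>x\<in>G. \<mu> x \<otimes> (\<Oplus>y\<in>F'. d 0 y x \<otimes> t y))"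
      by (rule R.finsum_addf) (use \<mu>c dc[OF yX] tc c1 in auto)
    also have "(\<Oplus>x\<in>G. \<mu> x \<otimes> d 0 y x \<otimes> t y) = (\<Oplus>x\<in>G. \<mu> x \<otimes> d 0 y x) \<otimes> t y"
      by (rule R.finsum_ldistr[symmetric]) (use \<mu>c dc[OF yX] tc G in auto)
    finally show ?case
    proof (rule ssubst)
      have "y \<in> F" "F' \<subseteq> F" using insert.prems by auto
      then show "(\<Oplus>x\<in>G. \<mu> x \<otimes> d 0 y x) \<otimes> t y \<oplus> (\<Oplus>x\<in>G. \<mu> x \<otimes> (\<Oplus>y\<in>F'. d 0 y x \<otimes> t y)) \<in> ?P"
        by (intro P.a_closed ideal_prod.prod[OF dI tI] insert.IH)
    qed
  qed
  \<comment> \<open>A lift of the augmentation of \<open>v\<close>, hence congruent to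
    \<open>1\<close> modulo the kernel. In \<open>r = (1 - \<alpha>) r + \<alpha> r\<close> the
    first term is a product of two kernel elements and the second is the double sum.\<close>
  define \<alpha> where "\<alpha> = (\<Oplus>x\<in>G. \<mu> x \<otimes> v x)"
  have \<alpha>c: "\<alpha> \<in> carrier R" unfolding \<alpha>_def using \<mu>c v' by (intro R.finsum_closed) auto
  have "{x. v x \<noteq> \<zero>} \<subseteq> G" by (auto simp: G_def)
  then have h\<alpha>: "h \<alpha> = \<one>\<^bsub>S\<^esub>" unfolding \<alpha>_def using aug[OF v(1)] v(2) by simp
  have "\<alpha> \<otimes> r = (\<Oplus>x\<in>G. \<mu> x \<otimes> v x \<otimes> r)"
    unfolding \<alpha>_def by (rule R.finsum_ldistr) (use \<mu>c v' r G in auto)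
  also have "\<dots> = (\<Oplus>x\<in>G. \<mu> x \<otimes> (\<Oplus>y\<in>F. d 0 y x \<otimes> t y))"
    by (rule R.add.finprod_cong') (use \<mu>c v' r in \<open>auto simp: R.m_assoc simp flip: vrF\<close>)
  finally have \<alpha>r: "\<alpha> \<otimes> r \<in> ?P" using sumP[OF F(1)] by simp
  have "\<one> \<ominus> \<alpha> \<in> ?I" 
    unfolding ker using \<alpha>c h\<alpha> by (simp add: a_minus_def S.r_neg)
  then have "(\<one> \<ominus> \<alpha>) \<otimes> r \<in> ?P" using rI by (rule ideal_prod.prod)
  with \<alpha>r have "(\<one> \<ominus> \<alpha>) \<otimes> r \<oplus> \<alpha> \<otimes> r \<in> ?P" by (intro P.a_closed)
  moreover have "(\<one> \<ominus> \<alpha>) \<otimes> r \<oplus> \<alpha> \<otimes> r = r"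
    using \<alpha>c r by (simp add: R.l_distr_minus R.minus_add_cancel)
  ultimately show "r \<in> ?P" by simp
qed

section \<open>Restricting, reindexing and transporting resolutions\<close>

lemma free_resolutionI:
  assumes "\<And>n y. y \<in> Xs (Suc n) \<Longrightarrow> d n y \<in> FE A (Xs n)"
    "\<And>x. x \<in> Xs 0 \<Longrightarrow> m x \<in> carrier B"
    "augm A B \<phi> m ` FE A (Xs 0) = carrier B"
    "{v \<in> FE A (Xs 0). augm A B \<phi> m v = \<zero>\<^bsub>B\<^esub>} = dmap A (d 0) ` FE A (Xs (Suc 0))"
    "\<And>n. {v \<in> FE A (Xs (Suc n)). dmap A (d n) v = (\<lambda>_. \<zero>\<^bsub>A\<^esub>)} =
      dmap A (d (Suc n)) ` FE A (Xs (Suc (Suc n)))"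
  shows "free_resolution A B \<phi> Xs d m"
  unfolding free_resolution_def One_nat_def
proof (intro conjI allI ballI)
  show "d n y \<in> FE A (Xs n)" if "y \<in> Xs (Suc n)" for n y by (rule assms(1)[OF that])
  show "m x \<in> carrier B" if "x \<in> Xs 0" for x by (rule assms(2)[OF that])
  show "{v \<in> FE A (Xs (Suc n)). dmap A (d n) v = (\<lambda>_. \<zero>\<^bsub>A\<^esub>)} =
      dmap A (d (Suc n)) ` FE A (Xs (Suc (Suc n)))" for n by (rule assms(5))
qed (rule assms(3) assms(4))+

lemma tor_vanishesD:
  assumes "tor_vanishes B \<phi> Xs d" "w \<in> FE B (Xs (Suc n))" "tmap B \<phi> (d n) w = (\<lambda>_. \<zero>\<^bsub>B\<^esub>)"
  shows "\<exists>u\<in>FE B (Xs (Suc (Suc n))). w = tmap B \<phi> (d (Suc n)) u"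
proof -
  have "w \<in> {w \<in> FE B (Xs (Suc n)). tmap B \<phi> (d n) w = (\<lambda>_. \<zero>\<^bsub>B\<^esub>)}" using assms(2,3) by simp
  from subsetD[OF assms(1)[unfolded tor_vanishes_def, rule_format] this] show ?thesis by blast
qed

lemma tor_vanishesI:
  assumes "\<And>n w. w \<in> FE B (Xs (Suc n)) \<Longrightarrow> tmap B \<phi> (d n) w = (\<lambda>_. \<zero>\<^bsub>B\<^esub>) \<Longrightarrow>
    \<exists>u\<in>FE B (Xs (Suc (Suc n))). w = tmap B \<phi> (d (Suc n)) u"
  shows "tor_vanishes B \<phi> Xs d"
  unfolding tor_vanishes_def
proof (intro allI subsetI)
  fix n w assume "w \<in> {w \<in> FE B (Xs (Suc n)). tmap B \<phi> (d n) w = (\<lambda>_. \<zero>\<^bsub>B\<^esub>)}"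
  then have "w \<in> FE B (Xs (Suc n))" "tmap B \<phi> (d n) w = (\<lambda>_. \<zero>\<^bsub>B\<^esub>)" by simp_all
  from assms[OF this] show "w \<in> tmap B \<phi> (d (Suc n)) ` FE B (Xs (Suc (Suc n)))" by blast
qed

lemma FE_mono: "v \<in> FE R (Z \<inter> Y) \<Longrightarrow> v \<in> FE R Z"
  by (simp add: FE_subset_iff)

text \<open>Boundaries of vectors supported in \<open>Y\<close> stay in \<open>Y\<close> because the
  columns \<open>d n y\<close> do, and they are cycles already in the large complex. The converse
  inclusions and the surjectivity of the augmentation need preimages supported in \<open>Y\<close>,
  which the last three assumptions supply.\<close>

lemma free_resolution_restrict:
  assumes hom: "ring_hom_ring A B \<phi>" and res: "free_resolution A B \<phi> Xs d m"
    and supp: "\<And>n y. y \<in> Xs (Suc n) \<Longrightarrow> y \<in> Y \<Longrightarrow> {x. d n y x \<noteq> \<zero>\<^bsub>A\<^esub>} \<subseteq> Y"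
    and onto: "\<And>b. b \<in> carrier B \<Longrightarrow> \<exists>v\<in>FE A (Xs 0 \<inter> Y). augm A B \<phi> m v = b"
    and exact0: "\<And>v. v \<in> FE A (Xs 0 \<inter> Y) \<Longrightarrow> augm A B \<phi> m v = \<zero>\<^bsub>B\<^esub> \<Longrightarrow>
      \<exists>u\<in>FE A (Xs (Suc 0) \<inter> Y). v = dmap A (d 0) u"
    and exact: "\<And>n v. v \<in> FE A (Xs (Suc n) \<inter> Y) \<Longrightarrow> dmap A (d n) v = (\<lambda>_. \<zero>\<^bsub>A\<^esub>) \<Longrightarrow>
      \<exists>u\<in>FE A (Xs (Suc (Suc n)) \<inter> Y). v = dmap A (d (Suc n)) u"
  shows "free_resolution A B \<phi> (\<lambda>n. Xs n \<inter> Y) d m"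
proof (rule free_resolutionI)
  interpret ring_hom_ring A B \<phi> by fact
  note D = free_resolutionD[OF res]
  have dc: "d n y x \<in> carrier A" if "y \<in> Xs (Suc n) \<inter> Y" for n y x
    using FED(1)[OF D(1)] that by blast
  have bd: "{x. dmap A (d n) u x \<noteq> \<zero>\<^bsub>A\<^esub>} \<subseteq> Y" if u: "u \<in> FE A (Xs (Suc n) \<inter> Y)" for n u
  proof
    fix x assume "x \<in> {x. dmap A (d n) u x \<noteq> \<zero>\<^bsub>A\<^esub>}"
    then obtain y where "y \<in> Xs (Suc n) \<inter> Y" "d n y x \<noteq> \<zero>\<^bsub>A\<^esub>"
      using R.dmap_nonzero[OF u, of "d n" x] dc by blast
    then show "x \<in> Y" using supp by blast
  qed
  show "d n y \<in> FE A (Xs n \<inter> Y)" if "y \<in> Xs (Suc n) \<inter> Y" for n y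
    using D(1)[of y n] supp[of y n] that unfolding FE_subset_iff by simp
  show "m x \<in> carrier B" if "x \<in> Xs 0 \<inter> Y" for x using D(2) that by simp
  show "augm A B \<phi> m ` FE A (Xs 0 \<inter> Y) = carrier B"
  proof
    show "augm A B \<phi> m ` FE A (Xs 0 \<inter> Y) \<subseteq> carrier B"
      using D(3) FE_mono by blast
    show "carrier B \<subseteq> augm A B \<phi> m ` FE A (Xs 0 \<inter> Y)"
      using onto by blast
  qed
  show "{v \<in> FE A (Xs 0 \<inter> Y). augm A B \<phi> m v = \<zero>\<^bsub>B\<^esub>} = dmap A (d 0) ` FE A (Xs (Suc 0) \<inter> Y)"
  proof
    show "{v \<in> FE A (Xs 0 \<inter> Y). augm A B \<phi> m v = \<zero>\<^bsub>B\<^esub>} \<subseteq> dmap A (d 0) ` FE A (Xs (Suc 0) \<inter> Y)"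
      using exact0 by blast
    show "dmap A (d 0) ` FE A (Xs (Suc 0) \<inter> Y) \<subseteq> {v \<in> FE A (Xs 0 \<inter> Y). augm A B \<phi> m v = \<zero>\<^bsub>B\<^esub>}"
    proof
      fix v assume "v \<in> dmap A (d 0) ` FE A (Xs (Suc 0) \<inter> Y)"
      then obtain u where u: "v = dmap A (d 0) u" "u \<in> FE A (Xs (Suc 0) \<inter> Y)" by (rule imageE)
      have "v \<in> dmap A (d 0) ` FE A (Xs (Suc 0))" unfolding u(1) by (rule imageI[OF FE_mono[OF u(2)]])
      then have "v \<in> FE A (Xs 0) \<and> augm A B \<phi> m v = \<zero>\<^bsub>B\<^esub>" unfolding D(4)[symmetric] by simp
      then show "v \<in> {v \<in> FE A (Xs 0 \<inter> Y). augm A B \<phi> m v = \<zero>\<^bsub>B\<^esub>}"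
        using bd[OF u(2)] unfolding u(1) FE_subset_iff by simp
    qed
  qed
  fix n
  show "{v \<in> FE A (Xs (Suc n) \<inter> Y). dmap A (d n) v = (\<lambda>_. \<zero>\<^bsub>A\<^esub>)} =
      dmap A (d (Suc n)) ` FE A (Xs (Suc (Suc n)) \<inter> Y)"
  proof
    show "{v \<in> FE A (Xs (Suc n) \<inter> Y). dmap A (d n) v = (\<lambda>_. \<zero>\<^bsub>A\<^esub>)} \<subseteq>
        dmap A (d (Suc n)) ` FE A (Xs (Suc (Suc n)) \<inter> Y)"
      using exact by blast
    show "dmap A (d (Suc n)) ` FE A (Xs (Suc (Suc n)) \<inter> Y) \<subseteq>
        {v \<in> FE A (Xs (Suc n) \<inter> Y). dmap A (d n) v = (\<lambda>_. \<zero>\<^bsub>A\<^esub>)}"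
    proof
      fix v assume "v \<in> dmap A (d (Suc n)) ` FE A (Xs (Suc (Suc n)) \<inter> Y)"
      then obtain u where u: "v = dmap A (d (Suc n)) u" "u \<in> FE A (Xs (Suc (Suc n)) \<inter> Y)" by (rule imageE)
      have "v \<in> dmap A (d (Suc n)) ` FE A (Xs (Suc (Suc n)))"
        unfolding u(1) by (rule imageI[OF FE_mono[OF u(2)]])
      then have "v \<in> FE A (Xs (Suc n)) \<and> dmap A (d n) v = (\<lambda>_. \<zero>\<^bsub>A\<^esub>)" unfolding D(5)[symmetric] by simp
      then show "v \<in> {v \<in> FE A (Xs (Suc n) \<inter> Y). dmap A (d n) v = (\<lambda>_. \<zero>\<^bsub>A\<^esub>)}"
        using bd[OF u(2)] unfolding u(1) FE_subset_iff by simp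
    qed
  qed
qed

text \<open>Transports a vector along an injection, with \<open>z\<close> off the image.
  \<open>U\<close> will contain the index sets of all degrees, so one inverse of
  \<open>\<iota>\<close> serves the whole complex.\<close>

definition push :: "('i \<Rightarrow> 'j) \<Rightarrow> 'i set \<Rightarrow> 'c \<Rightarrow> ('i \<Rightarrow> 'c) \<Rightarrow> 'j \<Rightarrow> 'c" where
  "push \<iota> U z v = (\<lambda>x. if x \<in> \<iota> ` U then v (inv_into U \<iota> x) else z)"

lemma push_apply: "inj_on \<iota> U \<Longrightarrow> x \<in> U \<Longrightarrow> push \<iota> U z v (\<iota> x) = v x"
  by (simp add: push_def)

lemma push_outside: "x \<notin> \<iota> ` U \<Longrightarrow> push \<iota> U z v x = z"
  by (simp add: push_def)

lemma push_support:
  assumes "inj_on \<iota> U" "Z \<subseteq> U" "v \<in> FE R Z"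
  shows "{x. push \<iota> U \<zero>\<^bsub>R\<^esub> v x \<noteq> \<zero>\<^bsub>R\<^esub>} = \<iota> ` {x. v x \<noteq> \<zero>\<^bsub>R\<^esub>}"
proof (intro Set.set_eqI iffI)
  fix x assume x: "x \<in> {x. push \<iota> U \<zero>\<^bsub>R\<^esub> v x \<noteq> \<zero>\<^bsub>R\<^esub>}"
  then have "x \<in> \<iota> ` U" unfolding push_def by (simp split: if_splits)
  then obtain y where "y \<in> U" "x = \<iota> y" by blast
  then show "x \<in> \<iota> ` {x. v x \<noteq> \<zero>\<^bsub>R\<^esub>}" using x by (auto simp: push_apply[OF assms(1)])
next
  fix x assume "x \<in> \<iota> ` {x. v x \<noteq> \<zero>\<^bsub>R\<^esub>}"
  then obtain y where y: "x = \<iota> y" "v y \<noteq> \<zero>\<^bsub>R\<^esub>" by blast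
  then have "y \<in> U" using FED(4)[OF assms(3)] assms(2) by blast
  then show "x \<in> {x. push \<iota> U \<zero>\<^bsub>R\<^esub> v x \<noteq> \<zero>\<^bsub>R\<^esub>}" using y by (simp add: push_apply[OF assms(1)])
qed

lemma push_FE:
  assumes "ring R" "inj_on \<iota> U" "Z \<subseteq> U" "v \<in> FE R Z"
  shows "push \<iota> U \<zero>\<^bsub>R\<^esub> v \<in> FE R (\<iota> ` Z)"
proof (rule FEI)
  note S = push_support[OF assms(2-4)]
  show "push \<iota> U \<zero>\<^bsub>R\<^esub> v x \<in> carrier R" for x
    using FED(1)[OF assms(4)] ring.ring_simprules(2)[OF assms(1)] by (simp add: push_def)
  show "push \<iota> U \<zero>\<^bsub>R\<^esub> v x = \<zero>\<^bsub>R\<^esub>" if "x \<notin> \<iota> ` Z" for x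
    using S that FED(4)[OF assms(4)] by blast
  show "finite (\<iota> ` {x. v x \<noteq> \<zero>\<^bsub>R\<^esub>})" using FED(3)[OF assms(4)] by simp
  show "{x. push \<iota> U \<zero>\<^bsub>R\<^esub> v x \<noteq> \<zero>\<^bsub>R\<^esub>} \<subseteq> \<iota> ` {x. v x \<noteq> \<zero>\<^bsub>R\<^esub>}" using S by simp
qed

lemma push_inject:
  assumes "inj_on \<iota> U" "Z \<subseteq> U" "v \<in> FE R Z" "w \<in> FE R Z"
    "push \<iota> U \<zero>\<^bsub>R\<^esub> v = push \<iota> U \<zero>\<^bsub>R\<^esub> w"
  shows "v = w"
proof
  fix x
  show "v x = w x"
  proof (cases "x \<in> U")
    case True
    then show ?thesis using fun_cong[OF assms(5), of "\<iota> x"] by (simp add: push_apply[OF assms(1)])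
  next
    case False
    then have "x \<notin> Z" using assms(2) by blast
    then show ?thesis using FED(2)[OF assms(3)] FED(2)[OF assms(4)] by simp
  qed
qed

lemma push_image_FE:
  assumes "ring R" "inj_on \<iota> U" "Z \<subseteq> U"
  shows "FE R (\<iota> ` Z) = push \<iota> U \<zero>\<^bsub>R\<^esub> ` FE R Z"
proof
  show "push \<iota> U \<zero>\<^bsub>R\<^esub> ` FE R Z \<subseteq> FE R (\<iota> ` Z)" using push_FE[OF assms] by blast
  show "FE R (\<iota> ` Z) \<subseteq> push \<iota> U \<zero>\<^bsub>R\<^esub> ` FE R Z"
  proof
    fix w assume w: "w \<in> FE R (\<iota> ` Z)"
    define v where "v x = (if x \<in> Z then w (\<iota> x) else \<zero>\<^bsub>R\<^esub>)" for x
    have sub: "{x. v x \<noteq> \<zero>\<^bsub>R\<^esub>} \<subseteq> Z" by (auto simp: v_def)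
    have "\<iota> ` {x. v x \<noteq> \<zero>\<^bsub>R\<^esub>} \<subseteq> {x. w x \<noteq> \<zero>\<^bsub>R\<^esub>}" by (auto simp: v_def)
    moreover have "inj_on \<iota> {x. v x \<noteq> \<zero>\<^bsub>R\<^esub>}" using assms(2,3) sub by (metis inj_on_subset subset_trans)
    ultimately have "finite {x. v x \<noteq> \<zero>\<^bsub>R\<^esub>}" using FED(3)[OF w] finite_imageD finite_subset by metis
    then have v: "v \<in> FE R Z"
      by (rule FEI[rotated 2])
        (use FED(1)[OF w] ring.ring_simprules(2)[OF assms(1)] in \<open>auto simp: v_def\<close>)
    have "w x = push \<iota> U \<zero>\<^bsub>R\<^esub> v x" for x
    proof (cases "x \<in> \<iota> ` Z")
      case True
      then obtain y where "y \<in> Z" "x = \<iota> y" by blast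
      then show ?thesis using assms(3) by (auto simp: push_apply[OF assms(2), of y] v_def)
    next
      case False
      then show ?thesis using FED(2)[OF w] FED(2)[OF push_FE[OF assms v]] by simp
    qed
    then have "w = push \<iota> U \<zero>\<^bsub>R\<^esub> v" by blast
    then show "w \<in> push \<iota> U \<zero>\<^bsub>R\<^esub> ` FE R Z" using v by (rule image_eqI)
  qed
qed

lemma dmap_push:
  assumes "ring R" and inj: "inj_on \<iota> U" and Z: "Z \<subseteq> U" and v: "v \<in> FE R Z"
    and D: "\<And>y x. y \<in> Z \<Longrightarrow> D y x \<in> carrier R"
  shows "dmap R (\<lambda>y. push \<iota> U \<zero>\<^bsub>R\<^esub> (D (inv_into U \<iota> y))) (push \<iota> U \<zero>\<^bsub>R\<^esub> v) =
    push \<iota> U \<zero>\<^bsub>R\<^esub> (dmap R D v)"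
proof
  interpret ring R by fact
  fix x
  let ?F = "{y. v y \<noteq> \<zero>\<^bsub>R\<^esub>}"
  let ?g = "\<lambda>y. push \<iota> U \<zero>\<^bsub>R\<^esub> (D (inv_into U \<iota> y)) x \<otimes>\<^bsub>R\<^esub> push \<iota> U \<zero>\<^bsub>R\<^esub> v y"
  have FZ: "?F \<subseteq> Z" by (rule FED(4)[OF v])
  have FU: "?F \<subseteq> U" using FZ Z by blast
  have pc: "push \<iota> U \<zero>\<^bsub>R\<^esub> (D y) x \<in> carrier R" if "y \<in> Z" for y
    using D that by (simp add: push_def)
  have g: "?g (\<iota> y) = push \<iota> U \<zero>\<^bsub>R\<^esub> (D y) x \<otimes>\<^bsub>R\<^esub> v y" if "y \<in> ?F" for y
  proof -
    have "y \<in> U" using that FU by blast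
    then show ?thesis using inj by (simp add: push_apply[OF inj])
  qed
  have gc: "?g (\<iota> y) \<in> carrier R" if "y \<in> ?F" for y
  proof -
    have "y \<in> Z" using that FZ by blast
    then show ?thesis unfolding g[OF that] using pc FED(1)[OF v] by simp
  qed
  have "dmap R (\<lambda>y. push \<iota> U \<zero>\<^bsub>R\<^esub> (D (inv_into U \<iota> y))) (push \<iota> U \<zero>\<^bsub>R\<^esub> v) x = (\<Oplus>\<^bsub>R\<^esub>y\<in>\<iota> ` ?F. ?g y)"
    unfolding dmap_def push_support[OF inj Z v] ..
  also have "\<dots> = (\<Oplus>\<^bsub>R\<^esub>y\<in>?F. ?g (\<iota> y))"
    by (rule finsum_reindex) (use gc inj_on_subset[OF inj FU] in auto)
  also have "\<dots> = (\<Oplus>\<^bsub>R\<^esub>y\<in>?F. push \<iota> U \<zero>\<^bsub>R\<^esub> (D y) x \<otimes>\<^bsub>R\<^esub> v y)"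
    by (rule add.finprod_cong') (use g gc in auto)
  also have "\<dots> = push \<iota> U \<zero>\<^bsub>R\<^esub> (dmap R D v) x"
  proof (cases "x \<in> \<iota> ` U")
    case True
    then obtain x0 where "x = \<iota> x0" "x0 \<in> U" by blast
    then show ?thesis by (simp add: push_apply[OF inj] dmap_def)
  next
    case False
    have "(\<Oplus>\<^bsub>R\<^esub>y\<in>?F. push \<iota> U \<zero>\<^bsub>R\<^esub> (D y) x \<otimes>\<^bsub>R\<^esub> v y) = \<zero>\<^bsub>R\<^esub>"
      by (rule add.finprod_one_eqI) (simp add: push_outside[OF False] FED(1)[OF v])
    then show ?thesis by (simp add: push_outside[OF False])
  qed
  finally show "dmap R (\<lambda>y. push \<iota> U \<zero>\<^bsub>R\<^esub> (D (inv_into U \<iota> y))) (push \<iota> U \<zero>\<^bsub>R\<^esub> v) x =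
    push \<iota> U \<zero>\<^bsub>R\<^esub> (dmap R D v) x" .
qed

lemma (in ring_hom_ring) augm_push:
  assumes inj: "inj_on \<iota> U" and Z: "Z \<subseteq> U" and v: "v \<in> FE R Z"
    and m: "\<And>x. x \<in> Z \<Longrightarrow> m x \<in> carrier S"
  shows "augm R S h (\<lambda>x. m (inv_into U \<iota> x)) (push \<iota> U \<zero> v) = augm R S h m v"
proof -
  let ?F = "{y. v y \<noteq> \<zero>}"
  have FZ: "?F \<subseteq> Z" by (rule FED(4)[OF v])
  have FU: "?F \<subseteq> U" using FZ Z by blast
  let ?g = "\<lambda>x. m (inv_into U \<iota> x) \<otimes>\<^bsub>S\<^esub> h (push \<iota> U \<zero> v x)"
  have g: "?g (\<iota> y) = m y \<otimes>\<^bsub>S\<^esub> h (v y)" if "y \<in> ?F" for y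
  proof -
    have "y \<in> U" using that FU by blast
    then show ?thesis using inj by (simp add: push_apply[OF inj])
  qed
  have gc: "?g (\<iota> y) \<in> carrier S" if "y \<in> ?F" for y
  proof -
    have "y \<in> Z" using that FZ by blast
    then show ?thesis unfolding g[OF that] using m FED(1)[OF v] by simp
  qed
  have "augm R S h (\<lambda>x. m (inv_into U \<iota> x)) (push \<iota> U \<zero> v) = (\<Oplus>\<^bsub>S\<^esub>y\<in>\<iota> ` ?F. ?g y)"
    unfolding augm_def push_support[OF inj Z v] ..
  also have "\<dots> = (\<Oplus>\<^bsub>S\<^esub>y\<in>?F. ?g (\<iota> y))"
    by (rule S.finsum_reindex) (use gc inj_on_subset[OF inj FU] in auto)
  also have "\<dots> = (\<Oplus>\<^bsub>S\<^esub>y\<in>?F. m y \<otimes>\<^bsub>S\<^esub> h (v y))"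
    by (rule S.add.finprod_cong') (use g gc in auto)
  finally show ?thesis unfolding augm_def .
qed

lemma free_resolution_reindex:
  assumes hom: "ring_hom_ring A B \<phi>" and res: "free_resolution A B \<phi> Xs d m"
    and tor: "tor_vanishes B \<phi> Xs d" and inj: "inj_on \<iota> U" and U: "\<And>n. Xs n \<subseteq> U"
  shows "\<exists>d' m'. free_resolution A B \<phi> (\<lambda>n. \<iota> ` Xs n) d' m' \<and> tor_vanishes B \<phi> (\<lambda>n. \<iota> ` Xs n) d'"
proof -
  interpret ring_hom_ring A B \<phi> by fact
  note D = free_resolutionD[OF res]
  have dc: "d n y x \<in> carrier A" if "y \<in> Xs (Suc n)" for n y x
    using FED(1)[OF D(1)[OF that]] .
  let ?p = "push \<iota> U \<zero>\<^bsub>A\<^esub>" and ?q = "push \<iota> U \<zero>\<^bsub>B\<^esub>"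
  define d' where "d' n y = ?p (d n (inv_into U \<iota> y))" for n y
  define m' where "m' x = m (inv_into U \<iota> x)" for x
  note imA = push_image_FE[OF R.ring_axioms inj U] and imB = push_image_FE[OF S.ring_axioms inj U]
  have dm: "dmap A (d' n) (?p v) = ?p (dmap A (d n) v)" if "v \<in> FE A (Xs (Suc n))" for n v
    unfolding d'_def by (rule dmap_push[OF R.ring_axioms inj U that dc])
  have tm: "tmap B \<phi> (d' n) (?q w) = ?q (tmap B \<phi> (d n) w)" if w: "w \<in> FE B (Xs (Suc n))" for n w
  proof -
    have "(\<lambda>y x. \<phi> (d' n y x)) = (\<lambda>y. ?q (\<lambda>x. \<phi> (d n (inv_into U \<iota> y) x)))"
      by (intro ext) (simp add: d'_def push_def)
    then show ?thesis
      unfolding tmap_eq_dmap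
      using dmap_push[OF S.ring_axioms inj U w, of "\<lambda>y x. \<phi> (d n y x)"] dc by simp
  qed
  have am: "augm A B \<phi> m' (?p v) = augm A B \<phi> m v" if "v \<in> FE A (Xs 0)" for v
    unfolding m'_def by (rule augm_push[OF inj U that D(2)])
  have p0: "?p (\<lambda>_. \<zero>\<^bsub>A\<^esub>) = (\<lambda>_. \<zero>\<^bsub>A\<^esub>)" by (simp add: push_def)
  have zeroA: "?p v = (\<lambda>_. \<zero>\<^bsub>A\<^esub>) \<longleftrightarrow> v = (\<lambda>_. \<zero>\<^bsub>A\<^esub>)" if "v \<in> FE A (Xs n)" for v n
  proof -
    have z: "(\<lambda>_. \<zero>\<^bsub>A\<^esub>) \<in> FE A (Xs n)" by (simp add: fin_elems_def)
    show ?thesis using push_inject[OF inj U that z] p0 by auto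
  qed
  have bdA: "dmap A (d n) v \<in> FE A (Xs n)" if "v \<in> FE A (Xs (Suc n))" for n v
  proof (cases n)
    case 0
    then show ?thesis using imageI[OF that, of "dmap A (d 0)"] D(4) by auto
  next
    case (Suc k)
    then show ?thesis using imageI[OF that, of "dmap A (d n)"] D(5)[of k] by auto
  qed
  have "free_resolution A B \<phi> (\<lambda>n. \<iota> ` Xs n) d' m'"
  proof (rule free_resolutionI)
    fix n y assume "y \<in> \<iota> ` Xs (Suc n)"
    then obtain x where x: "y = \<iota> x" "x \<in> Xs (Suc n)" by blast
    then have "inv_into U \<iota> y = x" using U inj by (metis inv_into_f_f subsetD)
    then show "d' n y \<in> FE A (\<iota> ` Xs n)"
      unfolding d'_def using push_FE[OF R.ring_axioms inj U D(1)[OF x(2)]] by simp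
  next
    fix y assume "y \<in> \<iota> ` Xs 0"
    then obtain x where x: "y = \<iota> x" "x \<in> Xs 0" by blast
    then have "inv_into U \<iota> y = x" using U inj by (metis inv_into_f_f subsetD)
    then show "m' y \<in> carrier B" using D(2) x by (simp add: m'_def)
  next
    show "augm A B \<phi> m' ` FE A (\<iota> ` Xs 0) = carrier B"
      unfolding imA image_image D(3)[symmetric] by (rule image_cong[OF refl am])
  next
    have "{v \<in> FE A (\<iota> ` Xs 0). augm A B \<phi> m' v = \<zero>\<^bsub>B\<^esub>} =
      ?p ` {v \<in> FE A (Xs 0). augm A B \<phi> m v = \<zero>\<^bsub>B\<^esub>}"
      unfolding imA using am by auto
    also have "\<dots> = dmap A (d' 0) ` FE A (\<iota> ` Xs (Suc 0))"
      unfolding D(4) imA image_image by (rule image_cong[OF refl dm[symmetric]])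
    finally show "{v \<in> FE A (\<iota> ` Xs 0). augm A B \<phi> m' v = \<zero>\<^bsub>B\<^esub>} =
      dmap A (d' 0) ` FE A (\<iota> ` Xs (Suc 0))" .
  next
    fix n
    have "{v \<in> FE A (\<iota> ` Xs (Suc n)). dmap A (d' n) v = (\<lambda>_. \<zero>\<^bsub>A\<^esub>)} =
      ?p ` {v \<in> FE A (Xs (Suc n)). dmap A (d n) v = (\<lambda>_. \<zero>\<^bsub>A\<^esub>)}"
      unfolding imA using dm zeroA[OF bdA] by (auto simp: p0)
    also have "\<dots> = dmap A (d' (Suc n)) ` FE A (\<iota> ` Xs (Suc (Suc n)))"
      unfolding D(5) imA image_image by (rule image_cong[OF refl dm[symmetric]])
    finally show "{v \<in> FE A (\<iota> ` Xs (Suc n)). dmap A (d' n) v = (\<lambda>_. \<zero>\<^bsub>A\<^esub>)} =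
      dmap A (d' (Suc n)) ` FE A (\<iota> ` Xs (Suc (Suc n)))" .
  qed
  moreover have "tor_vanishes B \<phi> (\<lambda>n. \<iota> ` Xs n) d'"
  proof (rule tor_vanishesI)
    fix n w assume "w \<in> FE B (\<iota> ` Xs (Suc n))" and z: "tmap B \<phi> (d' n) w = (\<lambda>_. \<zero>\<^bsub>B\<^esub>)"
    then obtain v where v: "w = ?q v" "v \<in> FE B (Xs (Suc n))" unfolding imB by (elim imageE)
    have "tmap B \<phi> (d n) v x = \<zero>\<^bsub>B\<^esub>" for x
    proof (cases "x \<in> U")
      case True
      then show ?thesis using fun_cong[OF z, of "\<iota> x"] tm[OF v(2)] v(1)
        by (simp add: push_apply[OF inj])
    next
      \<comment> \<open>\<open>push\<close> forgets coordinates outside \<open>U\<close>, so the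
        transported vector says nothing here; instead the entries \<open>d n y x\<close> vanish
        because \<open>d n y\<close> is supported in \<open>Xs n\<close>.\<close>
      case False
      show ?thesis
      proof (rule ccontr)
        assume ne: "tmap B \<phi> (d n) v x \<noteq> \<zero>\<^bsub>B\<^esub>"
        have "\<phi> (d n y x) \<in> carrier B" if "y \<in> Xs (Suc n)" for y using dc[OF that] by simp
        from S.dmap_nonzero[OF v(2), where d = "\<lambda>y x. \<phi> (d n y x)", OF this] ne
        obtain y where y: "y \<in> Xs (Suc n)" "\<phi> (d n y x) \<noteq> \<zero>\<^bsub>B\<^esub>" unfolding tmap_eq_dmap by blast
        then have "d n y x \<noteq> \<zero>\<^bsub>A\<^esub>" by auto
        then have "x \<in> U" using FED(4)[OF D(1)[OF y(1)]] U by blast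
        then show False using False by simp
      qed
    qed
    then obtain u where u: "u \<in> FE B (Xs (Suc (Suc n)))" "v = tmap B \<phi> (d (Suc n)) u"
      using tor_vanishesD[OF tor v(2)] by blast
    then have "w = tmap B \<phi> (d' (Suc n)) (?q u)" using v tm by simp
    then show "\<exists>u\<in>FE B (\<iota> ` Xs (Suc (Suc n))). w = tmap B \<phi> (d' (Suc n)) u"
      using u(1) unfolding imB by blast
  qed
  ultimately show ?thesis by blast
qed

text \<open>The complex of free \<open>A\<close>-modules is kept and only the augmentation is
  composed with \<open>\<psi>\<close>. \<open>\<phi>'\<close> is compared with
  \<open>\<psi> \<circ> \<phi>\<close> on the carrier, since the coset map may differ from it
  elsewhere.\<close>

lemma free_resolution_iso:
  assumes hom: "ring_hom_ring A B \<phi>" and B': "ring B'" and iso: "\<psi> \<in> ring_iso B B'"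
    and \<phi>': "\<And>a. a \<in> carrier A \<Longrightarrow> \<phi>' a = \<psi> (\<phi> a)"
    and res: "free_resolution A B \<phi> Xs d m" and tor: "tor_vanishes B \<phi> Xs d"
  shows "free_resolution A B' \<phi>' Xs d (\<lambda>x. \<psi> (m x)) \<and> tor_vanishes B' \<phi>' Xs d"
proof -
  interpret ring_hom_ring A B \<phi> by fact
  note D = free_resolutionD[OF res]
  have dc: "d n y x \<in> carrier A" if "y \<in> Xs (Suc n)" for n y x
    using FED(1)[OF D(1)[OF that]] .
  interpret p: ring_hom_ring B B' \<psi>
    using iso B' S.ring_axioms by (auto simp: ring_iso_def intro: ring_hom_ringI2)
  have inj: "inj_on \<psi> (carrier B)" and surj: "\<psi> ` carrier B = carrier B'"
    using iso by (auto simp: ring_iso_def bij_betw_def)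
  have psi0: "\<psi> b = \<zero>\<^bsub>B'\<^esub> \<longleftrightarrow> b = \<zero>\<^bsub>B\<^esub>" if "b \<in> carrier B" for b
    using inj_onD[OF inj _ that S.zero_closed] by auto
  have am: "augm A B' \<phi>' (\<lambda>x. \<psi> (m x)) v = \<psi> (augm A B \<phi> m v)" if v: "v \<in> FE A (Xs 0)" for v
  proof -
    let ?F = "{x. v x \<noteq> \<zero>\<^bsub>A\<^esub>}"
    have mc: "m x \<in> carrier B" if "x \<in> ?F" for x using that FED(4)[OF v] D(2) by blast
    have "\<psi> (augm A B \<phi> m v) = (\<Oplus>\<^bsub>B'\<^esub>x\<in>?F. \<psi> (m x \<otimes>\<^bsub>B\<^esub> \<phi> (v x)))"
      unfolding augm_def by (rule p.hom_finsum) (use mc FED(1)[OF v] in auto)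
    also have "\<dots> = (\<Oplus>\<^bsub>B'\<^esub>x\<in>?F. \<psi> (m x) \<otimes>\<^bsub>B'\<^esub> \<phi>' (v x))"
      by (rule p.S.add.finprod_cong') (use mc FED(1)[OF v] \<phi>' in auto)
    finally show ?thesis unfolding augm_def by simp
  qed
  have tm: "tmap B' \<phi>' (d n) (\<lambda>y. \<psi> (w y)) x = \<psi> (tmap B \<phi> (d n) w x)"
    if w: "w \<in> FE B (Xs (Suc n))" for n w x
  proof -
    have "tmap B' \<phi>' (d n) (\<lambda>y. \<psi> (w y)) x = dmap B' (\<lambda>y x. \<psi> (\<phi> (d n y x))) (\<lambda>y. \<psi> (w y)) x"
      unfolding tmap_eq_dmap
      by (rule dmap_cong[OF B' p.FE_hom[OF w]]) (simp_all add: \<phi>' dc)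
    also have "\<dots> = \<psi> (tmap B \<phi> (d n) w x)"
      unfolding tmap_eq_dmap by (rule p.hom_dmap[OF w, symmetric]) (simp add: dc)
    finally show ?thesis .
  qed
  have "free_resolution A B' \<phi>' Xs d (\<lambda>x. \<psi> (m x))"
  proof (rule free_resolutionI)
    show "\<psi> (m x) \<in> carrier B'" if "x \<in> Xs 0" for x using D(2)[OF that] by simp
    have "augm A B' \<phi>' (\<lambda>x. \<psi> (m x)) ` FE A (Xs 0) = \<psi> ` augm A B \<phi> m ` FE A (Xs 0)"
      unfolding image_image by (rule image_cong[OF refl am])
    then show "augm A B' \<phi>' (\<lambda>x. \<psi> (m x)) ` FE A (Xs 0) = carrier B'"
      unfolding D(3) surj .
    have "\<psi> (augm A B \<phi> m v) = \<zero>\<^bsub>B'\<^esub> \<longleftrightarrow> augm A B \<phi> m v = \<zero>\<^bsub>B\<^esub>" if "v \<in> FE A (Xs 0)" for v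
      by (rule psi0[OF augm_closed[OF that D(2)]])
    then have "{v \<in> FE A (Xs 0). augm A B' \<phi>' (\<lambda>x. \<psi> (m x)) v = \<zero>\<^bsub>B'\<^esub>} =
      {v \<in> FE A (Xs 0). augm A B \<phi> m v = \<zero>\<^bsub>B\<^esub>}"
      using am by auto
    then show "{v \<in> FE A (Xs 0). augm A B' \<phi>' (\<lambda>x. \<psi> (m x)) v = \<zero>\<^bsub>B'\<^esub>} =
      dmap A (d 0) ` FE A (Xs (Suc 0))" unfolding D(4) .
    show "{v \<in> FE A (Xs (Suc n)). dmap A (d n) v = (\<lambda>_. \<zero>\<^bsub>A\<^esub>)} =
      dmap A (d (Suc n)) ` FE A (Xs (Suc (Suc n)))" for n by (rule D(5))
  qed (rule D(1))
  moreover have "tor_vanishes B' \<phi>' Xs d"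
  proof (rule tor_vanishesI)
    fix n w' assume w': "w' \<in> FE B' (Xs (Suc n))" and z: "tmap B' \<phi>' (d n) w' = (\<lambda>_. \<zero>\<^bsub>B'\<^esub>)"
    obtain w where w: "w \<in> FE B (Xs (Suc n))" "w' = (\<lambda>x. \<psi> (w x))"
      using p.FE_lift[OF surj w'] by blast
    have "tmap B \<phi> (d n) w x = \<zero>\<^bsub>B\<^esub>" for x
    proof -
      have "tmap B \<phi> (d n) w x \<in> carrier B"
        unfolding tmap_eq_dmap by (rule S.dmap_closed[OF w(1)]) (simp add: dc)
      moreover have "\<psi> (tmap B \<phi> (d n) w x) = \<zero>\<^bsub>B'\<^esub>"
        using tm[OF w(1), of x] fun_cong[OF z, of x] w(2) by simp
      ultimately show ?thesis using psi0 by blast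
    qed
    then obtain u where u: "u \<in> FE B (Xs (Suc (Suc n)))" "w = tmap B \<phi> (d (Suc n)) u"
      using tor_vanishesD[OF tor w(1)] by blast
    have "w' = tmap B' \<phi>' (d (Suc n)) (\<lambda>x. \<psi> (u x))"
      unfolding w(2) u(2) by (rule ext) (rule tm[OF u(1), symmetric])
    then show "\<exists>u\<in>FE B' (Xs (Suc (Suc n))). w' = tmap B' \<phi>' (d (Suc n)) u"
      using p.FE_hom[OF u(1)] by blast
  qed
  ultimately show ?thesis by blast
qed

section \<open>Cutting a resolution down to the size of \<open>A\<close>\<close>

definition chosen_support :: "'c \<Rightarrow> (('i \<Rightarrow> 'c) \<Rightarrow> bool) \<Rightarrow> 'i set" where
  "chosen_support z P = (if \<exists>u. P u then {x. (SOME u. P u) x \<noteq> z} else {})"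

text \<open>One solution is fixed for each predicate, so an index set containing
  \<open>chosen_support z P\<close> supports a solution of \<open>P\<close> whenever there is one;
  an unsolvable \<open>P\<close> contributes nothing.\<close>

lemma chosen_support:
  assumes "P u"
  shows "\<exists>u. P u \<and> {x. u x \<noteq> z} = chosen_support z P"
  using someI[of P, OF assms] assms unfolding chosen_support_def by auto

lemma countable_chosen_support:
  assumes "\<And>u. P u \<Longrightarrow> finite {x. u x \<noteq> z}"
  shows "countable (chosen_support z P)"
proof (cases "\<exists>u. P u")
  case True
  then have "P (SOME u. P u)" by (rule someI_ex)
  from assms[OF this] show ?thesis
    using True by (simp add: chosen_support_def countable_finite)
qed (simp add: chosen_support_def)

text \<open>Lists are the inputs of the closure process; every finitely supported vector is read off
  from one of them.\<close>

definition vec_of :: "'c \<Rightarrow> ('i \<times> 'c) list \<Rightarrow> 'i \<Rightarrow> 'c" where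
  "vec_of z l x = (case map_of l x of None \<Rightarrow> z | Some a \<Rightarrow> a)"

lemma FE_vec_of:
  assumes "v \<in> FE R (Z \<inter> Y)"
  shows "\<exists>l. fst ` set l \<subseteq> Y \<and> vec_of \<zero>\<^bsub>R\<^esub> l = v"
proof -
  obtain xs where xs: "set xs = {x. v x \<noteq> \<zero>\<^bsub>R\<^esub>}"
    using finite_list[OF FED(3)[OF assms]] by blast
  have "vec_of \<zero>\<^bsub>R\<^esub> (map (\<lambda>x. (x, v x)) xs) = v"
    by (rule ext) (simp add: vec_of_def map_of_map_restrict restrict_map_def xs)
  moreover have "fst ` set (map (\<lambda>x. (x, v x)) xs) \<subseteq> Y"
    using FED(4)[OF assms] by (auto simp: xs)
  ultimately show ?thesis by blast
qed

text \<open>Each finitely supported vector forces only countably many further indices. Surjectivity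
  bounds the labels: elements of \<open>B\<close> and vectors over \<open>B\<close> are images of
  elements of \<open>A\<close> and vectors over \<open>A\<close>, so labels in \<open>'a\<close>
  suffice.\<close>

lemma small_subresolution:
  fixes A :: "('a, 'm) ring_scheme" and B :: "('b, 'n) ring_scheme" and Xs :: "nat \<Rightarrow> 'i set"
  assumes hom: "ring_hom_ring A B \<phi>" and surj: "\<phi> ` carrier A = carrier B"
    and res: "free_resolution A B \<phi> Xs d m" and tor: "tor_vanishes B \<phi> Xs d"
  shows "\<exists>Y (\<iota> :: 'i \<Rightarrow> ('a + 'a set) list). inj_on \<iota> Y \<and>
    free_resolution A B \<phi> (\<lambda>n. Xs n \<inter> Y) d m \<and> tor_vanishes B \<phi> (\<lambda>n. Xs n \<inter> Y) d"
proof -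
  interpret ring_hom_ring A B \<phi> by fact
  note D = free_resolutionD[OF res]
  let ?v = "vec_of \<zero>\<^bsub>A\<^esub>"
  define P0 where "P0 l u \<longleftrightarrow> u \<in> FE A (Xs (Suc 0)) \<and> ?v l = dmap A (d 0) u" for l u
  define P where "P n l u \<longleftrightarrow> u \<in> FE A (Xs (Suc (Suc n))) \<and> ?v l = dmap A (d (Suc n)) u" for n l u
  define T where "T n l u \<longleftrightarrow> u \<in> FE B (Xs (Suc (Suc n))) \<and>
    (\<lambda>x. \<phi> (?v l x)) = tmap B \<phi> (d (Suc n)) u" for n l u
  define Ag where "Ag a u \<longleftrightarrow> u \<in> FE A (Xs 0) \<and> augm A B \<phi> m u = \<phi> a" for a u
  define F1 where "F1 l = (\<Union>n. \<Union>y\<in>fst ` set l \<inter> Xs (Suc n). {x. d n y x \<noteq> \<zero>\<^bsub>A\<^esub>})" for l :: "('i \<times> 'a) list"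
  \<comment> \<open>\<open>l\<close> is read both as a vector and as a list of coefficients.
    Collected are the supports of the columns \<open>d n y\<close>, of chosen preimages of the
    vector in every degree, of preimages of its image over \<open>B\<close>, and of a vector
    augmenting to \<open>\<phi> a\<close> for each coefficient \<open>a\<close>.\<close>
  define F where "F l = F1 l \<union> chosen_support \<zero>\<^bsub>A\<^esub> (P0 l) \<union> (\<Union>n. chosen_support \<zero>\<^bsub>A\<^esub> (P n l)) \<union>
    (\<Union>n. chosen_support \<zero>\<^bsub>B\<^esub> (T n l)) \<union> (\<Union>a\<in>snd ` set l. chosen_support \<zero>\<^bsub>A\<^esub> (Ag a))" for l
  have countF: "countable (F l)" for l
  proof -
    have 1: "countable (F1 l)"
    proof -
      have "countable {x. d n y x \<noteq> \<zero>\<^bsub>A\<^esub>}" if "y \<in> Xs (Suc n)" for n y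
        using FED(3)[OF D(1)[OF that]] by (rule countable_finite)
      moreover have "countable (fst ` set l \<inter> Xs (Suc n))" for n by (intro countable_finite) simp
      ultimately have "countable (\<Union>y\<in>fst ` set l \<inter> Xs (Suc n). {x. d n y x \<noteq> \<zero>\<^bsub>A\<^esub>})" for n
        by (intro countable_UN) blast+
      then show ?thesis unfolding F1_def by (rule countable_UN[rotated]) simp
    qed
    have 2: "countable (chosen_support \<zero>\<^bsub>A\<^esub> (P0 l))"
      by (rule countable_chosen_support) (use FED(3) in \<open>unfold P0_def, blast\<close>)
    have 3: "countable (chosen_support \<zero>\<^bsub>A\<^esub> (P n l))" for n
      by (rule countable_chosen_support) (use FED(3) in \<open>unfold P_def, blast\<close>)
    have 4: "countable (chosen_support \<zero>\<^bsub>B\<^esub> (T n l))" for n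
      by (rule countable_chosen_support) (use FED(3) in \<open>unfold T_def, blast\<close>)
    have 5: "countable (chosen_support \<zero>\<^bsub>A\<^esub> (Ag a))" for a
      by (rule countable_chosen_support) (use FED(3) in \<open>unfold Ag_def, blast\<close>)
    show ?thesis unfolding F_def
      by (intro countable_Un 1 2 countable_UN 3 4 5 countable_finite[OF finite_imageI[OF finite_set]])
        simp_all
  qed
  obtain Y and \<iota> :: "'i \<Rightarrow> ('a + 'a set) list" where inj: "inj_on \<iota> Y" and "Y \<noteq> {}"
    and cl: "\<forall>l. fst ` set l \<subseteq> Y \<longrightarrow> F l \<subseteq> Y"
    using small_closed_set[of F, OF countF] by (elim exE conjE)
  \<comment> \<open>An index is needed to form the one-entry list \<open>[(t, a)]\<close> that
    carries a given coefficient \<open>a\<close>.\<close>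
  then obtain t where t: "t \<in> Y" by blast
  note closed = cl[rule_format]
  have "free_resolution A B \<phi> (\<lambda>n. Xs n \<inter> Y) d m"
  proof (rule free_resolution_restrict[OF hom res])
    fix n y assume y: "y \<in> Xs (Suc n)" "y \<in> Y"
    \<comment> \<open>Only the index \<open>y\<close> matters for \<open>F1\<close>; the coefficient
      zero is a filler.\<close>
    have "{x. d n y x \<noteq> \<zero>\<^bsub>A\<^esub>} \<subseteq> F [(y, \<zero>\<^bsub>A\<^esub>)]"
      unfolding F_def F1_def using y by auto
    also have "\<dots> \<subseteq> Y" by (rule closed) (use y in simp)
    finally show "{x. d n y x \<noteq> \<zero>\<^bsub>A\<^esub>} \<subseteq> Y" .
  next
    fix b assume "b \<in> carrier B"
    then obtain a where a: "b = \<phi> a" "a \<in> carrier A" unfolding surj[symmetric] by (rule imageE)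
    then have "b \<in> augm A B \<phi> m ` FE A (Xs 0)" unfolding D(3) by simp
    then obtain u where "Ag a u" unfolding Ag_def a(1) by auto
    from chosen_support[of "Ag a", OF this]
    obtain u where u: "Ag a u" "{x. u x \<noteq> \<zero>\<^bsub>A\<^esub>} = chosen_support \<zero>\<^bsub>A\<^esub> (Ag a)" by blast
    have "{x. u x \<noteq> \<zero>\<^bsub>A\<^esub>} \<subseteq> F [(t, a)]" unfolding F_def u(2) by auto
    also have "\<dots> \<subseteq> Y" by (rule closed) (use t in simp)
    finally have "u \<in> FE A (Xs 0 \<inter> Y)" using u(1) unfolding Ag_def FE_subset_iff by simp
    then show "\<exists>v\<in>FE A (Xs 0 \<inter> Y). augm A B \<phi> m v = b"
      using u(1) unfolding Ag_def a(1) by blast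
  next
    fix v assume v: "v \<in> FE A (Xs 0 \<inter> Y)" "augm A B \<phi> m v = \<zero>\<^bsub>B\<^esub>"
    obtain l where l: "fst ` set l \<subseteq> Y" "?v l = v" using FE_vec_of[OF v(1)] by blast
    have "v \<in> {v \<in> FE A (Xs 0). augm A B \<phi> m v = \<zero>\<^bsub>B\<^esub>}" using v(2) FE_mono[OF v(1)] by simp
    then obtain u where "P0 l u" unfolding D(4) P0_def l(2) by (elim imageE) simp
    from chosen_support[of "P0 l", OF this]
    obtain u where u: "P0 l u" "{x. u x \<noteq> \<zero>\<^bsub>A\<^esub>} = chosen_support \<zero>\<^bsub>A\<^esub> (P0 l)" by blast
    have "{x. u x \<noteq> \<zero>\<^bsub>A\<^esub>} \<subseteq> F l" unfolding F_def u(2) by auto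
    also have "\<dots> \<subseteq> Y" by (rule closed[OF l(1)])
    finally have "u \<in> FE A (Xs (Suc 0) \<inter> Y)" using u(1) unfolding P0_def FE_subset_iff by simp
    then show "\<exists>u\<in>FE A (Xs (Suc 0) \<inter> Y). v = dmap A (d 0) u"
      using u(1) unfolding P0_def l(2) by blast
  next
    fix n v assume v: "v \<in> FE A (Xs (Suc n) \<inter> Y)" "dmap A (d n) v = (\<lambda>_. \<zero>\<^bsub>A\<^esub>)"
    obtain l where l: "fst ` set l \<subseteq> Y" "?v l = v" using FE_vec_of[OF v(1)] by blast
    have "v \<in> {v \<in> FE A (Xs (Suc n)). dmap A (d n) v = (\<lambda>_. \<zero>\<^bsub>A\<^esub>)}" using v(2) FE_mono[OF v(1)] by simp
    then obtain u where "P n l u" unfolding D(5) P_def l(2) by (elim imageE) simp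
    from chosen_support[of "P n l", OF this]
    obtain u where u: "P n l u" "{x. u x \<noteq> \<zero>\<^bsub>A\<^esub>} = chosen_support \<zero>\<^bsub>A\<^esub> (P n l)" by blast
    have "{x. u x \<noteq> \<zero>\<^bsub>A\<^esub>} \<subseteq> F l" unfolding F_def u(2) by auto
    also have "\<dots> \<subseteq> Y" by (rule closed[OF l(1)])
    finally have "u \<in> FE A (Xs (Suc (Suc n)) \<inter> Y)" using u(1) unfolding P_def FE_subset_iff by simp
    then show "\<exists>u\<in>FE A (Xs (Suc (Suc n)) \<inter> Y). v = dmap A (d (Suc n)) u"
      using u(1) unfolding P_def l(2) by blast
  qed
  moreover have "tor_vanishes B \<phi> (\<lambda>n. Xs n \<inter> Y) d"
  proof (rule tor_vanishesI)
    fix n w assume w: "w \<in> FE B (Xs (Suc n) \<inter> Y)" "tmap B \<phi> (d n) w = (\<lambda>_. \<zero>\<^bsub>B\<^esub>)"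
    obtain v where v: "v \<in> FE A (Xs (Suc n) \<inter> Y)" "w = (\<lambda>x. \<phi> (v x))" using FE_lift[OF surj w(1)] by blast
    obtain l where l: "fst ` set l \<subseteq> Y" "?v l = v" using FE_vec_of[OF v(1)] by blast
    obtain u where "T n l u"
      using tor_vanishesD[OF tor FE_mono[OF w(1)] w(2)] unfolding T_def l(2) v(2) by blast
    from chosen_support[of "T n l", OF this]
    obtain u where u: "T n l u" "{x. u x \<noteq> \<zero>\<^bsub>B\<^esub>} = chosen_support \<zero>\<^bsub>B\<^esub> (T n l)" by blast
    have "{x. u x \<noteq> \<zero>\<^bsub>B\<^esub>} \<subseteq> F l" unfolding F_def u(2) by auto
    also have "\<dots> \<subseteq> Y" by (rule closed[OF l(1)])
    finally have "u \<in> FE B (Xs (Suc (Suc n)) \<inter> Y)" using u(1) unfolding T_def FE_subset_iff by simp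
    then show "\<exists>u\<in>FE B (Xs (Suc (Suc n)) \<inter> Y). w = tmap B \<phi> (d (Suc n)) u"
      using u(1) unfolding T_def l(2) v(2) by blast
  qed
  ultimately show ?thesis using inj by blast
qed

section \<open>The quotient by the kernel\<close>

lemma ring_epi_Quot:
  assumes "ideal I A"
  shows "ring_epi A (A Quot I) (\<lambda>a. I +>\<^bsub>A\<^esub> a)"
proof -
  interpret ideal I A by fact
  show ?thesis
    unfolding ring_epi_def carrier_Quot
    using ring_axioms quotient_is_ring rcos_ring_hom by simp
qed

lemma homological_epi_Quot_kernel:
  fixes A :: "('a, 'm) ring_scheme" and B :: "('b, 'n) ring_scheme"
  assumes hom: "ring_hom_ring A B \<phi>" and surj: "\<phi> ` carrier A = carrier B"
    and epi: "homological_epi A B \<phi>"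
  shows "homological_epi A (A Quot a_kernel A B \<phi>) (\<lambda>a. a_kernel A B \<phi> +>\<^bsub>A\<^esub> a)"
proof -
  interpret ring_hom_ring A B \<phi> by fact
  let ?I = "a_kernel A B \<phi>"
  interpret I: ideal ?I A by (rule kernel_is_ideal)
  obtain Xs :: "nat \<Rightarrow> ('a + 'b) list set" and d m where
    res: "free_resolution A B \<phi> Xs d m" and tor: "tor_vanishes B \<phi> Xs d"
    using epi unfolding homological_epi_def by blast
  obtain Y and \<iota> :: "('a + 'b) list \<Rightarrow> ('a + 'a set) list" where inj: "inj_on \<iota> Y"
    and "free_resolution A B \<phi> (\<lambda>n. Xs n \<inter> Y) d m" "tor_vanishes B \<phi> (\<lambda>n. Xs n \<inter> Y) d"
    using small_subresolution[OF hom surj res tor] by blast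
  from free_resolution_reindex[OF hom this(2,3) inj Int_lower2]
  obtain d' m' where res': "free_resolution A B \<phi> (\<lambda>n. \<iota> ` (Xs n \<inter> Y)) d' m'"
    and tor': "tor_vanishes B \<phi> (\<lambda>n. \<iota> ` (Xs n \<inter> Y)) d'" by blast
  \<comment> \<open>The isomorphism from \<open>A Quot ?I\<close> to \<open>B\<close> induced by
    \<open>\<phi>\<close>. Its inverse \<open>\<psi>\<close> sends \<open>\<phi> a\<close> to the
    coset of \<open>a\<close>, so it carries the resolution of \<open>B\<close> to one of the
    quotient.\<close>
  let ?\<theta> = "\<lambda>Z. the_elem (\<phi> ` Z)"
  define \<psi> where "\<psi> = inv_into (carrier (A Quot ?I)) ?\<theta>"
  have \<theta>: "?\<theta> \<in> ring_iso (A Quot ?I) B" by (rule FactRing_iso_set[OF surj])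
  have \<psi>: "\<psi> \<in> ring_iso B (A Quot ?I)"
    unfolding \<psi>_def by (rule ring_iso_set_sym[OF I.quotient_is_ring \<theta>])
  have "?I +>\<^bsub>A\<^esub> a = \<psi> (\<phi> a)" if a: "a \<in> carrier A" for a
  proof -
    have "\<phi> ` (?I +>\<^bsub>A\<^esub> a) = {\<phi> a}"
    proof
      show "\<phi> ` (?I +>\<^bsub>A\<^esub> a) \<subseteq> {\<phi> a}"
        using a rcos_imp_homeq by blast
      show "{\<phi> a} \<subseteq> \<phi> ` (?I +>\<^bsub>A\<^esub> a)" using I.a_rcos_self[OF a] by blast
    qed
    then have "?\<theta> (?I +>\<^bsub>A\<^esub> a) = \<phi> a" by simp
    moreover have "?I +>\<^bsub>A\<^esub> a \<in> carrier (A Quot ?I)" using a by (simp add: carrier_Quot)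
    ultimately show ?thesis
      unfolding \<psi>_def using \<theta> by (metis (no_types, lifting) bij_betw_def inv_into_f_f mem_Collect_eq ring_iso_def)
  qed
  from free_resolution_iso[OF hom I.quotient_is_ring \<psi> this res' tor']
  show ?thesis
    unfolding homological_epi_def using ring_epi_Quot[OF I.ideal_axioms] by blast
qed

theorem theorem3p1:
  fixes A :: "'a ring" and B :: "'b ring" and \<phi> :: "'a \<Rightarrow> 'b"
  assumes epi: "ring_epi A B \<phi>"
    and perfA: "right_perfect A \<or> left_perfect A"
    and slB: "semilocal B"
    and basicB: "basic_ring B"
  shows "\<phi> ` carrier A = carrier B \<and>
         (homological_epi A B \<phi> \<longrightarrow>
            stratifying_ideal A (a_kernel A B \<phi>) \<and>
            (\<exists>e \<in> carrier A. e \<otimes>\<^bsub>A\<^esub> e = e \<and> a_kernel A B \<phi> = Idl\<^bsub>A\<^esub> {e}))"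
proof (intro conjI impI)
  interpret ring_hom_ring A B \<phi>
    using epi by (simp add: ring_epi_def ring_hom_ringI2)
  show surj: "\<phi> ` carrier A = carrier B"
    by (rule epi_surjective[OF epi perfA basicB])
  assume hepi: "homological_epi A B \<phi>"
  then obtain Xs :: "nat \<Rightarrow> ('a + 'b) list set" and d m where
    "free_resolution A B \<phi> Xs d m" "tor_vanishes B \<phi> Xs d"
    unfolding homological_epi_def by blast
  from tor_vanishes_kernel_idempotent[OF this surj]
  show e: "\<exists>e \<in> carrier A. e \<otimes>\<^bsub>A\<^esub> e = e \<and> a_kernel A B \<phi> = Idl\<^bsub>A\<^esub> {e}"
    by (rule R.perfect_idempotent_ideal[OF perfA kernel_is_ideal])
  show "stratifying_ideal A (a_kernel A B \<phi>)"
    unfolding stratifying_ideal_def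
    using e homological_epi_Quot_kernel[OF ring_hom_ring_axioms surj hepi] by blast
qed

end
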